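(* For $n\in\mathbf{N}$ (including $n=0$), let $T^n=\prod_{i=1}^n S^1$ denote the $n$-torus, so that $T^0$ is a point. Then the family $\{T^n\}_{n\in\mathbf{N}}$ is a strong generator for the 2-category $\underline{\mathbf{Hot}}$ of spaces. That is, if $f:X\to Y$ is any morphism of $\underline{\mathbf{Hot}}$ such that for every $n\in\mathbf{N}$ the induced functor $\underline{\mathbf{Hot}}(T^n,f):\underline{\mathbf{Hot}}(T^n,X)\to\underline{\mathbf{Hot}}(T^n,Y)$ is an equivalence of categories, then $f$ is an equivalence in $\underline{\mathbf{Hot}}$.
   Context: $\underline{\mathbf{Hot}}$ is the 2-category whose objects are CW complexes (equivalently, Kan complexes), not assumed pointed or connected, and whose hom-categories are the fundamental groupoids of mapping spaces: $\underline{\mathbf{Hot}}(X,Y)=\Pi_1(Y^X)$. Thus an object of $\underline{\mathbf{Hot}}(X,Y)$ is a continuous map $X\to Y$, and a morphism from $f$ to $g$ is an equivalence class of homotopies $X\times I\to Y$ from $f$ to $g$, where two such homotopies are identified if there is a homotopy $X\times I\times I\to Y$ between them that is constant at $f$ on $X\times\{0\}\times I$ and constant at $g$ on $X\times\{1\}\times I$. Composition is the usual composition of maps and of homotopies. For a morphism $f:X\to Y$, the functor $\underline{\mathbf{Hot}}(G,f)$ is postcomposition with $f$. A morphism $f:X\to Y$ of a 2-category is an equivalence if there is a morphism $g:Y\to X$ with $gf$ and $fg$ isomorphic, via invertible 2-morphisms, to the respective identities. A small set $\mathcal{G}$ of objects of a 2-category $\mathcal{K}$ is a strong generator for $\mathcal{K}$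 if it jointly detects equivalences: whenever $f:X\to Y$ is a morphism in $\mathcal{K}$ such that $\mathcal{K}(G,f):\mathcal{K}(G,X)\to\mathcal{K}(G,Y)$ is an equivalence of categories for every $G\in\mathcal{G}$, then $f$ is an equivalence in $\mathcal{K}$. *)

theory Defs
  imports "HOL-Analysis.Analysis"
begin

section \<open>Categories and equivalences of categories\<close>

text \<open>
  The categories considered below have pairwise disjoint hom-sets, so an arrow determines its
  endpoints; composition and the arrow part of a functor therefore take only arrows as arguments.
  \<open>Comp C h k\<close> is the composite of \<open>k\<close> followed by \<open>h\<close>.
\<close>

record ('o, 'm) cat =
  Obj :: "'o set"
  Hom :: "'o \<Rightarrow> 'o \<Rightarrow> 'm set"
  Id :: "'o \<Rightarrow> 'm"
  Comp :: "'m \<Rightarrow> 'm \<Rightarrow> 'm"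

definition is_functor ::
  "('o, 'm) cat \<Rightarrow> ('p, 'n) cat \<Rightarrow> ('o \<Rightarrow> 'p) \<Rightarrow> ('m \<Rightarrow> 'n) \<Rightarrow> bool" where
  "is_functor C D Fo Fm \<longleftrightarrow>
     (\<forall>a \<in> Obj C. Fo a \<in> Obj D) \<and>
     (\<forall>a \<in> Obj C. \<forall>b \<in> Obj C. \<forall>h \<in> Hom C a b. Fm h \<in> Hom D (Fo a) (Fo b)) \<and>
     (\<forall>a \<in> Obj C. Fm (Id C a) = Id D (Fo a)) \<and>
     (\<forall>a \<in> Obj C. \<forall>b \<in> Obj C. \<forall>c \<in> Obj C. \<forall>k \<in> Hom C a b. \<forall>h \<in> Hom C b c.
        Fm (Comp C h k) = Comp D (Fm h) (Fm k))"

definition is_iso :: "('o, 'm) cat \<Rightarrow> 'o \<Rightarrow> 'o \<Rightarrow> 'm \<Rightarrow> bool" where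
  "is_iso C a b h \<longleftrightarrow>
     h \<in> Hom C a b \<and> (\<exists>k \<in> Hom C b a. Comp C k h = Id C a \<and> Comp C h k = Id C b)"

definition isomorphic_objects :: "('o, 'm) cat \<Rightarrow> 'o \<Rightarrow> 'o \<Rightarrow> bool" where
  "isomorphic_objects C a b \<longleftrightarrow> a \<in> Obj C \<and> b \<in> Obj C \<and> (\<exists>h. is_iso C a b h)"

definition naturally_isomorphic ::
  "('o, 'm) cat \<Rightarrow> ('p, 'n) cat \<Rightarrow> ('o \<Rightarrow> 'p) \<Rightarrow> ('m \<Rightarrow> 'n) \<Rightarrow> ('o \<Rightarrow> 'p) \<Rightarrow> ('m \<Rightarrow> 'n) \<Rightarrow> bool" where
  "naturally_isomorphic C D Fo Fm Go Gm \<longleftrightarrow>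
     (\<exists>\<eta>. (\<forall>a \<in> Obj C. is_iso D (Fo a) (Go a) (\<eta> a)) \<and>
          (\<forall>a \<in> Obj C. \<forall>b \<in> Obj C. \<forall>h \<in> Hom C a b.
             Comp D (Gm h) (\<eta> a) = Comp D (\<eta> b) (Fm h)))"

definition equivalence_of_categories ::
  "('o, 'm) cat \<Rightarrow> ('p, 'n) cat \<Rightarrow> ('o \<Rightarrow> 'p) \<Rightarrow> ('m \<Rightarrow> 'n) \<Rightarrow> bool" where
  "equivalence_of_categories C D Fo Fm \<longleftrightarrow>
     is_functor C D Fo Fm \<and>
     (\<exists>Go Gm. is_functor D C Go Gm \<and>
        naturally_isomorphic C C (\<lambda>a. a) (\<lambda>h. h) (\<lambda>a. Go (Fo a)) (\<lambda>h. Gm (Fm h)) \<and>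
        naturally_isomorphic D D (\<lambda>b. Fo (Go b)) (\<lambda>k. Fm (Gm k)) (\<lambda>b. b) (\<lambda>k. k))"


section \<open>CW complexes\<close>

definition disc :: "nat \<Rightarrow> (nat \<Rightarrow> real) topology" where
  "disc n = subtopology (Euclidean_space n) {x. (\<Sum>i<n. (x i)\<^sup>2) \<le> 1}"

definition disc_interior :: "nat \<Rightarrow> (nat \<Rightarrow> real) set" where
  "disc_interior n = {x \<in> topspace (disc n). (\<Sum>i<n. (x i)\<^sup>2) < 1}"

definition disc_boundary :: "nat \<Rightarrow> (nat \<Rightarrow> real) set" where
  "disc_boundary n = {x \<in> topspace (disc n). (\<Sum>i<n. (x i)\<^sup>2) = 1}"

text \<open>
  J. H. C. Whitehead's definition: \<open>E n\<close> is the set of open \<open>n\<close>-cells, as subsets of the space,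
  and \<open>\<Phi> e\<close> is a characteristic map of the cell \<open>e\<close>. The last two conditions are closure
  finiteness and the weak topology.
\<close>

definition CW_structure ::
  "'a topology \<Rightarrow> (nat \<Rightarrow> 'a set set) \<Rightarrow> ('a set \<Rightarrow> (nat \<Rightarrow> real) \<Rightarrow> 'a) \<Rightarrow> bool" where
  "CW_structure X E \<Phi> \<longleftrightarrow>
     (\<Union>n. \<Union>(E n)) = topspace X \<and>
     (\<forall>m n. \<forall>d \<in> E m. \<forall>e \<in> E n. (m, d) \<noteq> (n, e) \<longrightarrow> disjnt d e) \<and>
     (\<forall>n. \<forall>e \<in> E n. continuous_map (disc n) X (\<Phi> e) \<and>
        homeomorphic_map (subtopology (disc n) (disc_interior n)) (subtopology X e) (\<Phi> e)) \<and>
     (\<forall>n. \<forall>e \<in> E n. \<exists>F. finite F \<and> F \<subseteq> (\<Union>m<n. E m) \<and> \<Phi> e ` disc_boundary n \<subseteq> \<Union>F) \<and>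
     (\<forall>A \<subseteq> topspace X. closedin X A \<longleftrightarrow> (\<forall>n. \<forall>e \<in> E n. closedin X (A \<inter> (X closure_of e))))"

definition CW_complex :: "'a topology \<Rightarrow> bool" where
  "CW_complex X \<longleftrightarrow> Hausdorff_space X \<and> (\<exists>E \<Phi>. CW_structure X E \<Phi>)"


section \<open>The 2-category of spaces\<close>

abbreviation unit_interval :: "real topology" where
  "unit_interval \<equiv> top_of_set {0..1}"

text \<open>Maps are made extensional so that each continuous map is represented by exactly one function.\<close>

definition maps :: "'a topology \<Rightarrow> 'b topology \<Rightarrow> ('a \<Rightarrow> 'b) set" where
  "maps X Y = {f \<in> extensional (topspace X). continuous_map X Y f}"

definition homotopies ::
  "'a topology \<Rightarrow> 'b topology \<Rightarrow> ('a \<Rightarrow> 'b) \<Rightarrow> ('a \<Rightarrow> 'b) \<Rightarrow> ('a \<times> real \<Rightarrow> 'b) set" where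
  "homotopies X Y f g =
     {H \<in> maps (prod_topology X unit_interval) Y.
        (\<forall>x \<in> topspace X. H (x, 0) = f x) \<and> (\<forall>x \<in> topspace X. H (x, 1) = g x)}"

text \<open>Homotopy of homotopies, constant on \<open>X \<times> {0}\<close> and on \<open>X \<times> {1}\<close>.\<close>

definition homotopy_rel ::
  "'a topology \<Rightarrow> 'b topology \<Rightarrow> (('a \<times> real \<Rightarrow> 'b) \<times> ('a \<times> real \<Rightarrow> 'b)) set" where
  "homotopy_rel X Y =
     {(H, K). H \<in> maps (prod_topology X unit_interval) Y \<and>
        K \<in> maps (prod_topology X unit_interval) Y \<and>
        homotopic_with
          (\<lambda>L. \<forall>x \<in> topspace X. L (x, 0) = H (x, 0) \<and> L (x, 1) = H (x, 1))
          (prod_topology X unit_interval) Y H K}"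

definition const_homotopy :: "'a topology \<Rightarrow> ('a \<Rightarrow> 'b) \<Rightarrow> ('a \<times> real \<Rightarrow> 'b)" where
  "const_homotopy X f = (\<lambda>(x, t) \<in> topspace X \<times> {0..1}. f x)"

definition concat_homotopy ::
  "'a topology \<Rightarrow> ('a \<times> real \<Rightarrow> 'b) \<Rightarrow> ('a \<times> real \<Rightarrow> 'b) \<Rightarrow> ('a \<times> real \<Rightarrow> 'b)" where
  "concat_homotopy X H K =
     (\<lambda>(x, t) \<in> topspace X \<times> {0..1}. if t \<le> 1/2 then H (x, 2 * t) else K (x, 2 * t - 1))"

text \<open>
  The hom-category, i.e. the fundamental groupoid of the mapping space. The composite of two
  classes is the class of the concatenation of any two representatives.
\<close>

definition Hot ::
  "'a topology \<Rightarrow> 'b topology \<Rightarrow> ('a \<Rightarrow> 'b, ('a \<times> real \<Rightarrow> 'b) set) cat" where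
  "Hot X Y =
     \<lparr>Obj = maps X Y,
      Hom = (\<lambda>f g. homotopies X Y f g // homotopy_rel X Y),
      Id = (\<lambda>f. homotopy_rel X Y `` {const_homotopy X f}),
      Comp = (\<lambda>B A. \<Union>H \<in> A. \<Union>K \<in> B. homotopy_rel X Y `` {concat_homotopy X H K})\<rparr>"

text \<open>The postcomposition functor \<open>Hot G X \<rightarrow> Hot G Y\<close> on objects and on arrows.\<close>

definition postcomp_obj :: "'g topology \<Rightarrow> ('a \<Rightarrow> 'b) \<Rightarrow> ('g \<Rightarrow> 'a) \<Rightarrow> ('g \<Rightarrow> 'b)" where
  "postcomp_obj G f u = compose (topspace G) f u"

definition postcomp_arr ::
  "'g topology \<Rightarrow> 'b topology \<Rightarrow> ('a \<Rightarrow> 'b) \<Rightarrow> ('g \<times> real \<Rightarrow> 'a) set \<Rightarrow> ('g \<times> real \<Rightarrow> 'b) set" where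
  "postcomp_arr G Y f A =
     (\<Union>H \<in> A. homotopy_rel G Y `` {compose (topspace G \<times> {0..1}) f H})"

definition Hot_equivalence :: "'a topology \<Rightarrow> 'b topology \<Rightarrow> ('a \<Rightarrow> 'b) \<Rightarrow> bool" where
  "Hot_equivalence X Y f \<longleftrightarrow>
     f \<in> Obj (Hot X Y) \<and>
     (\<exists>g \<in> Obj (Hot Y X).
        isomorphic_objects (Hot X X) (compose (topspace X) g f) (\<lambda>x \<in> topspace X. x) \<and>
        isomorphic_objects (Hot Y Y) (compose (topspace Y) f g) (\<lambda>y \<in> topspace Y. y))"

text \<open>
  The objects of the 2-category are the CW complexes, with points in an arbitrary type. A
  quantifier cannot range over types, so the types carrying source and target of the tested
  morphism are parameters; a theorem with these left as type variables covers all morphisms.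
\<close>

definition Hot_strong_generator :: "'a itself \<Rightarrow> 'b itself \<Rightarrow> 'g topology set \<Rightarrow> bool" where
  "Hot_strong_generator _ _ \<G> \<longleftrightarrow>
     (\<forall>G \<in> \<G>. CW_complex G) \<and>
     (\<forall>(X :: 'a topology) (Y :: 'b topology) f.
        CW_complex X \<longrightarrow> CW_complex Y \<longrightarrow> f \<in> Obj (Hot X Y) \<longrightarrow>
        (\<forall>G \<in> \<G>. equivalence_of_categories (Hot G X) (Hot G Y)
                     (postcomp_obj G f) (postcomp_arr G Y f)) \<longrightarrow>
        Hot_equivalence X Y f)"

definition torus :: "nat \<Rightarrow> (nat \<Rightarrow> complex) topology" where
  "torus n = product_topology (\<lambda>i. top_of_set (sphere 0 1)) {1..n}"

end

theory Submission
  imports Defs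
begin

text \<open>
  Let \<open>f\<close> induce equivalences on maps out of every torus. Essential surjectivity and fullness say
  that \<open>f\<close> has the homotopy extension and lifting property (HELP) for the pairs \<open>(T\<^sup>n, \<emptyset>)\<close> and
  \<open>T\<^sup>n \<times> (I, \<partial>I)\<close>. Polar coordinates in the last two directions of \<open>I\<^sup>k\<^sup>+\<^sup>2\<close> exhibit \<open>T\<^sup>n \<times> I\<^sup>k\<^sup>+\<^sup>2\<close>
  as a quotient of \<open>T\<^sup>n\<^sup>+\<^sup>1 \<times> I\<^sup>k\<^sup>+\<^sup>1\<close>, injective away from the boundary and the axis
  \<open>T\<^sup>n \<times> I\<^sup>k\<close>; so HELP for \<open>T\<^sup>n\<^sup>+\<^sup>1 \<times> (I\<^sup>k\<^sup>+\<^sup>1, \<partial>I\<^sup>k\<^sup>+\<^sup>1)\<close> and \<open>T\<^sup>n \<times> (I\<^sup>k, \<partial>I\<^sup>k)\<close> gives it for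
  \<open>T\<^sup>n \<times> (I\<^sup>k\<^sup>+\<^sup>2, \<partial>I\<^sup>k\<^sup>+\<^sup>2)\<close>. By induction on \<open>k\<close>, simultaneously for all \<open>n\<close>, HELP holds for all
  these pairs, in particular (\<open>n = 0\<close>) for all cells. No base points and no homotopy groups are
  needed. The usual cell-by-cell argument extends
  HELP to CW pairs; applied to \<open>(Y, \<emptyset>)\<close> it yields a right inverse \<open>g\<close> of \<open>f\<close> up to homotopy, and
  applied to \<open>X \<times> (I, \<partial>I)\<close> a homotopy from the identity of \<open>X\<close> to \<open>g \<circ> f\<close>.
\<close>

section \<open>The homotopy extension and lifting property\<close>

text \<open>\<open>HELP\<close> is the strict lifting property of the mapping path fibration of
  \<open>f\<close>. Strictness makes it stable under quotients, unions and composition of pairs, so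
  everything after the base cases is gluing. The hypothesis, however, speaks of maps up to homotopy
  and of homotopies up to deformation. Fullness yields a homotopy in \<open>X\<close> whose image is
  only deformable to the given one, and \<open>HELP_interval\<close> turns this deformation into an
  exact extension by filling a square. The test spaces offer only cubes of dimension 0 and 1. Every
  further cube direction is bought with one circle, used as an angle; this is why all tori enter
  even though only cells are wanted in the end. The price of polar coordinates is the axis, where
  the angle is lost: a lift found upstairs descends only if it is already prescribed there. Hence
  the step to \<open>k + 2\<close> draws on both \<open>k + 1\<close> and \<open>k\<close>, and
  there are two base cases. Continuity on products is the recurring technical issue. Quotient maps
  and weak topologies survive multiplication by an interval because the interval is compact
  Hausdorff.\<close>

text \<open>
  A lift of \<open>b\<close> to the mapping path space of \<open>f\<close>: at \<open>x\<close> it consists of a point of \<open>X\<close> and a path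
  in \<open>Y\<close> from \<open>b x\<close> to the image of that point. Topologizing the path space is avoided by
  asking for continuity of the adjoint map on \<open>K \<times> [0,1]\<close>.
\<close>

definition path_lift ::
  "'a topology \<Rightarrow> 'b topology \<Rightarrow> ('a \<Rightarrow> 'b) \<Rightarrow> 'k topology \<Rightarrow> ('k \<Rightarrow> 'b) \<Rightarrow>
   ('k \<Rightarrow> 'a \<times> (real \<Rightarrow> 'b)) \<Rightarrow> bool" where
  "path_lift X Y f K b \<sigma> \<longleftrightarrow>
     continuous_map K X (\<lambda>x. fst (\<sigma> x)) \<and>
     continuous_map (prod_topology K unit_interval) Y (\<lambda>p. snd (\<sigma> (fst p)) (snd p)) \<and>
     (\<forall>x \<in> topspace K. snd (\<sigma> x) 0 = b x \<and> snd (\<sigma> x) 1 = f (fst (\<sigma> x)))"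

text \<open>This is the right lifting property of the mapping path fibration over \<open>Y\<close>,
  evaluated at the start of the path, against the inclusion of \<open>L\<close>. Only the trace of
  \<open>L\<close> on \<open>K\<close> matters, so \<open>L\<close> may be written down as a larger
  set. Agreement on \<open>L\<close> is equality of values, including the values of the path
  functions outside \<open>[0,1]\<close>.\<close>

definition HELP ::
  "'a topology \<Rightarrow> 'b topology \<Rightarrow> ('a \<Rightarrow> 'b) \<Rightarrow> 'k topology \<Rightarrow> 'k set \<Rightarrow> bool" where
  "HELP X Y f K L \<longleftrightarrow>
     (\<forall>b \<sigma>. continuous_map K Y b \<longrightarrow> path_lift X Y f (subtopology K L) b \<sigma> \<longrightarrow>
        (\<exists>\<tau>. path_lift X Y f K b \<tau> \<and> (\<forall>x \<in> topspace K \<inter> L. \<tau> x = \<sigma> x)))"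

lemma HELPD:
  assumes "HELP X Y f K L" "continuous_map K Y b" "path_lift X Y f (subtopology K L) b \<sigma>"
  obtains \<tau> where "path_lift X Y f K b \<tau>" "\<And>x. x \<in> topspace K \<Longrightarrow> x \<in> L \<Longrightarrow> \<tau> x = \<sigma> x"
  using assms unfolding HELP_def by blast

lemma path_lift_cong:
  assumes "path_lift X Y f K b \<sigma>"
    and "\<And>x. x \<in> topspace K \<Longrightarrow> b x = b' x" "\<And>x. x \<in> topspace K \<Longrightarrow> \<sigma> x = \<sigma>' x"
  shows "path_lift X Y f K b' \<sigma>'"
proof -
  have "continuous_map K X (\<lambda>x. fst (\<sigma>' x))"
    by (rule continuous_map_eq [where f = "\<lambda>x. fst (\<sigma> x)"])
        (use assms in \<open>auto simp: path_lift_def\<close>)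
  moreover have "continuous_map (prod_topology K unit_interval) Y (\<lambda>p. snd (\<sigma>' (fst p)) (snd p))"
    by (rule continuous_map_eq [where f = "\<lambda>p. snd (\<sigma> (fst p)) (snd p)"])
      (use assms in \<open>auto simp: path_lift_def\<close>)
  ultimately show ?thesis
    using assms unfolding path_lift_def by metis
qed

lemma path_lift_compose:
  assumes "path_lift X Y f K b \<sigma>" and q: "continuous_map K' K q"
  shows "path_lift X Y f K' (\<lambda>x. b (q x)) (\<lambda>x. \<sigma> (q x))"
proof -
  have "continuous_map (prod_topology K' unit_interval) (prod_topology K unit_interval)
          (\<lambda>p. (q (fst p), snd p))"
    by (intro continuous_map_pairedI continuous_map_compose
        [OF continuous_map_fst q, unfolded o_def]
        continuous_map_snd)
  then have "continuous_map (prod_topology K' unit_interval) Y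
      ((\<lambda>p. snd (\<sigma> (fst p)) (snd p)) \<circ> (\<lambda>p. (q (fst p), snd p)))"
    using assms(1) continuous_map_compose unfolding path_lift_def by blast
  moreover have "continuous_map K' X ((\<lambda>x. fst (\<sigma> x)) \<circ> q)"
    using assms continuous_map_compose unfolding path_lift_def by blast
  moreover have "q x \<in> topspace K" if "x \<in> topspace K'" for x
    using q that by (auto simp: continuous_map_def)
  ultimately show ?thesis
    using assms(1) unfolding path_lift_def by (simp add: o_def)
qed

lemma path_lift_subtopology:
  "path_lift X Y f K b \<sigma> \<Longrightarrow> path_lift X Y f (subtopology K L) b \<sigma>"
  using path_lift_compose [of X Y f K b \<sigma> "subtopology K L" "\<lambda>x. x"]
  by (simp add: continuous_map_from_subtopology)

lemma path_lift_subtopology_mono: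
  "path_lift X Y f (subtopology K M) b \<sigma> \<Longrightarrow> L \<subseteq> M \<Longrightarrow> path_lift X Y f (subtopology K L) b \<sigma>"
  using path_lift_subtopology [of X Y f "subtopology K M" b \<sigma> L]
  by (simp add: subtopology_subtopology Int_absorb1)

text \<open>The path component lives on the product with the interval, and a product of a quotient
  map with an identity need not be a quotient map. It is one here because the interval is locally
  compact Hausdorff.\<close>

lemma path_lift_quotient:
  assumes q: "quotient_map K' K q"
    and "path_lift X Y f K' (\<lambda>x. b (q x)) (\<lambda>x. \<sigma> (q x))"
  shows "path_lift X Y f K b \<sigma>"
proof -
  have "quotient_map (prod_topology K' unit_interval) (prod_topology K unit_interval)
          (\<lambda>(x, t). (q x, t))"
    using q compact_space_subtopology [of euclideanreal "{0..1}"]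
    by (intro quotient_map_prod_left)
      (auto simp: Hausdorff_space_subtopology compact_imp_locally_compact_space)
  moreover have "continuous_map (prod_topology K' unit_interval) Y
      ((\<lambda>p. snd (\<sigma> (fst p)) (snd p)) \<circ> (\<lambda>(x, t). (q x, t)))"
    using assms(2) unfolding path_lift_def by (simp add: o_def case_prod_unfold)
  ultimately have "continuous_map (prod_topology K unit_interval) Y (\<lambda>p. snd (\<sigma> (fst p)) (snd p))"
    using continuous_compose_quotient_map by blast
  moreover have "continuous_map K X (\<lambda>x. fst (\<sigma> x))"
    using continuous_compose_quotient_map [OF q, of X "\<lambda>x. fst (\<sigma> x)"] assms(2)
    unfolding path_lift_def by (simp add: o_def)
  moreover have "q ` topspace K' = topspace K"
    using q by (rule quotient_imp_surjective_map)
  ultimately show ?thesis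
    using assms(2) unfolding path_lift_def by force
qed

lemma path_lift_paste:
  assumes "finite I" and clo: "\<And>i. i \<in> I \<Longrightarrow> closedin K (T i)"
    and cov: "topspace K \<subseteq> (\<Union>i\<in>I. T i)"
    and lift: "\<And>i. i \<in> I \<Longrightarrow> path_lift X Y f (subtopology K (T i)) b \<sigma>"
  shows "path_lift X Y f K b \<sigma>"
proof -
  have "continuous_map K X (\<lambda>x. fst (\<sigma> x))"
    by (rule pasting_lemma_closed [where I = I and T = T and f = "\<lambda>i x. fst (\<sigma> x)"])
      (use assms in \<open>auto simp: path_lift_def\<close>)
  moreover have "continuous_map (prod_topology K unit_interval) Y (\<lambda>p. snd (\<sigma> (fst p)) (snd p))"
  proof (rule pasting_lemma_closed [where I = I and T = "\<lambda>i. T i \<times> {0..1}"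
          and f = "\<lambda>i p. snd (\<sigma> (fst p)) (snd p)"])
    fix i assume i: "i \<in> I"
    show "closedin (prod_topology K unit_interval) (T i \<times> {0..1})"
      using closedin_topspace [of unit_interval] clo [OF i] by (simp add: closedin_prod_Times_iff)
    have "subtopology (prod_topology K unit_interval) (T i \<times> {0..1})
        = prod_topology (subtopology K (T i)) unit_interval"
      by (simp add: subtopology_Times subtopology_subtopology)
    then show "continuous_map (subtopology (prod_topology K unit_interval) (T i \<times> {0..1})) Y
        (\<lambda>p. snd (\<sigma> (fst p)) (snd p))"
      using lift [OF i] by (simp add: path_lift_def)
  qed (use assms in auto)
  moreover have "snd (\<sigma> x) 0 = b x \<and> snd (\<sigma> x) 1 = f (fst (\<sigma> x))" if x: "x \<in> topspace K" for x
  proof -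
    obtain i where "i \<in> I" "x \<in> T i"
      using cov x by blast
    then show ?thesis
      using lift [of i] x by (simp add: path_lift_def)
  qed
  ultimately show ?thesis
    unfolding path_lift_def by blast
qed

text \<open>A relative homeomorphism transports the property: solve the pulled back problem
  upstairs. The solution is constant on fibres, because over \<open>L\<close> it is prescribed by
  \<open>\<sigma>\<close> and elsewhere fibres are single points.\<close>

lemma HELP_quotient:
  assumes K': "HELP X Y f K' L'" and q: "quotient_map K' K q"
    and L': "\<And>x. x \<in> topspace K' \<Longrightarrow> x \<in> L' \<longleftrightarrow> q x \<in> L"
    and inj: "\<And>x y. x \<in> topspace K' \<Longrightarrow> y \<in> topspace K' \<Longrightarrow> q x = q y \<Longrightarrow> q x \<notin> L \<Longrightarrow> x = y"
  shows "HELP X Y f K L"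
  unfolding HELP_def
proof (intro allI impI)
  fix b \<sigma>
  assume b: "continuous_map K Y b" and \<sigma>: "path_lift X Y f (subtopology K L) b \<sigma>"
  have qc: "continuous_map K' K q"
    using q by (rule quotient_imp_continuous_map)
  have qL: "continuous_map (subtopology K' L') (subtopology K L) q"
    using qc L' by (auto simp: continuous_map_in_subtopology continuous_map_from_subtopology)
  have "continuous_map K' Y (\<lambda>x. b (q x))"
    using continuous_map_compose [OF qc b] by (simp add: o_def)
  then obtain \<tau>' where \<tau>': "path_lift X Y f K' (\<lambda>x. b (q x)) \<tau>'"
    and ext: "\<And>x. x \<in> topspace K' \<Longrightarrow> x \<in> L' \<Longrightarrow> \<tau>' x = \<sigma> (q x)"
    using HELPD [OF K' _ path_lift_compose [OF \<sigma> qL]] by blast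
  \<comment> \<open>Off \<open>L\<close> the preimage chosen by \<open>SOME\<close> is the only one;
    on \<open>L\<close> the value \<open>\<sigma>\<close> is inserted literally, so the extension is
    exact.\<close>
  define \<tau> where "\<tau> y = (if y \<in> L then \<sigma> y else \<tau>' (SOME x. x \<in> topspace K' \<and> q x = y))" for y
  have "\<tau> (q x) = \<tau>' x" if x: "x \<in> topspace K'" for x
  proof (cases "q x \<in> L")
    case True
    then show ?thesis
      using ext x L' by (simp add: \<tau>_def)
  next
    case False
    have "(SOME z. z \<in> topspace K' \<and> q z = q x) = x"
      by (rule some_equality) (use x inj False in auto)
    then show ?thesis
      using False by (simp add: \<tau>_def)
  qed
  then have "path_lift X Y f K' (\<lambda>x. b (q x)) (\<lambda>x. \<tau> (q x))"
    using path_lift_cong [OF \<tau>'] by simp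
  then have "path_lift X Y f K b \<tau>"
    using path_lift_quotient [OF q] by blast
  then show "\<exists>\<tau>. path_lift X Y f K b \<tau> \<and> (\<forall>x\<in>topspace K \<inter> L. \<tau> x = \<sigma> x)"
    by (intro exI [of _ \<tau>]) (auto simp: \<tau>_def)
qed

lemma HELP_compact_quotient:
  assumes "HELP X Y f K' L'" "continuous_map K' K q" "compact_space K'" "Hausdorff_space K"
    and "q ` topspace K' = topspace K"
    and "\<And>x. x \<in> topspace K' \<Longrightarrow> x \<in> L' \<longleftrightarrow> q x \<in> L"
    and "\<And>x y. x \<in> topspace K' \<Longrightarrow> y \<in> topspace K' \<Longrightarrow> q x = q y \<Longrightarrow> q x \<notin> L \<Longrightarrow> x = y"
  shows "HELP X Y f K L"
  using HELP_quotient [OF assms(1) continuous_imp_quotient_map] assms by blast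

lemma HELP_trans:
  assumes LM: "HELP X Y f (subtopology K M) L" and MK: "HELP X Y f K M" and "L \<subseteq> M"
  shows "HELP X Y f K L"
  unfolding HELP_def
proof (intro allI impI)
  fix b \<sigma>
  assume b: "continuous_map K Y b" and \<sigma>: "path_lift X Y f (subtopology K L) b \<sigma>"
  have "path_lift X Y f (subtopology (subtopology K M) L) b \<sigma>"
    using \<sigma> \<open>L \<subseteq> M\<close> by (simp add: subtopology_subtopology Int_absorb1)
  then obtain \<tau> where \<tau>: "path_lift X Y f (subtopology K M) b \<tau>"
    "\<And>x. x \<in> topspace (subtopology K M) \<Longrightarrow> x \<in> L \<Longrightarrow> \<tau> x = \<sigma> x"
    using HELPD [OF LM continuous_map_from_subtopology [OF b]] by blast
  then obtain \<upsilon> where "path_lift X Y f K b \<upsilon>" "\<And>x. x \<in> topspace K \<Longrightarrow> x \<in> M \<Longrightarrow> \<upsilon> x = \<tau> x"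
    using HELPD [OF MK b] by blast
  then show "\<exists>\<tau>. path_lift X Y f K b \<tau> \<and> (\<forall>x\<in>topspace K \<inter> L. \<tau> x = \<sigma> x)"
    using \<tau>(2) \<open>L \<subseteq> M\<close> by (intro exI [of _ \<upsilon>]) auto
qed

text \<open>Here \<open>A\<close> will be the axis and \<open>L\<close> the boundary. Lifting over
  \<open>A\<close> relative to its intersection with \<open>L\<close> suffices, since two lifts on
  closed sets that agree on the overlap can be glued.\<close>

lemma HELP_union:
  assumes A: "HELP X Y f (subtopology K A) L"
    and "closedin K (topspace K \<inter> A)" "closedin K (topspace K \<inter> L)"
  shows "HELP X Y f (subtopology K (A \<union> L)) L"
  unfolding HELP_def
proof (intro allI impI)
  fix b \<sigma>
  let ?K = "subtopology K (A \<union> L)"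
  assume b: "continuous_map ?K Y b" and \<sigma>: "path_lift X Y f (subtopology ?K L) b \<sigma>"
  have KL: "subtopology ?K L = subtopology K L" and KA: "subtopology ?K A = subtopology K A"
    by (simp_all add: subtopology_subtopology Int_absorb1)
  have "path_lift X Y f (subtopology (subtopology K A) L) b \<sigma>"
    using path_lift_subtopology_mono [of X Y f K L b \<sigma> "A \<inter> L"] \<sigma>
    by (simp add: KL subtopology_subtopology)
  moreover have "continuous_map (subtopology K A) Y b"
    using continuous_map_from_subtopology [OF b, of A] by (simp add: KA)
  ultimately obtain \<tau> where \<tau>: "path_lift X Y f (subtopology K A) b \<tau>"
    "\<And>x. x \<in> topspace (subtopology K A) \<Longrightarrow> x \<in> L \<Longrightarrow> \<tau> x = \<sigma> x"
    using HELPD [OF A] by blast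
  define \<upsilon> where "\<upsilon> x = (if x \<in> L then \<sigma> x else \<tau> x)" for x
  have "path_lift X Y f ?K b \<upsilon>"
  proof (rule path_lift_paste [where I = "{True, False}" and T = "\<lambda>i. topspace K \<inter>
      (if i then A else L)"])
    fix i assume "i \<in> {True, False}"
    show "closedin ?K (topspace K \<inter> (if i then A else L))"
      using assms by (auto intro: closedin_subset_topspace)
    have eq: "subtopology ?K (topspace K \<inter> C) = subtopology ?K C" for C
      by (metis subtopology_restrict subtopology_subtopology inf_commute)
    have "path_lift X Y f (subtopology ?K (if i then A else L)) b \<upsilon>"
    proof (cases i)
      case True
      then show ?thesis
        using path_lift_cong [OF \<tau>(1), of b \<upsilon>] \<tau>(2) unfolding KA if_P [OF True]
        by (simp add: \<upsilon>_def)
    next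
      case False
      then show ?thesis
        using path_lift_cong [OF \<sigma>, of b \<upsilon>] unfolding KL if_not_P [OF False]
        by (simp add: \<upsilon>_def)
    qed
    then show "path_lift X Y f (subtopology ?K (topspace K \<inter> (if i then A else L))) b \<upsilon>"
      unfolding eq .
  qed auto
  then show "\<exists>\<tau>. path_lift X Y f ?K b \<tau> \<and> (\<forall>x\<in>topspace ?K \<inter> L. \<tau> x = \<sigma> x)"
    by (intro exI [of _ \<upsilon>]) (auto simp: \<upsilon>_def)
qed


section \<open>Tori times cubes\<close>

definition torus_set :: "nat \<Rightarrow> (nat \<Rightarrow> complex) set" where
  "torus_set n = PiE {1..n} (\<lambda>_. sphere 0 1)"

definition cube :: "nat \<Rightarrow> (nat \<Rightarrow> real) set" where
  "cube k = {x. (\<forall>i<k. \<bar>x i\<bar> \<le> 1) \<and> (\<forall>i\<ge>k. x i = 0)}"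

text \<open>It is not cut down to \<open>cube k\<close>, because \<open>HELP\<close> sees only the
  trace on the space. For \<open>k = 0\<close> it is empty and for \<open>k = 1\<close> it cuts out
  the two end points of the interval.\<close>

definition cube_boundary :: "nat \<Rightarrow> (nat \<Rightarrow> real) set" where
  "cube_boundary k = {x. \<exists>i<k. \<bar>x i\<bar> = 1}"

lemma continuous_on_coordinate [continuous_intros]:
  fixes S :: "('a \<Rightarrow> 'b::topological_space) set"
  shows "continuous_on S (\<lambda>x. x i)"
  using continuous_on_subset [OF continuous_on_product_coordinates [of i], of S] by simp

lemma continuous_on_fst_coordinate [continuous_intros]:
  fixes S :: "(('a \<Rightarrow> 'b::topological_space) \<times> 'c::topological_space) set"
  shows "continuous_on S (\<lambda>p. fst p i)"
proof -
  have "continuous_on S fst"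
    by (simp add: continuous_on_fst)
  then show ?thesis
    using continuous_on_product_then_coordinatewise [of S fst i] by simp
qed

lemma continuous_on_snd_coordinate [continuous_intros]:
  fixes S :: "('c::topological_space \<times> ('a \<Rightarrow> 'b::topological_space)) set"
  shows "continuous_on S (\<lambda>p. snd p i)"
proof -
  have "continuous_on S snd"
    by (simp add: continuous_on_snd)
  then show ?thesis
    using continuous_on_product_then_coordinatewise [of S snd i] by simp
qed

text \<open>The finite product topology and the one induced from the full function space agree
  because all coordinates outside \<open>{1..n}\<close> are constantly \<open>undefined\<close>.
  From here on continuity can be handled by \<open>continuous_on\<close>.\<close>

lemma torus_eq: "torus n = top_of_set (torus_set n)"
proof -
  have top: "topspace (torus n) = topspace (top_of_set (torus_set n))"
    by (simp add: torus_def torus_set_def)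
  have "continuous_map (torus n) (product_topology (\<lambda>_. euclidean) UNIV) (\<lambda>z. z)"
    unfolding continuous_map_componentwise_UNIV
  proof
    fix i
    show "continuous_map (torus n) euclidean (\<lambda>z. z i)"
    proof (cases "i \<in> {1..n}")
      case True
      then have "continuous_map (torus n) (top_of_set (sphere 0 1)) (\<lambda>z. z i)"
        unfolding torus_def by (rule continuous_map_product_projection)
      then show ?thesis
        unfolding continuous_map_in_subtopology by blast
    next
      case False
      have "undefined = z i" if "z \<in> topspace (torus n)" for z
        using that False unfolding top topspace_euclidean_subtopology torus_set_def
        by (metis PiE_arb)
      moreover have "continuous_map (torus n) euclidean (\<lambda>_. undefined :: complex)"
        by simp
      ultimately show ?thesis
        by (rule continuous_map_eq [rotated])
    qed
  qed
  then have "continuous_map (torus n) (top_of_set (torus_set n)) id"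
    unfolding continuous_map_in_subtopology euclidean_product_topology id_def top
      topspace_euclidean_subtopology by blast
  moreover have "continuous_map (top_of_set (torus_set n)) (torus n) id"
    unfolding torus_def continuous_map_componentwise
  proof (intro conjI ballI)
    show "id ` topspace (top_of_set (torus_set n)) \<subseteq> extensional {1..n}"
      by (auto simp: torus_set_def PiE_iff)
    fix i assume "i \<in> {1..n}"
    then show "continuous_map (top_of_set (torus_set n)) (top_of_set (sphere 0 1)) (\<lambda>z. id z i)"
      unfolding continuous_map_subtopology_eu id_def torus_set_def
      by (intro conjI continuous_on_coordinate) (simp add: PiE_iff Pi_iff)
  qed
  ultimately show ?thesis
    using iffD2 [OF topology_finer_continuous_id [OF top]]
      iffD2 [OF topology_finer_continuous_id [OF top [symmetric]]]
    by (intro topology_eq [THEN iffD2] allI iffI) metis+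
qed

lemma compact_torus_set: "compact (torus_set n)"
proof -
  \<comment> \<open>Singleton factors turn the set into a product over all indices, to which
    Tychonoff applies.\<close>
  have "torus_set n = PiE UNIV (\<lambda>i. if i \<in> {1..n} then sphere 0 1 else {undefined})"
    unfolding torus_set_def PiE_def Pi_def extensional_def by (rule set_eqI) (simp, metis)
  moreover have "compactin (product_topology (\<lambda>_. euclidean) UNIV) \<dots>"
    unfolding compactin_PiE by auto
  ultimately show ?thesis
    by (simp add: euclidean_product_topology)
qed

lemma compact_cube: "compact (cube k)"
proof -
  have "cube k = PiE UNIV (\<lambda>i. if i < k then {-1..1} else {0})"
    unfolding cube_def by (rule set_eqI) (simp add: PiE_iff abs_le_iff, smt (verit) not_le)
  moreover have "compactin (product_topology (\<lambda>_. euclidean) UNIV) \<dots>"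
    unfolding compactin_PiE by auto
  ultimately show ?thesis
    by (simp add: euclidean_product_topology)
qed

lemma HELP_compact_quotient_set:
  fixes S :: "'c::topological_space set" and T :: "'d::metric_space set"
  assumes "HELP X Y f (top_of_set S) L'" "continuous_on S q" "compact S"
    and "q ` S = T" "\<And>x. x \<in> S \<Longrightarrow> x \<in> L' \<longleftrightarrow> q x \<in> L"
    and "\<And>x y. x \<in> S \<Longrightarrow> y \<in> S \<Longrightarrow> q x = q y \<Longrightarrow> q x \<notin> L \<Longrightarrow> x = y"
  shows "HELP X Y f (top_of_set T) L"
proof (rule HELP_compact_quotient [OF assms(1), where q = q])
  show "Hausdorff_space (top_of_set T)"
    using Hausdorff_space_euclidean by (rule Hausdorff_space_subtopology)
qed (use assms in \<open>auto simp: compact_space_subtopology\<close>)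

lemma HELP_restrict:
  assumes "HELP X Y f K L'" and L: "topspace K \<inter> L = topspace K \<inter> L'"
  shows "HELP X Y f K L"
proof -
  have "subtopology K L = subtopology K L'"
    using L by (metis subtopology_restrict)
  then show ?thesis
    using assms unfolding HELP_def by simp
qed

section \<open>Polar coordinates on a square\<close>

definition max_norm :: "complex \<Rightarrow> real" where
  "max_norm w = max \<bar>Re w\<bar> \<bar>Im w\<bar>"

text \<open>Polar coordinates for the maximum norm, so that \<open>r = 1\<close> is the boundary of the square.\<close>

definition square_polar :: "complex \<Rightarrow> real \<Rightarrow> complex" where
  "square_polar w r = of_real (r / max_norm w) * w"

lemma max_norm_mult: "max_norm (of_real c * w) = \<bar>c\<bar> * max_norm w"
  by (simp add: max_norm_def abs_mult max_mult_distrib_left)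

lemma max_norm_eq_0_iff [simp]: "max_norm w = 0 \<longleftrightarrow> w = 0"
  by (auto simp: max_norm_def complex_eq_iff max_def)

lemma max_norm_nonneg [simp]: "0 \<le> max_norm w"
  by (simp add: max_norm_def)

lemma max_norm_square_polar: "w \<noteq> 0 \<Longrightarrow> 0 \<le> r \<Longrightarrow> max_norm (square_polar w r) = r"
  by (simp add: square_polar_def max_norm_mult del: of_real_divide)

text \<open>The maximum norm of the point recovers the radius, its Euclidean norm recovers the
  scaling factor, and away from 0 this factor can be cancelled.\<close>

lemma square_polar_inj:
  assumes "norm w = 1" "norm w' = 1" "0 \<le> r" "0 \<le> r'"
    and eq: "square_polar w r = square_polar w' r'" and "square_polar w r \<noteq> 0"
  shows "w = w' \<and> r = r'"
proof -
  have w: "w \<noteq> 0" "w' \<noteq> 0"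
    using assms by auto
  then have r: "r = r'"
    using assms by (metis max_norm_square_polar)
  have "norm (square_polar w r) = r / max_norm w" "norm (square_polar w' r') = r' / max_norm w'"
    unfolding square_polar_def norm_mult norm_of_real using assms by simp_all
  then have "r / max_norm w = r' / max_norm w'"
    using eq by simp
  then show ?thesis
    using eq r assms(6) by (auto simp: square_polar_def)
qed

lemma square_polar_surj:
  assumes "max_norm v \<le> 1"
  obtains w r where "norm w = 1" "0 \<le> r" "r \<le> 1" "square_polar w r = v"
proof (cases "v = 0")
  case True
  then show ?thesis
    using that [of 1 0] by (simp add: square_polar_def)
next
  case False
  define w where "w = of_real (1 / norm v) * v"
  have w: "max_norm w = max_norm v / norm v" "norm w = 1"
    unfolding w_def max_norm_mult norm_mult norm_of_real using False by simp_all
  moreover have "square_polar w (max_norm v) = of_real (norm v * (1 / norm v)) * v"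
    unfolding square_polar_def w(1) using False by (simp add: w_def)
  then have "square_polar w (max_norm v) = v"
    using False by simp
  ultimately show ?thesis
    using that [of w "max_norm v"] assms by simp
qed

lemma continuous_on_square_polar [continuous_intros]:
  assumes "continuous_on S g" "continuous_on S h" "\<And>x. x \<in> S \<Longrightarrow> g x \<noteq> 0"
  shows "continuous_on S (\<lambda>x. square_polar (g x) (h x))"
proof -
  have "continuous_on S (\<lambda>x. max_norm (g x))"
    unfolding max_norm_def using assms by (intro continuous_intros)
  then show ?thesis
    unfolding square_polar_def using assms by (intro continuous_intros) auto
qed

text \<open>The last circle coordinate is the angle, and the last cube coordinate, rescaled from
  \<open>[-1,1]\<close> to \<open>[0,1]\<close>, is the radius. Together they become the point of
  the square in coordinates \<open>k\<close> and \<open>Suc k\<close>.\<close>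

definition torus_rotation ::
  "nat \<Rightarrow> nat \<Rightarrow> (nat \<Rightarrow> complex) \<times> (nat \<Rightarrow> real) \<Rightarrow> (nat \<Rightarrow> complex) \<times> (nat \<Rightarrow> real)" where
  "torus_rotation n k = (\<lambda>(z, x). (restrict z {1..n},
     let v = square_polar (z (Suc n)) ((x k + 1) / 2) in x(k := Re v, Suc k := Im v)))"

lemma torus_rotation_continuous: "continuous_on (torus_set (Suc n) \<times> cube (Suc k))
    (torus_rotation n k)"
proof -
  \<comment> \<open>\<open>square_polar\<close> divides by the maximum norm of the angle, so
    continuity needs the angle to be nonzero.\<close>
  have nz: "fst p (Suc n) \<noteq> 0" if "p \<in> torus_set (Suc n) \<times> cube (Suc k)" for p
  proof -
    have "norm (fst p (Suc n)) = 1"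
      using that by (auto simp: torus_set_def PiE_iff)
    then show ?thesis
      by auto
  qed
  have z: "continuous_on (torus_set (Suc n) \<times> cube (Suc k)) (\<lambda>p. restrict (fst p) {1..n} i)" for i
    by (cases "i \<in> {1..n}") (auto intro!: continuous_intros)
  have "continuous_on (torus_set (Suc n) \<times> cube (Suc k))
     (\<lambda>p. ((snd p)(k := Re (square_polar (fst p (Suc n)) ((snd p k + 1) / 2)),
                   Suc k := Im (square_polar (fst p (Suc n)) ((snd p k + 1) / 2)))) i)" for i
    using nz by (cases "i = Suc k"; cases "i = k") (auto intro!: continuous_intros)
  then show ?thesis
    unfolding torus_rotation_def case_prod_unfold Let_def
    by (intro continuous_on_Pair continuous_on_coordinatewise_then_product z)
qed

lemma torus_rotation_image: "torus_rotation n k ` (torus_set (Suc n) \<times> cube (Suc k))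
    = torus_set n \<times> cube (k + 2)"
proof (intro equalityI subsetI)
  fix p assume "p \<in> torus_rotation n k ` (torus_set (Suc n) \<times> cube (Suc k))"
  then obtain z x where z: "z \<in> torus_set (Suc n)" and x: "x \<in> cube (Suc k)"
    and p: "p = torus_rotation n k (z, x)"
    by auto
  have w: "norm (z (Suc n)) = 1"
    using z by (auto simp: torus_set_def PiE_iff)
  then have "z (Suc n) \<noteq> 0"
    by auto
  moreover have r: "0 \<le> (x k + 1) / 2" "(x k + 1) / 2 \<le> 1"
    using x by (auto simp: cube_def abs_le_iff dest: spec [of _ k])
  ultimately have "max_norm (square_polar (z (Suc n)) ((x k + 1) / 2)) \<le> 1"
    using max_norm_square_polar by simp
  then show "p \<in> torus_set n \<times> cube (k + 2)"
    using z x by (auto simp: p torus_rotation_def torus_set_def cube_def max_norm_def less_Suc_eq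
        Let_def)
next
  fix p assume "p \<in> torus_set n \<times> cube (k + 2)"
  then obtain z x where p: "p = (z, x)" and z: "z \<in> torus_set n" and x: "x \<in> cube (k + 2)"
    by auto
  have "max_norm (Complex (x k) (x (Suc k))) \<le> 1"
    using x by (simp add: max_norm_def cube_def)
  then obtain w r where w: "norm w = 1" "0 \<le> r" "r \<le> 1"
    "square_polar w r = Complex (x k) (x (Suc k))"
    by (rule square_polar_surj)
  have "restrict (z(Suc n := w)) {1..n} = z"
    using z by (auto simp: torus_set_def PiE_iff extensional_def fun_eq_iff)
  then have "torus_rotation n k (z(Suc n := w), x(k := 2 * r - 1, Suc k := 0)) = p"
    using w by (auto simp: torus_rotation_def p)
  moreover have "z(Suc n := w) \<in> torus_set (Suc n)"
    using z w by (auto simp: torus_set_def PiE_iff extensional_def)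
  moreover have "x(k := 2 * r - 1, Suc k := 0) \<in> cube (Suc k)"
  proof -
    have "\<bar>2 * r - 1\<bar> \<le> 1"
      using w by simp
    then show ?thesis
      using x by (simp add: cube_def)
  qed
  ultimately show "p \<in> torus_rotation n k ` (torus_set (Suc n) \<times> cube (Suc k))"
    by (intro image_eqI [where x = "(z(Suc n := w), x(k := 2 * r - 1, Suc k := 0))"]) simp_all
qed

text \<open>With \<open>A\<close> the axis, extension goes in two stages: from the boundary to
  boundary plus axis, which is the second hypothesis, and from there to the whole space through
  \<open>torus_rotation\<close>, which is injective off the boundary and the axis.\<close>

lemma HELP_torus_cube_step:
  assumes "HELP X Y f (top_of_set (torus_set (Suc n) \<times> cube (Suc k))) (UNIV \<times> cube_boundary
      (Suc k))"
    and axis: "HELP X Y f (top_of_set (torus_set n \<times> cube k)) (UNIV \<times> cube_boundary k)"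
  shows "HELP X Y f (top_of_set (torus_set n \<times> cube (k + 2))) (UNIV \<times> cube_boundary (k + 2))"
proof -
  let ?K = "top_of_set (torus_set n \<times> cube (k + 2))" and ?L = "UNIV \<times> cube_boundary (k + 2)"
  define A :: "((nat \<Rightarrow> complex) \<times> (nat \<Rightarrow> real)) set" where
    "A = UNIV \<times> {x. x k = 0 \<and> x (Suc k) = 0}"
  have A_Int: "(torus_set n \<times> cube (k + 2)) \<inter> A = torus_set n \<times> cube k"
  proof -
    have "x \<in> cube k" if "x \<in> cube (k + 2)" "x k = 0" "x (Suc k) = 0" for x
    proof -
      have "x i = 0" if "k \<le> i" for i
      proof (cases "i < k + 2")
        case True
        with that have "i = k \<or> i = Suc k"
          by linarith
        then show ?thesis
          using \<open>x k = 0\<close> \<open>x (Suc k) = 0\<close> by auto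
      qed (use \<open>x \<in> cube (k + 2)\<close> in \<open>simp add: cube_def\<close>)
      then show ?thesis
        using \<open>x \<in> cube (k + 2)\<close> by (simp add: cube_def)
    qed
    moreover have "x \<in> cube (k + 2) \<and> x k = 0 \<and> x (Suc k) = 0" if "x \<in> cube k" for x
    proof -
      have "\<bar>x i\<bar> \<le> 1" for i
        using that by (cases "i < k") (simp_all add: cube_def)
      then show ?thesis
        using that by (simp add: cube_def)
    qed
    ultimately show ?thesis
      by (auto simp: A_def)
  qed
  \<comment> \<open>On the axis the last two coordinates vanish, so the boundary of the big cube
    meets it exactly in the boundary of the small one.\<close>
  have "HELP X Y f (top_of_set (torus_set n \<times> cube k)) ?L"
    by (rule HELP_restrict [OF axis]) (force simp: cube_def cube_boundary_def less_Suc_eq)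
  then have "HELP X Y f (subtopology ?K A) ?L"
    unfolding subtopology_subtopology A_Int .
  moreover have "closed A"
    unfolding A_def by (intro closed_Times closed_UNIV closed_Collect_conj closed_Collect_eq
        continuous_intros)
  moreover have "closed ?L"
  proof -
    have "cube_boundary (k + 2) = (\<Union>i<k+2. {x. \<bar>x i\<bar> = 1})"
      by (auto simp: cube_boundary_def)
    moreover have "closed {x::nat \<Rightarrow> real. \<bar>x i\<bar> = 1}" for i
      by (intro closed_Collect_eq continuous_intros)
    ultimately show ?thesis
      by (auto intro!: closed_Times closed_UN)
  qed
  ultimately have step1: "HELP X Y f (subtopology ?K (A \<union> ?L)) ?L"
    by (intro HELP_union) (unfold topspace_euclidean_subtopology, auto intro: closedin_closed_Int)
  have "HELP X Y f ?K (A \<union> ?L)"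
  proof (rule HELP_compact_quotient_set [OF assms(1) torus_rotation_continuous _
      torus_rotation_image])
    show "compact (torus_set (Suc n) \<times> cube (Suc k))"
      by (intro compact_Times compact_torus_set compact_cube)
    have polar: "max_norm (square_polar (z (Suc n)) ((x k + 1) / 2)) = (x k + 1) / 2"
      "norm (z (Suc n)) = 1" "0 \<le> (x k + 1) / 2" "(x k + 1) / 2 \<le> 1"
      if "(z, x) \<in> torus_set (Suc n) \<times> cube (Suc k)" for z x
    proof -
      show w: "norm (z (Suc n)) = 1" 
        using that by (auto simp: torus_set_def PiE_iff)
      show r: "0 \<le> (x k + 1) / 2" "(x k + 1) / 2 \<le> 1"
        using that by (auto simp: cube_def abs_le_iff dest: spec [of _ k])
      show "max_norm (square_polar (z (Suc n)) ((x k + 1) / 2)) = (x k + 1) / 2"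
        by (rule max_norm_square_polar) (use w r in auto)
    qed
    \<comment> \<open>The face \<open>x k = -1\<close> has radius 0 and lands on the axis, the face
      \<open>x k = 1\<close> has radius 1 and lands on the boundary of the square, and the other
      faces are kept. So the boundary upstairs is precisely the preimage of
      \<open>A \<union> ?L\<close>.\<close>
    have in_AL: "torus_rotation n k (z, x) \<in> A \<union> ?L \<longleftrightarrow>
        x \<in> cube_boundary k \<or> (x k + 1) / 2 = 0 \<or> (x k + 1) / 2 = 1"
      if zx: "(z, x) \<in> torus_set (Suc n) \<times> cube (Suc k)" for z x
    proof -
      define v where "v = square_polar (z (Suc n)) ((x k + 1) / 2)"
      have v: "max_norm v = (x k + 1) / 2" "max_norm v \<le> 1"
        using polar [OF zx] by (simp_all add: v_def)
      have "x(k := Re v, Suc k := Im v) \<in> cube_boundary (k + 2) \<longleftrightarrow>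
          x \<in> cube_boundary k \<or> \<bar>Re v\<bar> = 1 \<or> \<bar>Im v\<bar> = 1"
        by (auto simp: cube_boundary_def less_Suc_eq intro: exI [of _ k] exI [of _ "Suc k"])
      moreover have "\<bar>Re v\<bar> = 1 \<or> \<bar>Im v\<bar> = 1 \<longleftrightarrow> max_norm v = 1"
        using v(2) by (auto simp: max_norm_def max_def)
      moreover have "Re v = 0 \<and> Im v = 0 \<longleftrightarrow> max_norm v = 0"
        by (simp add: complex_eq_iff)
      ultimately show ?thesis
        unfolding torus_rotation_def case_prod_conv Let_def v_def [symmetric] A_def
        unfolding v(1) [symmetric] by (simp add: disj_left_commute)
    qed
    fix p assume p: "p \<in> torus_set (Suc n) \<times> cube (Suc k)"
    obtain z x where zx: "p = (z, x)"
      by fastforce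
    have "x \<in> cube_boundary (Suc k) \<longleftrightarrow> x \<in> cube_boundary k \<or> x k = -1 \<or> x k = 1"
      by (auto simp: cube_boundary_def less_Suc_eq)
    then show "p \<in> UNIV \<times> cube_boundary (Suc k) \<longleftrightarrow> torus_rotation n k p \<in> A \<union> ?L"
      using in_AL p zx by auto
    fix p' assume p': "p' \<in> torus_set (Suc n) \<times> cube (Suc k)"
      and eq: "torus_rotation n k p = torus_rotation n k p'"
      and nAL: "torus_rotation n k p \<notin> A \<union> ?L"
    obtain z' x' where zx': "p' = (z', x')"
      by fastforce
    note zp = p [unfolded zx] and zp' = p' [unfolded zx']
    define v where "v = square_polar (z (Suc n)) ((x k + 1) / 2)"
    define v' where "v' = square_polar (z' (Suc n)) ((x' k + 1) / 2)"
    have eqs: "restrict z {1..n} = restrict z' {1..n}"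
      "x(k := Re v, Suc k := Im v) = x'(k := Re v', Suc k := Im v')"
      using eq unfolding zx zx' torus_rotation_def case_prod_conv Let_def v_def v'_def by simp_all
    have "Re v = Re v'" "Im v = Im v'"
      using fun_cong [OF eqs(2), of k] fun_cong [OF eqs(2), of "Suc k"] by simp_all
    then have "v = v'"
      by (simp add: complex_eq_iff)
    moreover have "v \<noteq> 0"
      using nAL in_AL [OF zp] polar(1) [OF zp] max_norm_eq_0_iff
      unfolding zx v_def by metis
    ultimately have same: "z (Suc n) = z' (Suc n) \<and> (x k + 1) / 2 = (x' k + 1) / 2"
      using polar [OF zp] polar [OF zp'] unfolding v_def v'_def by (intro square_polar_inj) auto
    have "z i = z' i" for i
    proof (cases "i \<in> {1..n}")
      case True
      then show ?thesis
        using fun_cong [OF eqs(1), of i] by simp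
    next
      case False
      then have "i = Suc n \<or> i \<notin> {1..Suc n}"
        by auto
      then show ?thesis
        using same zp zp' by (auto simp: torus_set_def PiE_iff extensional_def)
    qed
    moreover have "x i = x' i" for i
    proof (cases "i < k")
      case True
      then show ?thesis
        using fun_cong [OF eqs(2), of i] by simp
    next
      case False
      then have "i = k \<or> Suc k \<le> i"
        by auto
      then show ?thesis
        using same zp zp' by (auto simp: cube_def)
    qed
    ultimately show "p = p'"
      unfolding zx zx' by auto
  qed
  with step1 show ?thesis
    by (rule HELP_trans) simp
qed


lemma HELP_torus_cube:
  assumes "\<And>n. HELP X Y f (top_of_set (torus_set n \<times> cube 0)) (UNIV \<times> cube_boundary 0)"
    and "\<And>n. HELP X Y f (top_of_set (torus_set n \<times> cube 1)) (UNIV \<times> cube_boundary 1)"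
  shows "HELP X Y f (top_of_set (torus_set n \<times> cube k)) (UNIV \<times> cube_boundary k)"
proof (induction k arbitrary: n rule: less_induct)
  case (less k)
  consider "k = 0" | "k = 1" | j where "k = j + 2"
    by (metis add_2_eq_Suc' not0_implies_Suc One_nat_def)
  then show ?case
  proof cases
    case (3 j)
    show ?thesis
      unfolding 3 by (intro HELP_torus_cube_step less.IH) (simp_all add: 3)
  qed (use assms in simp_all)
qed

section \<open>Cubes and discs\<close>

definition disc_set :: "nat \<Rightarrow> (nat \<Rightarrow> real) set" where
  "disc_set k = {x. (\<forall>i\<ge>k. x i = 0) \<and> (\<Sum>i<k. (x i)\<^sup>2) \<le> 1}"

text \<open>The maximum norm of the first \<open>k\<close> coordinates; recursion avoids the maximum
  of an empty set for \<open>k = 0\<close>.\<close>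

primrec max_coord :: "nat \<Rightarrow> (nat \<Rightarrow> real) \<Rightarrow> real" where
  "max_coord 0 x = 0"
| "max_coord (Suc k) x = max (max_coord k x) \<bar>x k\<bar>"

definition eucl_norm :: "nat \<Rightarrow> (nat \<Rightarrow> real) \<Rightarrow> real" where
  "eucl_norm k x = sqrt (\<Sum>i<k. (x i)\<^sup>2)"

lemma disc_eq: "disc k = top_of_set (disc_set k)"
  unfolding disc_def Euclidean_space_def euclidean_product_topology subtopology_subtopology
      disc_set_def
  by (simp add: Collect_conj_eq)

lemma max_coord_nonneg: "0 \<le> max_coord k x"
  by (induction k) auto

lemma max_coord_le_iff: "0 \<le> c \<Longrightarrow> max_coord k x \<le> c \<longleftrightarrow> (\<forall>i<k. \<bar>x i\<bar> \<le> c)"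
  by (induction k) (auto simp: less_Suc_eq)

lemma max_coord_less_iff: "0 < c \<Longrightarrow> max_coord k x < c \<longleftrightarrow> (\<forall>i<k. \<bar>x i\<bar> < c)"
  by (induction k) (auto simp: less_Suc_eq)

lemma max_coord_divide: "0 < c \<Longrightarrow> max_coord k (\<lambda>i. x i / c) = max_coord k x / c"
  by (induction k) (auto simp: max_divide_distrib_right)

lemma continuous_on_max_coord [continuous_intros]: "continuous_on S (max_coord k)"
  by (induction k) (auto intro!: continuous_intros)

lemma eucl_norm_nonneg: "0 \<le> eucl_norm k x"
  by (simp add: eucl_norm_def sum_nonneg)

lemma eucl_norm_divide: "0 < c \<Longrightarrow> eucl_norm k (\<lambda>i. x i / c) = eucl_norm k x / c"
  by (simp add: eucl_norm_def power_divide real_sqrt_divide flip: sum_divide_distrib)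

lemma continuous_on_eucl_norm [continuous_intros]: "continuous_on S (eucl_norm k)"
  unfolding eucl_norm_def by (intro continuous_intros)

lemma max_coord_le_eucl_norm: "max_coord k x \<le> eucl_norm k x"
proof -
  have "\<bar>x i\<bar> \<le> eucl_norm k x" if "i < k" for i
  proof -
    have "(x i)\<^sup>2 \<le> (\<Sum>i<k. (x i)\<^sup>2)"
      using that by (intro member_le_sum) auto
    then show ?thesis
      unfolding eucl_norm_def by (metis real_sqrt_abs real_sqrt_le_mono)
  qed
  then show ?thesis
    using max_coord_le_iff eucl_norm_nonneg by blast
qed

lemma max_coord_pos: "0 < eucl_norm k x \<Longrightarrow> 0 < max_coord k x"
proof (rule ccontr)
  assume pos: "0 < eucl_norm k x" and "\<not> 0 < max_coord k x"
  then have "\<forall>i<k. x i = 0"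
    using max_coord_le_iff [of 0 k x] by auto
  then show False
    using pos by (simp add: eucl_norm_def)
qed

lemma mem_cube_iff: "x \<in> cube k \<longleftrightarrow> max_coord k x \<le> 1 \<and> (\<forall>i\<ge>k. x i = 0)"
  by (simp add: cube_def max_coord_le_iff)

lemma mem_disc_set_iff: "x \<in> disc_set k \<longleftrightarrow> eucl_norm k x \<le> 1 \<and> (\<forall>i\<ge>k. x i = 0)"
  by (auto simp: disc_set_def eucl_norm_def)

lemma cube_boundary_iff: "x \<in> cube k \<Longrightarrow> x \<in> cube_boundary k \<longleftrightarrow> max_coord k x = 1"
proof -
  assume "x \<in> cube k"
  then have "max_coord k x = 1 \<longleftrightarrow> \<not> max_coord k x < 1" "\<forall>i<k. \<bar>x i\<bar> = 1 \<longleftrightarrow> \<not> \<bar>x i\<bar> < 1"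
    by (force simp: mem_cube_iff, force simp: cube_def)
  then show ?thesis
    using max_coord_less_iff [of 1 k x] unfolding cube_boundary_def by auto
qed

lemma disc_boundary_iff: "x \<in> disc_boundary k \<longleftrightarrow> x \<in> disc_set k \<and> eucl_norm k x = 1"
  by (simp add: disc_boundary_def disc_eq eucl_norm_def)

lemma disc_interior_iff: "x \<in> disc_interior k \<longleftrightarrow> x \<in> disc_set k \<and> eucl_norm k x < 1"
  by (simp add: disc_interior_def disc_eq eucl_norm_def)

text \<open>
  Radial rescaling between the ball of a norm \<open>p\<close> and the ball of a norm \<open>q\<close>, given by
  \<open>x \<mapsto> x / (1 + q x - p x)\<close>. Unlike \<open>x \<mapsto> (p x / q x) \<cdot> x\<close> it needs no case distinction at the
  origin, and the inverse has the same form.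
\<close>

definition cube_to_disc :: "nat \<Rightarrow> (nat \<Rightarrow> real) \<Rightarrow> (nat \<Rightarrow> real)" where
  "cube_to_disc k x = (\<lambda>i. x i / (1 + eucl_norm k x - max_coord k x))"

definition disc_to_cube :: "nat \<Rightarrow> (nat \<Rightarrow> real) \<Rightarrow> (nat \<Rightarrow> real)" where
  "disc_to_cube k x = (\<lambda>i. x i / (1 + max_coord k x - eucl_norm k x))"

lemma cube_to_disc_denominator: "0 < 1 + eucl_norm k x - max_coord k x"
  using max_coord_le_eucl_norm [of k x] by simp

text \<open>If the Euclidean norm is positive then so is \<open>max_coord\<close>, which keeps the
  denominator positive even on the unit sphere; if it vanishes the denominator is at least
  1.\<close>

lemma disc_to_cube_denominator:
  assumes "eucl_norm k x \<le> 1" shows "0 < 1 + max_coord k x - eucl_norm k x"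
  using assms max_coord_pos [of k x] max_coord_nonneg [of k x] eucl_norm_nonneg [of k x] by linarith

lemma norms_cube_to_disc:
  "eucl_norm k (cube_to_disc k x) = eucl_norm k x / (1 + eucl_norm k x - max_coord k x)"
  "max_coord k (cube_to_disc k x) = max_coord k x / (1 + eucl_norm k x - max_coord k x)"
  unfolding cube_to_disc_def
  using cube_to_disc_denominator by (simp_all add: eucl_norm_divide max_coord_divide)

lemma norms_disc_to_cube:
  assumes "eucl_norm k x \<le> 1"
  shows "eucl_norm k (disc_to_cube k x) = eucl_norm k x / (1 + max_coord k x - eucl_norm k x)"
    and "max_coord k (disc_to_cube k x) = max_coord k x / (1 + max_coord k x - eucl_norm k x)"
  unfolding disc_to_cube_def
  using disc_to_cube_denominator [OF assms] by (simp_all add: eucl_norm_divide max_coord_divide)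

lemma cube_to_disc_mem: "x \<in> cube k \<Longrightarrow> cube_to_disc k x \<in> disc_set k"
  using cube_to_disc_denominator [of k x]
  by (auto simp: mem_cube_iff mem_disc_set_iff norms_cube_to_disc) (simp add: cube_to_disc_def)

lemma disc_to_cube_mem: "x \<in> disc_set k \<Longrightarrow> disc_to_cube k x \<in> cube k"
  using disc_to_cube_denominator [of k x]
  by (auto simp: mem_cube_iff mem_disc_set_iff norms_disc_to_cube) (simp add: disc_to_cube_def)

lemma disc_to_cube_inverse: "disc_to_cube k (cube_to_disc k x) = x"
proof -
  let ?c = "1 + eucl_norm k x - max_coord k x"
  \<comment> \<open>Both norms are divided by \<open>?c\<close>, so the denominator of the second
    map is the reciprocal of that of the first and the two scalings cancel.\<close>
  have "1 + max_coord k (cube_to_disc k x) - eucl_norm k (cube_to_disc k x) = 1 / ?c"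
    unfolding norms_cube_to_disc using cube_to_disc_denominator [of k x] by (simp add: field_simps)
  then show ?thesis
    unfolding disc_to_cube_def using cube_to_disc_denominator [of k x] by
        (simp add: cube_to_disc_def)
qed

lemma cube_to_disc_inverse:
  assumes "x \<in> disc_set k" shows "cube_to_disc k (disc_to_cube k x) = x"
proof -
  let ?c = "1 + max_coord k x - eucl_norm k x"
  have le: "eucl_norm k x \<le> 1"
    using assms by (simp add: mem_disc_set_iff)
  then have "1 + eucl_norm k (disc_to_cube k x) - max_coord k (disc_to_cube k x) = 1 / ?c"
    unfolding norms_disc_to_cube [OF le] using disc_to_cube_denominator [of k x] by
        (simp add: field_simps)
  then show ?thesis
    unfolding cube_to_disc_def using disc_to_cube_denominator [OF le] by
        (simp add: disc_to_cube_def)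
qed

text \<open>With norms \<open>e\<close> and \<open>m\<close>, the new Euclidean norm
  \<open>e / (1 + e - m)\<close> is 1 exactly when \<open>m = 1\<close>.\<close>

lemma cube_to_disc_boundary:
  "x \<in> cube k \<Longrightarrow> cube_to_disc k x \<in> disc_boundary k \<longleftrightarrow> x \<in> cube_boundary k"
  using cube_to_disc_denominator [of k x] cube_to_disc_mem [of x k]
  by (auto simp: disc_boundary_iff cube_boundary_iff norms_cube_to_disc field_simps)

lemma continuous_on_cube_to_disc: "continuous_on S (cube_to_disc k)"
proof -
  have "1 + eucl_norm k x - max_coord k x \<noteq> 0" for x
    using cube_to_disc_denominator [of k x] by simp
  then show ?thesis
    unfolding cube_to_disc_def
    by (intro continuous_on_coordinatewise_then_product continuous_intros) auto
qed

lemma continuous_on_disc_to_cube: "continuous_on (disc_set k) (disc_to_cube k)"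
proof -
  have "1 + max_coord k x - eucl_norm k x \<noteq> 0" if "x \<in> disc_set k" for x
    using disc_to_cube_denominator [of k x] that by (simp add: mem_disc_set_iff)
  then show ?thesis
    unfolding disc_to_cube_def
    by (intro continuous_on_coordinatewise_then_product continuous_intros) auto
qed

lemma cube_to_disc_image: "cube_to_disc k ` cube k = disc_set k"
  using cube_to_disc_mem disc_to_cube_mem cube_to_disc_inverse by
      (metis imageI image_subset_iff subsetI subset_antisym)

lemma compact_disc_set: "compact (disc_set k)"
  by (metis compact_continuous_image compact_cube continuous_on_cube_to_disc cube_to_disc_image)

text \<open>The factor \<open>{0}\<close> and the empty product give the pair the shape that
  \<open>HELP_CW\<close> expects for \<open>J = {0}\<close> and \<open>J0 = {}\<close>. The torus
  factor is the one-point set containing \<open>\<lambda>_. undefined\<close>.\<close>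

lemma HELP_disc:
  assumes "HELP X Y f (top_of_set (torus_set 0 \<times> cube k)) (UNIV \<times> cube_boundary k)"
  shows "HELP X Y f (top_of_set (disc_set k \<times> {0::real})) (disc_boundary k \<times> {0} \<union> disc_set k \<times> {})"
proof (rule HELP_compact_quotient_set [OF assms, where q = "\<lambda>p. (cube_to_disc k (snd p), 0)"])
  show "continuous_on (torus_set 0 \<times> cube k) (\<lambda>p. (cube_to_disc k (snd p), 0::real))"
    by (intro continuous_on_Pair continuous_on_const continuous_on_compose2
        [OF continuous_on_cube_to_disc]
        continuous_on_snd continuous_on_id) auto
  show "(\<lambda>p. (cube_to_disc k (snd p), 0::real)) ` (torus_set 0 \<times> cube k) = disc_set k \<times> {0}"
    unfolding cube_to_disc_image [symmetric] by (auto simp: torus_set_def image_iff)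
  show "compact (torus_set 0 \<times> cube k)"
    by (intro compact_Times compact_torus_set compact_cube)
  show "p = p'" if "p \<in> torus_set 0 \<times> cube k" "p' \<in> torus_set 0 \<times> cube k"
    "(cube_to_disc k (snd p), 0::real) = (cube_to_disc k (snd p'), 0)" for p p'
    using that disc_to_cube_inverse by (auto simp: torus_set_def) metis
qed (auto simp: cube_to_disc_boundary)

text \<open>The last cube coordinate, rescaled to \<open>[0,1]\<close>, becomes the interval, while
  the first \<open>k\<close> are rounded off to a disc. The boundary of the cube thereby becomes the
  lateral surface together with both ends.\<close>

lemma HELP_disc_interval:
  assumes "HELP X Y f (top_of_set (torus_set 0 \<times> cube (Suc k))) (UNIV \<times> cube_boundary (Suc k))"
  shows "HELP X Y f (top_of_set (disc_set k \<times> {0..1::real}))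
           (disc_boundary k \<times> {0..1} \<union> disc_set k \<times> {0,1})"
proof (rule HELP_compact_quotient_set [OF assms, where q = "\<lambda>p. (cube_to_disc k ((snd p)(k := 0)),
    (snd p k + 1) / 2)"])
  let ?q = "\<lambda>p. (cube_to_disc k ((snd p)(k := 0)), (snd p k + 1) / 2) :: (nat \<Rightarrow> real) \<times> real"
  have cont: "continuous_on (torus_set 0 \<times> cube (Suc k)) (\<lambda>p. ((snd p)(k := 0)) i)" for i
    by (cases "i = k") (auto intro!: continuous_intros)
  show "continuous_on (torus_set 0 \<times> cube (Suc k)) ?q"
    by (intro continuous_on_Pair continuous_on_compose2 [OF continuous_on_cube_to_disc [of UNIV]]
        continuous_on_coordinatewise_then_product cont continuous_intros) auto
  have mem: "x(k := 0) \<in> cube k" "\<bar>x k\<bar> \<le> 1" if "x \<in> cube (Suc k)" for x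
    using that by (auto simp: cube_def)
  show "?q ` (torus_set 0 \<times> cube (Suc k)) = disc_set k \<times> {0..1}"
  proof (intro equalityI subsetI)
    fix y assume "y \<in> disc_set k \<times> {0..1::real}"
    then obtain u t where y: "y = (u, t)" and u: "u \<in> disc_set k" and t: "0 \<le> t" "t \<le> 1"
      by auto
    define x where "x = (disc_to_cube k u)(k := 2 * t - 1)"
    have xk: "x k = 2 * t - 1"
      by (simp add: x_def)
    have c: "disc_to_cube k u \<in> cube k"
      using u by (rule disc_to_cube_mem)
    then have "x \<in> cube (Suc k)"
      using t by (auto simp: x_def cube_def less_Suc_eq)
    moreover have "x(k := 0) = disc_to_cube k u"
      using c by (auto simp: x_def cube_def)
    moreover have "(\<lambda>_. undefined) \<in> torus_set 0"
      by (simp add: torus_set_def)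
    ultimately show "y \<in> ?q ` (torus_set 0 \<times> cube (Suc k))"
      using cube_to_disc_inverse [OF u] xk
      by (intro image_eqI [where x = "(\<lambda>_. undefined, x)"]) (simp_all add: y)
  next
    fix y assume "y \<in> ?q ` (torus_set 0 \<times> cube (Suc k))"
    then show "y \<in> disc_set k \<times> {0..1}"
      using mem cube_to_disc_mem by (force simp: abs_le_iff)
  qed
  show "compact (torus_set 0 \<times> cube (Suc k))"
    by (intro compact_Times compact_torus_set compact_cube)
  fix p assume p: "p \<in> torus_set 0 \<times> cube (Suc k)"
  show "p \<in> UNIV \<times> cube_boundary (Suc k) \<longleftrightarrow>
      ?q p \<in> disc_boundary k \<times> {0..1} \<union> disc_set k \<times> {0, 1}"
  proof -
    obtain z x where zx: "p = (z, x)" and x: "x \<in> cube (Suc k)"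
      using p by auto
    have "x \<in> cube_boundary (Suc k) \<longleftrightarrow> x(k := 0) \<in> cube_boundary k \<or> x k = 1 \<or> x k = - 1"
      by (auto simp: cube_boundary_def less_Suc_eq)
    moreover have "(x k + 1) / 2 = 0 \<longleftrightarrow> x k = -1" "(x k + 1) / 2 = 1 \<longleftrightarrow> x k = 1"
      "0 \<le> (x k + 1) / 2" "(x k + 1) / 2 \<le> 1"
      using mem(2) [OF x] by auto
    ultimately show ?thesis
      using cube_to_disc_boundary [OF mem(1) [OF x]] cube_to_disc_mem [OF mem(1) [OF x]]
      unfolding zx by auto
  qed
  fix p' assume p': "p' \<in> torus_set 0 \<times> cube (Suc k)" and eq: "?q p = ?q p'"
  have "(snd p)(k := 0) = (snd p')(k := 0)" "snd p k = snd p' k"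
    using eq disc_to_cube_inverse by (metis Pair_inject, simp)
  then have "snd p = snd p'"
    by (metis fun_upd_triv fun_upd_upd)
  then show "p = p'"
    using p p' by (auto simp: torus_set_def)
qed


section \<open>Extension over the cells of a CW complex\<close>

text \<open>Unlike the closed version this allows infinitely many pieces, as needed for the summands
  of a disjoint union.\<close>

lemma path_lift_paste_open:
  assumes ope: "\<And>i. i \<in> I \<Longrightarrow> openin K (T i)"
    and cov: "topspace K \<subseteq> (\<Union>i\<in>I. T i)"
    and lift: "\<And>i. i \<in> I \<Longrightarrow> path_lift X Y f (subtopology K (T i)) b \<sigma>"
  shows "path_lift X Y f K b \<sigma>"
proof -
  have "continuous_map K X (\<lambda>x. fst (\<sigma> x))"
    by (rule pasting_lemma [where I = I and T = T and f = "\<lambda>i x. fst (\<sigma> x)"])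
      (use assms in \<open>auto simp: path_lift_def\<close>)
  moreover have "continuous_map (prod_topology K unit_interval) Y (\<lambda>p. snd (\<sigma> (fst p)) (snd p))"
  proof (rule pasting_lemma [where I = I and T = "\<lambda>i. T i \<times> {0..1}"
          and f = "\<lambda>i p. snd (\<sigma> (fst p)) (snd p)"])
    fix i assume i: "i \<in> I"
    show "openin (prod_topology K unit_interval) (T i \<times> {0..1})"
      using openin_topspace [of unit_interval] ope [OF i] by (simp add: openin_prod_Times_iff)
    have "subtopology (prod_topology K unit_interval) (T i \<times> {0..1})
        = prod_topology (subtopology K (T i)) unit_interval"
      by (simp add: subtopology_Times subtopology_subtopology)
    then show "continuous_map (subtopology (prod_topology K unit_interval) (T i \<times> {0..1})) Y
        (\<lambda>p. snd (\<sigma> (fst p)) (snd p))"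
      using lift [OF i] by (simp add: path_lift_def)
  qed (use assms in auto)
  moreover have "snd (\<sigma> x) 0 = b x \<and> snd (\<sigma> x) 1 = f (fst (\<sigma> x))" if x: "x \<in> topspace K" for x
  proof -
    obtain i where "i \<in> I" "x \<in> T i"
      using cov x by blast
    then show ?thesis
      using lift [of i] x by (simp add: path_lift_def)
  qed
  ultimately show ?thesis
    unfolding path_lift_def by blast
qed

text \<open>A space with the weak topology is a quotient of the disjoint sum of its closed pieces,
  and this quotient survives multiplication by the compact Hausdorff space \<open>J\<close>. So
  continuity on the product can be tested piece by piece without assuming that the product itself is
  a CW complex.\<close>

lemma path_lift_weak_topology:
  fixes J :: "real set"
  assumes "compact J" and C: "\<And>i. i \<in> I \<Longrightarrow> closedin K (C i)" and cov: "topspace K \<subseteq> (\<Union>i\<in>I. C i)"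
    and weak: "\<And>A. A \<subseteq> topspace K \<Longrightarrow> (\<And>i. i \<in> I \<Longrightarrow> closedin K (A \<inter> C i)) \<Longrightarrow> closedin K A"
    and lift: "\<And>i. i \<in> I \<Longrightarrow> path_lift X Y f (subtopology (prod_topology K (top_of_set J))
        (C i \<times> J)) b \<sigma>"
  shows "path_lift X Y f (prod_topology K (top_of_set J)) b \<sigma>"
proof -
  let ?S = "sum_topology (\<lambda>i. subtopology K (C i)) I"
  have sub: "C i \<subseteq> topspace K" if "i \<in> I" for i
    using C [OF that] by (rule closedin_subset)
  have topS: "topspace ?S = Sigma I C"
    using sub by (auto simp: Sigma_def)
  have "quotient_map ?S K snd"
    unfolding quotient_map_closedin topS
  proof (intro conjI allI impI)
    show "snd ` Sigma I C = topspace K"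
      using sub cov by force
    fix A assume A: "A \<subseteq> topspace K"
    have "closedin ?S {p \<in> Sigma I C. snd p \<in> A} \<longleftrightarrow> (\<forall>i\<in>I. closedin (subtopology K (C i)) {x. (i, x)
        \<in> {p \<in> Sigma I C. snd p \<in> A}})"
      unfolding closedin_sum_topology using sub by (auto simp: subset_iff)
    also have "\<dots> \<longleftrightarrow> (\<forall>i\<in>I. closedin K (A \<inter> C i))"
    proof (intro ball_cong refl)
      fix i assume i: "i \<in> I"
      have "{x. (i, x) \<in> {p \<in> Sigma I C. snd p \<in> A}} = A \<inter> C i"
        using i by auto
      then show "closedin (subtopology K (C i)) {x. (i, x) \<in> {p \<in> Sigma I C. snd p \<in> A}}
          \<longleftrightarrow> closedin K (A \<inter> C i)"
        using closedin_closed_subtopology [OF C [OF i]] by auto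
    qed
    also have "\<dots> \<longleftrightarrow> closedin K A"
      using weak [OF A] C by blast
    finally show "closedin ?S {p \<in> Sigma I C. snd p \<in> A} \<longleftrightarrow> closedin K A" .
  qed
  then have q: "quotient_map (prod_topology ?S (top_of_set J)) (prod_topology K (top_of_set J))
      (\<lambda>(p, t). (snd p, t))"
    using \<open>compact J\<close>
    by (intro quotient_map_prod_left)
      (auto intro!: compact_imp_locally_compact_space Hausdorff_space_subtopology
          Hausdorff_space_euclidean
        simp: compact_space_subtopology)
  have "path_lift X Y f (prod_topology ?S (top_of_set J)) (\<lambda>x. b ((\<lambda>(p, t). (snd p, t)) x)) (\<lambda>x. \<sigma>
      ((\<lambda>(p, t). (snd p, t)) x))"
  proof (rule path_lift_paste_open [where I = I and T = "\<lambda>i. Sigma {i} C \<times> J"])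
    fix i assume i: "i \<in> I"
    have "openin ?S (Sigma {i} C)"
      unfolding openin_sum_topology
    proof (intro conjI ballI)
      show "Sigma {i} C \<subseteq> Sigma I (topspace \<circ> (\<lambda>i. subtopology K (C i)))"
        using i sub [OF i] by auto
      fix j assume j: "j \<in> I"
      have "{x. (j, x) \<in> Sigma {i} C} = (if j = i then topspace (subtopology K (C i)) else {})"
        using sub [OF i] by auto
      then show "openin (subtopology K (C j)) {x. (j, x) \<in> Sigma {i} C}"
        by (metis openin_empty openin_topspace)
    qed
    then show "openin (prod_topology ?S (top_of_set J)) (Sigma {i} C \<times> J)"
      using openin_topspace [of "top_of_set J"] by (simp add: openin_prod_Times_iff)
    have "continuous_map (subtopology (prod_topology ?S (top_of_set J)) (Sigma {i} C \<times> J))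
        (subtopology (prod_topology K (top_of_set J)) (C i \<times> J)) (\<lambda>(p, t). (snd p, t))"
      unfolding continuous_map_in_subtopology
    proof
      show "continuous_map (subtopology (prod_topology ?S (top_of_set J)) (Sigma {i} C \<times> J))
          (prod_topology K (top_of_set J)) (\<lambda>(p, t). (snd p, t))"
        using quotient_imp_continuous_map [OF q] by (rule continuous_map_from_subtopology)
    qed auto
    then show "path_lift X Y f (subtopology (prod_topology ?S (top_of_set J)) (Sigma {i} C \<times> J))
        (\<lambda>x. b ((\<lambda>(p, t). (snd p, t)) x)) (\<lambda>x. \<sigma> ((\<lambda>(p, t). (snd p, t)) x))"
      by (rule path_lift_compose [OF lift [OF i]])
  qed auto
  then show ?thesis
    by (rule path_lift_quotient [OF q])
qed

section \<open>Open cells, closed cells and their boundaries\<close>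

lemma CW_structureD:
  assumes CW: "CW_structure K E \<Phi>" and e: "e \<in> E n"
  shows "continuous_map (disc n) K (\<Phi> e)" "\<Phi> e ` disc_interior n = e" "inj_on (\<Phi> e)
      (disc_interior n)"
    and "\<exists>F. finite F \<and> F \<subseteq> (\<Union>m<n. E m) \<and> \<Phi> e ` disc_boundary n \<subseteq> \<Union>F"
    and "e \<subseteq> topspace K"
proof -
  note cells = CW [unfolded CW_structure_def]
  have un: "(\<Union>n. \<Union>(E n)) = topspace K"
    using cells by (rule conjunct1)
  have char: "continuous_map (disc n) K (\<Phi> e) \<and>
      homeomorphic_map (subtopology (disc n) (disc_interior n)) (subtopology K e) (\<Phi> e)"
    using cells [THEN conjunct2, THEN conjunct2, THEN conjunct1] e by simp
  then show "continuous_map (disc n) K (\<Phi> e)"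
    by (rule conjunct1)
  have hom: "homeomorphic_map (subtopology (disc n) (disc_interior n)) (subtopology K e) (\<Phi> e)"
    using char by (rule conjunct2)
  have int: "topspace (subtopology (disc n) (disc_interior n)) = disc_interior n"
    by (auto simp: disc_interior_def)
  show e_sub: "e \<subseteq> topspace K"
    unfolding un [symmetric] using e by auto
  then have "topspace (subtopology K e) = e"
    by auto
  then show "\<Phi> e ` disc_interior n = e"
    using homeomorphic_imp_surjective_map [OF hom] unfolding int by simp
  show "inj_on (\<Phi> e) (disc_interior n)"
    using homeomorphic_imp_injective_map [OF hom] unfolding int .
  show "\<exists>F. finite F \<and> F \<subseteq> (\<Union>m<n. E m) \<and> \<Phi> e ` disc_boundary n \<subseteq> \<Union>F"
    using cells [THEN conjunct2, THEN conjunct2, THEN conjunct2, THEN conjunct1] e by simp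
qed

lemma CW_cells_disjoint:
  assumes CW: "CW_structure K E \<Phi>" and "x \<in> d" "x \<in> e" "d \<in> E m" "e \<in> E n"
  shows "m = n \<and> d = e"
proof -
  have "(m, d) \<noteq> (n, e) \<longrightarrow> disjnt d e"
    using CW [unfolded CW_structure_def, THEN conjunct2, THEN conjunct1] assms(4,5) by simp
  then show ?thesis
    using assms(2,3) by (auto simp: disjnt_iff)
qed

lemma cell_boundary_lower:
  assumes "CW_structure K E \<Phi>" "e \<in> E n" "x \<in> \<Phi> e ` disc_boundary n"
  shows "\<exists>m<n. \<exists>d\<in>E m. x \<in> d"
proof -
  obtain F where F: "F \<subseteq> (\<Union>m<n. E m)" "\<Phi> e ` disc_boundary n \<subseteq> \<Union>F"
    using CW_structureD(4) [OF assms(1,2)] by blast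
  obtain d where d: "d \<in> F" "x \<in> d"
    using subsetD [OF F(2) assms(3)] by (rule UnionE)
  then show ?thesis
    using subsetD [OF F(1) d(1)] by auto
qed

lemma disc_set_split: "disc_set n = disc_interior n \<union> disc_boundary n"
proof (rule set_eqI)
  fix x
  have "x \<in> disc_set n \<Longrightarrow> eucl_norm n x \<le> 1"
    by (simp add: mem_disc_set_iff)
  then show "x \<in> disc_set n \<longleftrightarrow> x \<in> disc_interior n \<union> disc_boundary n"
    unfolding Un_iff disc_interior_iff disc_boundary_iff by linarith
qed

lemma closed_cell_subset:
  assumes "CW_structure K E \<Phi>" "e \<in> E n"
  shows "\<Phi> e ` disc_set n \<subseteq> e \<union> \<Union>(\<Union>m<n. E m)"
proof -
  obtain F where "F \<subseteq> (\<Union>m<n. E m)" "\<Phi> e ` disc_boundary n \<subseteq> \<Union>F"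
    using CW_structureD(4) [OF assms] by blast
  then have "\<Phi> e ` disc_boundary n \<subseteq> \<Union>(\<Union>m<n. E m)"
    by (meson Union_mono order_trans)
  then show ?thesis
    unfolding disc_set_split image_Un CW_structureD(2) [OF assms] by (rule Un_mono [OF order_refl])
qed

text \<open>The image of the disc is compact, hence closed in a Hausdorff space, and it contains the
  open cell.\<close>

lemma closure_of_cell_subset:
  assumes CW: "CW_structure K E \<Phi>" "e \<in> E n" and "Hausdorff_space K"
  shows "K closure_of e \<subseteq> \<Phi> e ` disc_set n"
proof (rule closure_of_minimal)
  show "e \<subseteq> \<Phi> e ` disc_set n"
    unfolding disc_set_split image_Un CW_structureD(2) [OF CW] by (rule Un_upper1)
  have "compactin (disc n) (disc_set n)"
    by (simp add: disc_eq compactin_subtopology compact_disc_set)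
  then show "closedin K (\<Phi> e ` disc_set n)"
    using compactin_imp_closedin image_compactin CW_structureD(1) [OF CW] assms(3) by blast
qed

text \<open>A characteristic map is a relative homeomorphism from the disc and its boundary onto
  their images, so the property passes from the disc to the closed cell, simultaneously with the
  factor \<open>J\<close>.\<close>

lemma HELP_cell:
  fixes J :: "real set"
  assumes CW: "CW_structure K E \<Phi>" "e \<in> E n" and "Hausdorff_space K" "compact J" "J0 \<subseteq> J"
    and disc: "HELP X Y f (top_of_set (disc_set n \<times> J)) (disc_boundary n \<times> J \<union> disc_set n \<times> J0)"
  shows "HELP X Y f (subtopology (prod_topology K (top_of_set J)) (\<Phi> e ` disc_set n \<times> J))
    (\<Phi> e ` disc_boundary n \<times> J \<union> \<Phi> e ` disc_set n \<times> J0)"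
proof (rule HELP_compact_quotient [OF disc, where q = "\<lambda>(x, t). (\<Phi> e x, t)"])
  note cell = CW_structureD [OF CW]
  have "continuous_map (prod_topology (disc n) (top_of_set J)) (prod_topology K (top_of_set J))
      (\<lambda>(x, t). (\<Phi> e x, t))"
    unfolding case_prod_unfold
    by (intro continuous_map_pairedI continuous_map_compose
        [OF continuous_map_fst cell(1), unfolded o_def]
        continuous_map_snd)
  then show "continuous_map (top_of_set (disc_set n \<times> J))
      (subtopology (prod_topology K (top_of_set J)) (\<Phi> e ` disc_set n \<times> J)) (\<lambda>(x, t). (\<Phi> e x, t))"
    by (auto simp: disc_eq continuous_map_in_subtopology)
  show "compact_space (top_of_set (disc_set n \<times> J))"
    using \<open>compact J\<close> by (simp add: compact_space_subtopology compact_Times compact_disc_set)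
  have "Hausdorff_space (prod_topology K (top_of_set J))"
    using \<open>Hausdorff_space K\<close> Hausdorff_space_subtopology [OF Hausdorff_space_euclidean]
    by (auto simp: Hausdorff_space_prod_topology)
  then show "Hausdorff_space (subtopology (prod_topology K (top_of_set J)) (\<Phi> e ` disc_set n \<times> J))"
    by (rule Hausdorff_space_subtopology)
  have "\<Phi> e ` disc_set n \<subseteq> topspace K"
    using continuous_map_image_subset_topspace [OF cell(1)] by (simp add: disc_eq)
  then have "topspace (subtopology (prod_topology K (top_of_set J)) (\<Phi> e ` disc_set n \<times> J))
      = \<Phi> e ` disc_set n \<times> J"
    by auto
  then show "(\<lambda>(x, t). (\<Phi> e x, t)) ` topspace (top_of_set (disc_set n \<times> J)) =
      topspace (subtopology (prod_topology K (top_of_set J)) (\<Phi> e ` disc_set n \<times> J))"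
    by (simp only: topspace_euclidean_subtopology image_paired_Times image_ident)
  \<comment> \<open>Boundary points land in lower cells and interior points in \<open>e\<close>;
    since cells are disjoint, no interior point is identified with a boundary point.\<close>
  have bd: "x \<in> disc_boundary n \<longleftrightarrow> \<Phi> e x \<in> \<Phi> e ` disc_boundary n" if x: "x \<in> disc_set n" for x
  proof
    assume x_bd: "\<Phi> e x \<in> \<Phi> e ` disc_boundary n"
    obtain m d where "m < n" "d \<in> E m" "\<Phi> e x \<in> d"
      using cell_boundary_lower [OF CW x_bd] by blast
    have "\<Phi> e x \<notin> e"
      using CW_cells_disjoint [OF CW(1) \<open>\<Phi> e x \<in> d\<close> _ \<open>d \<in> E m\<close> CW(2)] \<open>m < n\<close> by auto
    then have "\<Phi> e x \<notin> \<Phi> e ` disc_interior n"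
      unfolding cell(2) .
    then have "x \<notin> disc_interior n"
      using imageI by metis
    then show "x \<in> disc_boundary n"
      using x unfolding disc_set_split by simp
  qed simp
  show "p \<in> disc_boundary n \<times> J \<union> disc_set n \<times> J0 \<longleftrightarrow>
      (case p of (x, t) \<Rightarrow> (\<Phi> e x, t)) \<in> \<Phi> e ` disc_boundary n \<times> J \<union> \<Phi> e ` disc_set n \<times> J0"
    if "p \<in> topspace (top_of_set (disc_set n \<times> J))" for p
    using that bd by auto
  fix p p'
  assume p: "p \<in> topspace (top_of_set (disc_set n \<times> J))" "p' \<in> topspace (top_of_set
      (disc_set n \<times> J))"
    and eq: "(case p of (x, t) \<Rightarrow> (\<Phi> e x, t)) = (case p' of (x, t) \<Rightarrow> (\<Phi> e x, t))"
    and nbd: "(case p of (x, t) \<Rightarrow> (\<Phi> e x, t)) \<notin> \<Phi> e ` disc_boundary n \<times> J \<union> \<Phi> e ` disc_set n \<times> J0"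
  obtain x t x' t' where [simp]: "p = (x, t)" "p' = (x', t')"
    by fastforce
  have xD: "x \<in> disc_set n" "x' \<in> disc_set n" "t \<in> J" and eqs: "\<Phi> e x = \<Phi> e x'" "t = t'"
    using p eq by simp_all
  have "\<Phi> e x \<notin> \<Phi> e ` disc_boundary n"
    using nbd xD(3) by simp
  then have "x \<notin> disc_boundary n" "x' \<notin> disc_boundary n"
    using bd [OF xD(1)] bd [OF xD(2)] eqs(1) by simp_all
  then have "x \<in> disc_interior n" "x' \<in> disc_interior n"
    using xD unfolding disc_set_split by simp_all
  then have "x = x'"
    using inj_on_eq_iff [OF cell(3), of x x'] eqs(1) by simp
  then show "p = p'"
    using eqs(2) by simp
qed

text \<open>The partial lift is kept as a total function whose continuity is recorded only over
  \<open>J0\<close> and over the closures of cells of dimension below \<open>n\<close>. Thus no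
  topology on skeleta has to be discussed.\<close>

lemma HELP_skeleton_step:
  fixes J :: "real set"
  assumes CW: "CW_structure K E \<Phi>" and "Hausdorff_space K" "compact J" "closed J0" "J0 \<subseteq> J"
    and disc: "\<And>n. HELP X Y f (top_of_set (disc_set n \<times> J)) (disc_boundary n \<times> J \<union> disc_set n \<times> J0)"
    and b: "continuous_map (prod_topology K (top_of_set J)) Y b"
    and \<sigma>0: "path_lift X Y f (subtopology (prod_topology K (top_of_set J)) (UNIV \<times> J0)) b \<sigma>"
    and \<sigma>: "\<And>m e. m < n \<Longrightarrow> e \<in> E m \<Longrightarrow>
      path_lift X Y f (subtopology (prod_topology K (top_of_set J)) ((K closure_of e) \<times> J)) b \<sigma>"
  shows "\<exists>\<tau>. (\<forall>x\<in>topspace K. \<forall>t\<in>J0. \<tau> (x, t) = \<sigma> (x, t)) \<and>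
    (\<forall>m<n. \<forall>e\<in>E m. \<forall>x\<in>e. \<forall>t\<in>J. \<tau> (x, t) = \<sigma> (x, t)) \<and>
    (\<forall>m<Suc n. \<forall>e\<in>E m. path_lift X Y f (subtopology (prod_topology K (top_of_set J))
        ((K closure_of e) \<times> J)) b \<tau>)"
proof -
  let ?T = "prod_topology K (top_of_set J)"
  have "\<exists>\<tau>. path_lift X Y f (subtopology ?T (\<Phi> e ` disc_set n \<times> J)) b \<tau> \<and>
      (\<forall>p \<in> \<Phi> e ` disc_boundary n \<times> J \<union> \<Phi> e ` disc_set n \<times> J0. \<tau> p = \<sigma> p)" if e: "e \<in> E n" for e
  proof -
    note cell = CW_structureD [OF CW e]
    let ?C = "\<Phi> e ` disc_set n \<times> J" and ?L = "\<Phi> e ` disc_boundary n \<times> J \<union> \<Phi> e ` disc_set n \<times> J0"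
    obtain F where F: "finite F" "F \<subseteq> (\<Union>m<n. E m)" "\<Phi> e ` disc_boundary n \<subseteq> \<Union>F"
      using cell(4) by blast
    have C: "\<Phi> e ` disc_set n \<subseteq> topspace K"
      using continuous_map_image_subset_topspace [OF cell(1)] by (simp add: disc_eq)
    have L: "?L \<subseteq> topspace ?T \<inter> ?C"
      using C \<open>J0 \<subseteq> J\<close> disc_set_split by auto
    have cl: "d \<subseteq> K closure_of d" if "d \<in> F" for d
      using F(2) that CW_structureD(5) [OF CW] by (intro closure_of_subset) blast
    \<comment> \<open>Closure finiteness enters here: the cell boundary is covered by finitely many
      closed cells of lower dimension, so continuity on \<open>?L\<close> follows by pasting. The
      index \<open>None\<close> stands for the part over \<open>J0\<close>.\<close>
    have "path_lift X Y f (subtopology ?T ?L) b \<sigma>"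
    proof (rule path_lift_paste [where I = "insert None (Some ` F)" and
          T = "\<lambda>i. ?L \<inter> (case i of None \<Rightarrow> topspace K \<times> J0 | Some d \<Rightarrow> (K closure_of d) \<times> J)"])
      fix i assume i: "i \<in> insert None (Some ` F)"
      let ?A = "case i of None \<Rightarrow> topspace K \<times> J0 | Some d \<Rightarrow> (K closure_of d) \<times> J"
      have "closedin ?T ?A"
      proof (cases i)
        case None
        have "closedin (top_of_set J) J0"
          using \<open>closed J0\<close> \<open>J0 \<subseteq> J\<close> by (rule closed_subset [rotated])
        then show ?thesis
          using None by (simp add: closedin_prod_Times_iff)
      next
        case (Some d)
        have "closedin (top_of_set J) J"
          by simp
        then show ?thesis
          using Some by (simp add: closedin_prod_Times_iff)
      qed
      then show "closedin (subtopology ?T ?L) (?L \<inter> ?A)"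
        by (auto simp: closedin_subtopology)
      have "path_lift X Y f (subtopology ?T ?A) b \<sigma>"
      proof (cases i)
        case None
        then show ?thesis
          using path_lift_subtopology_mono [OF \<sigma>0, of "topspace K \<times> J0"] by auto
      next
        case (Some d)
        then show ?thesis
          using \<sigma> F(2) i by auto
      qed
      then show "path_lift X Y f (subtopology (subtopology ?T ?L) (?L \<inter> ?A)) b \<sigma>"
        unfolding subtopology_subtopology by (rule path_lift_subtopology_mono) auto
    next
      show "topspace (subtopology ?T ?L) \<subseteq> (\<Union>i\<in>insert None (Some ` F).
          ?L \<inter> (case i of None \<Rightarrow> topspace K \<times> J0 | Some d \<Rightarrow> (K closure_of d) \<times> J))"
      proof
        fix p assume p: "p \<in> topspace (subtopology ?T ?L)"
        show "p \<in> (\<Union>i\<in>insert None (Some ` F).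
            ?L \<inter> (case i of None \<Rightarrow> topspace K \<times> J0 | Some d \<Rightarrow> (K closure_of d) \<times> J))"
        proof (cases "p \<in> topspace K \<times> J0")
          case True
          then show ?thesis
            using p by simp
        next
          case False
          then have "p \<in> \<Phi> e ` disc_boundary n \<times> J"
            using p by auto
          then obtain d where "d \<in> F" "p \<in> d \<times> J"
            using F(3) by blast
          then have "p \<in> ?L \<inter> (case Some d of None \<Rightarrow> topspace K \<times> J0 | Some d \<Rightarrow>
              (K closure_of d) \<times> J)"
            using p cl by auto
          then show ?thesis
            using \<open>d \<in> F\<close> by blast
        qed
      qed
    qed (use F in auto)
    then have "path_lift X Y f (subtopology (subtopology ?T ?C) ?L) b \<sigma>"
      using L by (simp add: subtopology_subtopology Int_absorb1)
    then obtain \<tau> where "path_lift X Y f (subtopology ?T ?C) b \<tau>"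
      "\<And>p. p \<in> topspace (subtopology ?T ?C) \<Longrightarrow> p \<in> ?L \<Longrightarrow> \<tau> p = \<sigma> p"
      using HELPD [OF HELP_cell [OF CW e assms(2,3,5) disc] continuous_map_from_subtopology [OF b]]
          by blast
    moreover from this(2) have "\<forall>p\<in>?L. \<tau> p = \<sigma> p"
      using L unfolding topspace_subtopology by blast
    ultimately show ?thesis
      by blast
  qed
  then obtain \<tau>e where \<tau>e: "\<And>e. e \<in> E n \<Longrightarrow> path_lift X Y f (subtopology ?T (\<Phi> e ` disc_set n \<times> J)) b
      (\<tau>e e)"
    and ext: "\<And>e p. e \<in> E n \<Longrightarrow> p \<in> \<Phi> e ` disc_boundary n \<times> J \<union> \<Phi> e ` disc_set n \<times> J0 \<Longrightarrow> \<tau>e e p = \<sigma> p"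
    by metis
  \<comment> \<open>Only open \<open>n\<close>-cells receive new values, so disjointness of cells
    makes the choice well defined. On the boundary of a cell \<open>\<tau>e\<close> equals
    \<open>\<sigma>\<close>, so \<open>\<tau>\<close> still agrees with \<open>\<tau>e\<close> on
    the closed cell.\<close>
  define \<tau> where "\<tau> p = (if \<exists>e\<in>E n. fst p \<in> e then \<tau>e (THE e. e \<in> E n \<and> fst p \<in> e) p else \<sigma> p)"
      for p
  have on_cell: "\<tau> (x, t) = \<tau>e e (x, t)" if "e \<in> E n" "x \<in> e" for e x t
  proof -
    have "(THE d. d \<in> E n \<and> x \<in> d) = e"
      by (rule the_equality) (use that CW_cells_disjoint [OF CW] in blast)+
    then show ?thesis
      using that by (auto simp: \<tau>_def)
  qed
  have below: "\<tau> (x, t) = \<sigma> (x, t)" if "m < n" "e \<in> E m" "x \<in> e" for m e x t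
  proof -
    have "\<not> (\<exists>e\<in>E n. x \<in> e)"
      using CW_cells_disjoint [OF CW that(3) _ that(2)] that(1) by auto
    then show ?thesis
      by (simp add: \<tau>_def)
  qed
  have on_closed_cell: "\<tau> (x, t) = \<tau>e e (x, t)" if "e \<in> E n" "x \<in> \<Phi> e ` disc_set n" "t \<in> J"
      for e x t
  proof (cases "x \<in> e")
    case False
    then have bd: "x \<in> \<Phi> e ` disc_boundary n"
      using that CW_structureD(2) [OF CW that(1)] disc_set_split by auto
    obtain m d where "m < n" "d \<in> E m" "x \<in> d"
      using cell_boundary_lower [OF CW \<open>e \<in> E n\<close> bd] by blast
    then show ?thesis
      using below ext [OF that(1)] bd that(3) by simp
  qed (use on_cell that in auto)
  show ?thesis
  proof (intro exI [of _ \<tau>] conjI ballI allI impI)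
    fix x t assume "x \<in> topspace K" "t \<in> J0"
    show "\<tau> (x, t) = \<sigma> (x, t)"
    proof (cases "\<exists>e\<in>E n. x \<in> e")
      case True
      then obtain e where e: "e \<in> E n" "x \<in> e"
        by blast
      then have "x \<in> \<Phi> e ` disc_set n"
        using CW_structureD(2) [OF CW e(1)] disc_set_split by auto
      then show ?thesis
        using on_cell [OF e] ext [OF e(1)] \<open>t \<in> J0\<close> by simp
    qed (simp add: \<tau>_def)
  next
    fix m e assume "m < Suc n" and e: "e \<in> E m"
    show "path_lift X Y f (subtopology ?T ((K closure_of e) \<times> J)) b \<tau>"
    proof (cases "m = n")
      case True
      have "path_lift X Y f (subtopology ?T (\<Phi> e ` disc_set n \<times> J)) b \<tau>"
        by (rule path_lift_cong [OF \<tau>e]) (use True e on_closed_cell in auto)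
      then show ?thesis
        by (rule path_lift_subtopology_mono)
          (use closure_of_cell_subset [OF CW e \<open>Hausdorff_space K\<close>] True in auto)
    next
      case False
      then have m: "m < n"
        using \<open>m < Suc n\<close> by simp
      \<comment> \<open>The closure of a lower cell consists of lower cells only, where nothing has
        changed.\<close>
      have cl: "\<exists>k<n. \<exists>d\<in>E k. x \<in> d" if "x \<in> K closure_of e" for x
      proof -
        have "x \<in> e \<union> \<Union>(\<Union>k<m. E k)"
          using that closure_of_cell_subset [OF CW e \<open>Hausdorff_space K\<close>] closed_cell_subset
              [OF CW e] by blast
        then show ?thesis
          using m e by (auto intro: less_trans)
      qed
      show ?thesis
      proof (rule path_lift_cong [OF \<sigma> [OF m e] refl])
        fix p assume "p \<in> topspace (subtopology ?T ((K closure_of e) \<times> J))"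
        then show "\<sigma> p = \<tau> p"
          using cl [of "fst p"] below by (cases p) fastforce
      qed
    qed
  qed (use below in auto)
qed

text \<open>The extra factor \<open>J\<close> serves two purposes: \<open>J = {0}\<close> gives
  extension over \<open>K\<close> itself, \<open>J = {0..1}\<close> extension of homotopies relative
  to their ends. Dependent choice produces a sequence of partial lifts in which every point is
  eventually frozen, and the weak topology makes the limit continuous.\<close>

proposition HELP_CW:
  fixes X :: "'x topology" and Y :: "'y topology" and K :: "'k topology" and J :: "real set"
  assumes CW: "CW_structure K E \<Phi>" and Haus: "Hausdorff_space K" and J: "compact J" "closed J0"
      "J0 \<subseteq> J"
    and disc: "\<And>n. HELP X Y f (top_of_set (disc_set n \<times> J)) (disc_boundary n \<times> J \<union> disc_set n \<times> J0)"
  shows "HELP X Y f (prod_topology K (top_of_set J)) (UNIV \<times> J0)"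
  unfolding HELP_def
proof (intro allI impI)
  let ?T = "prod_topology K (top_of_set J)"
  fix b \<sigma>
  assume b: "continuous_map ?T Y b" and \<sigma>: "path_lift X Y f (subtopology ?T (UNIV \<times> J0)) b \<sigma>"
  define P where "P n \<tau> \<longleftrightarrow> (\<forall>x\<in>topspace K. \<forall>t\<in>J0. \<tau> (x, t) = \<sigma> (x, t)) \<and>
    (\<forall>m<n. \<forall>e\<in>E m. path_lift X Y f (subtopology ?T ((K closure_of e) \<times> J)) b \<tau>)" for n \<tau>
  define Q where "Q n \<tau> \<tau>' \<longleftrightarrow> (\<forall>m<n. \<forall>e\<in>E m. \<forall>x\<in>e. \<forall>t\<in>J. \<tau>' (x, t) = \<tau> (x, t))"
    for n :: nat and \<tau> \<tau>' :: "'k \<times> real \<Rightarrow> 'x \<times> (real \<Rightarrow> 'y)"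
  have "\<exists>\<tau>'. P (Suc n) \<tau>' \<and> Q n \<tau> \<tau>'" if P: "P n \<tau>" for n \<tau>
  proof -
    have base: "path_lift X Y f (subtopology ?T (UNIV \<times> J0)) b \<tau>"
      by (rule path_lift_cong [OF \<sigma> refl]) (use P in \<open>auto simp: P_def\<close>)
    have lower: "path_lift X Y f (subtopology ?T ((K closure_of e) \<times> J)) b \<tau>"
      if "m < n" "e \<in> E m" for m e
      using P that unfolding P_def by simp
    have "\<exists>\<tau>'. (\<forall>x\<in>topspace K. \<forall>t\<in>J0. \<tau>' (x, t) = \<tau> (x, t)) \<and>
      (\<forall>m<n. \<forall>e\<in>E m. \<forall>x\<in>e. \<forall>t\<in>J. \<tau>' (x, t) = \<tau> (x, t)) \<and>
      (\<forall>m<Suc n. \<forall>e\<in>E m. path_lift X Y f (subtopology ?T ((K closure_of e) \<times> J)) b \<tau>')"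
      by (rule HELP_skeleton_step [OF CW Haus J disc b base]) (rule lower)
    then obtain \<tau>' where \<tau>': "\<forall>x\<in>topspace K. \<forall>t\<in>J0. \<tau>' (x, t) = \<tau> (x, t)"
      "\<forall>m<n. \<forall>e\<in>E m. \<forall>x\<in>e. \<forall>t\<in>J. \<tau>' (x, t) = \<tau> (x, t)"
      "\<forall>m<Suc n. \<forall>e\<in>E m. path_lift X Y f (subtopology ?T ((K closure_of e) \<times> J)) b \<tau>'"
      by (elim exE conjE)
    then have "P (Suc n) \<tau>'" "Q n \<tau> \<tau>'"
      using P unfolding P_def Q_def by simp_all
    then show ?thesis
      by blast
  qed
  moreover have "P 0 \<sigma>"
    by (simp add: P_def)
  ultimately obtain \<tau> where P: "\<And>n. P n (\<tau> n)" and Q: "\<And>n. Q n (\<tau> n) (\<tau> (Suc n))"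
    using dependent_nat_choice [of P Q] by metis
  have stable: "\<tau> (n + k) (x, t) = \<tau> n (x, t)" if "m < n" "e \<in> E m" "x \<in> e" "t \<in> J" for m n k e x t
    using that
  proof (induction k)
    case (Suc k)
    have "\<tau> (Suc (n + k)) (x, t) = \<tau> (n + k) (x, t)"
      using Q [of "n + k", unfolded Q_def, rule_format, of m e x t] Suc.prems by simp
    then show ?case
      using Suc by simp
  qed simp
  \<comment> \<open>Stage \<open>n\<close> has dealt with the cells of dimension strictly below
    \<open>n\<close>, so a point of an \<open>n\<close>-cell has its final value from stage
    \<open>Suc n\<close> on.\<close>
  define \<upsilon> where "\<upsilon> p = \<tau> (Suc (THE n. \<exists>e\<in>E n. fst p \<in> e)) p" for p
  have \<upsilon>: "\<upsilon> (x, t) = \<tau> n (x, t)" if "m < n" "e \<in> E m" "x \<in> e" "t \<in> J" for m n e x t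
  proof -
    have "(THE n. \<exists>e\<in>E n. x \<in> e) = m"
      by (rule the_equality) (use that CW_cells_disjoint [OF CW] in blast)+
    then show ?thesis
      using stable [of m "Suc m" e x t "n - Suc m"] that by (simp add: \<upsilon>_def)
  qed
  have cover: "\<exists>n. \<exists>e\<in>E n. x \<in> e" if "x \<in> topspace K" for x
    using CW [unfolded CW_structure_def, THEN conjunct1] that by blast
  have "path_lift X Y f ?T b \<upsilon>"
  proof (rule path_lift_weak_topology [where I = "\<Union>n. E n" and C = "\<lambda>e. K closure_of e"])
    show "topspace K \<subseteq> (\<Union>e\<in>\<Union>n. E n. K closure_of e)"
    proof
      fix x assume "x \<in> topspace K"
      then obtain n e where e: "e \<in> E n" "x \<in> e"
        using cover by blast
      then have "x \<in> K closure_of e"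
        using closure_of_subset [OF CW_structureD(5) [OF CW e(1)]] by (simp add: subset_iff)
      then show "x \<in> (\<Union>e\<in>\<Union>n. E n. K closure_of e)"
        using e by auto
    qed
    show "closedin K A" if "A \<subseteq> topspace K" "\<And>e. e \<in> (\<Union>n. E n) \<Longrightarrow> closedin K (A \<inter> K closure_of e)"
        for A
    proof -
      have "\<forall>n. \<forall>e\<in>E n. closedin K (A \<inter> K closure_of e)"
        using that(2) by blast
      then show ?thesis
        using CW [unfolded CW_structure_def] that(1) by (elim conjE) simp
    qed
    fix e assume "e \<in> (\<Union>n. E n)"
    then obtain n where e: "e \<in> E n"
      by blast
    show "path_lift X Y f (subtopology ?T ((K closure_of e) \<times> J)) b \<upsilon>"
    proof (rule path_lift_cong [where \<sigma> = "\<tau> (Suc n)"])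
      show "path_lift X Y f (subtopology ?T ((K closure_of e) \<times> J)) b (\<tau> (Suc n))"
        using P [of "Suc n"] e by (auto simp: P_def)
      fix p assume "p \<in> topspace (subtopology ?T ((K closure_of e) \<times> J))"
      then obtain x t where p: "p = (x, t)" "x \<in> K closure_of e" "t \<in> J"
        by auto
      then have "x \<in> e \<union> \<Union>(\<Union>k<n. E k)"
        using closure_of_cell_subset [OF CW e Haus] closed_cell_subset [OF CW e] by blast
      then obtain m d where "m < Suc n" "d \<in> E m" "x \<in> d"
        using e by (auto intro: less_SucI)
      then show "\<tau> (Suc n) p = \<upsilon> p"
        using \<upsilon> p by metis
    qed simp
  qed (use J in auto)
  moreover have "\<upsilon> p = \<sigma> p" if mem: "p \<in> topspace ?T \<inter> UNIV \<times> J0" for p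
  proof -
    obtain x t where p: "p = (x, t)" "x \<in> topspace K" "t \<in> J0"
      using mem by auto
    then show ?thesis
      using P by (simp add: \<upsilon>_def P_def)
  qed
  ultimately show "\<exists>\<tau>. path_lift X Y f ?T b \<tau> \<and> (\<forall>p\<in>topspace ?T \<inter> UNIV \<times> J0. \<tau> p = \<sigma> p)"
    by blast
qed


section \<open>Equivalences of categories are full and essentially surjective\<close>

text \<open>The record \<open>cat\<close> carries no axioms, but cancelling an isomorphism needs the
  unit laws and associativity; they are proved for \<open>Hot\<close> in
  \<open>is_category_Hot\<close>.\<close>

definition is_category :: "('o, 'm) cat \<Rightarrow> bool" where
  "is_category C \<longleftrightarrow>
     (\<forall>a \<in> Obj C. Id C a \<in> Hom C a a) \<and>
     (\<forall>a \<in> Obj C. \<forall>b \<in> Obj C. \<forall>c \<in> Obj C. \<forall>k \<in> Hom C a b. \<forall>h \<in> Hom C b c. Comp C h k \<in> Hom C a c) \<and>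
     (\<forall>a \<in> Obj C. \<forall>b \<in> Obj C. \<forall>k \<in> Hom C a b. Comp C (Id C b) k = k \<and> Comp C k (Id C a) = k) \<and>
     (\<forall>a \<in> Obj C. \<forall>b \<in> Obj C. \<forall>c \<in> Obj C. \<forall>d \<in> Obj C.
        \<forall>k \<in> Hom C a b. \<forall>h \<in> Hom C b c. \<forall>g \<in> Hom C c d. Comp C g (Comp C h k) = Comp C
            (Comp C g h) k)"

lemma categoryD:
  assumes "is_category C"
  shows "a \<in> Obj C \<Longrightarrow> Id C a \<in> Hom C a a"
    and "\<lbrakk>a \<in> Obj C; b \<in> Obj C; c \<in> Obj C; k \<in> Hom C a b; h \<in> Hom C b c\<rbrakk> \<Longrightarrow> Comp C h k \<in> Hom C a c"
    and "\<lbrakk>a \<in> Obj C; b \<in> Obj C; k \<in> Hom C a b\<rbrakk> \<Longrightarrow> Comp C (Id C b) k = k"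
    and "\<lbrakk>a \<in> Obj C; b \<in> Obj C; k \<in> Hom C a b\<rbrakk> \<Longrightarrow> Comp C k (Id C a) = k"
    and "\<lbrakk>a \<in> Obj C; b \<in> Obj C; c \<in> Obj C; d \<in> Obj C; k \<in> Hom C a b; h \<in> Hom C b c; g \<in> Hom C c d\<rbrakk>
      \<Longrightarrow> Comp C g (Comp C h k) = Comp C (Comp C g h) k"
  using assms unfolding is_category_def by simp_all

lemma iso_cancel_right:
  assumes C: "is_category C" and ob: "a \<in> Obj C" "b \<in> Obj C" "c \<in> Obj C"
    and e: "is_iso C a b e" and gh: "g \<in> Hom C b c" "h \<in> Hom C b c" and eq: "Comp C g e
        = Comp C h e"
  shows "g = h"
proof -
  obtain k where k: "k \<in> Hom C b a" "Comp C e k = Id C b" and eH: "e \<in> Hom C a b"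
    using e unfolding is_iso_def by blast
  have "x = Comp C (Comp C x e) k" if "x \<in> Hom C b c" for x
    using categoryD(5) [OF C ob(2) ob(1) ob(2) ob(3) k(1) eH that] categoryD(4)
        [OF C ob(2) ob(3) that] k(2)
    by simp
  then show ?thesis
    using gh eq by metis
qed

text \<open>Take \<open>h\<close> to be \<open>Gm k\<close> conjugated by the unit
  \<open>\<eta>\<close>. Naturality of \<open>\<eta>\<close> gives \<open>Gm (Fm h) = Gm k\<close>,
  and naturality of \<open>\<epsilon>\<close> shows that \<open>Gm\<close> is injective on parallel
  arrows.\<close>

lemma equivalence_full:
  assumes C: "is_category C" and D: "is_category D" and eq: "equivalence_of_categories C D Fo Fm"
    and ab: "a \<in> Obj C" "b \<in> Obj C" and k: "k \<in> Hom D (Fo a) (Fo b)"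
  shows "\<exists>h \<in> Hom C a b. Fm h = k"
proof -
  obtain Go Gm where F: "is_functor C D Fo Fm" and G: "is_functor D C Go Gm"
    and n1: "naturally_isomorphic C C (\<lambda>a. a) (\<lambda>h. h) (\<lambda>a. Go (Fo a)) (\<lambda>h. Gm (Fm h))"
    and n2: "naturally_isomorphic D D (\<lambda>b. Fo (Go b)) (\<lambda>k. Fm (Gm k)) (\<lambda>b. b) (\<lambda>k. k)"
    using eq unfolding equivalence_of_categories_def by blast
  obtain \<eta> where \<eta>: "\<And>a. a \<in> Obj C \<Longrightarrow> is_iso C a (Go (Fo a)) (\<eta> a)"
    and \<eta>_nat: "\<And>a b h. \<lbrakk>a \<in> Obj C; b \<in> Obj C; h \<in> Hom C a b\<rbrakk> \<Longrightarrow> Comp C (Gm (Fm h)) (\<eta> a) = Comp C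
        (\<eta> b) h"
    using n1 unfolding naturally_isomorphic_def by blast
  obtain \<epsilon> where \<epsilon>: "\<And>a. a \<in> Obj D \<Longrightarrow> is_iso D (Fo (Go a)) a (\<epsilon> a)"
    and \<epsilon>_nat: "\<And>a b h. \<lbrakk>a \<in> Obj D; b \<in> Obj D; h \<in> Hom D a b\<rbrakk> \<Longrightarrow> Comp D h (\<epsilon> a) = Comp D (\<epsilon> b) (Fm
        (Gm h))"
    using n2 unfolding naturally_isomorphic_def by blast
  have Fo: "Fo a \<in> Obj D" if "a \<in> Obj C" for a
    using F that by (simp add: is_functor_def)
  have Fm: "Fm h \<in> Hom D (Fo a) (Fo b)" if "a \<in> Obj C" "b \<in> Obj C" "h \<in> Hom C a b" for a b h
    using F that by (simp add: is_functor_def)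
  have Go: "Go a \<in> Obj C" if "a \<in> Obj D" for a
    using G that by (simp add: is_functor_def)
  have Gm: "Gm h \<in> Hom C (Go a) (Go b)" if "a \<in> Obj D" "b \<in> Obj D" "h \<in> Hom D a b" for a b h
    using G that by (simp add: is_functor_def)
  let ?a = "Go (Fo a)" and ?b = "Go (Fo b)"
  have ob: "?a \<in> Obj C" "?b \<in> Obj C"
    using ab Fo Go by simp_all
  have \<eta>a: "\<eta> a \<in> Hom C a ?a" and \<eta>b: "\<eta> b \<in> Hom C b ?b"
    using \<eta> ab unfolding is_iso_def by simp_all
  obtain \<theta> where \<theta>: "\<theta> \<in> Hom C ?b b" "Comp C (\<eta> b) \<theta> = Id C ?b"
    using \<eta> [OF ab(2)] unfolding is_iso_def by blast
  have Gk: "Gm k \<in> Hom C ?a ?b"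
    using Gm [OF Fo [OF ab(1)] Fo [OF ab(2)] k] .
  have Gk\<eta>: "Comp C (Gm k) (\<eta> a) \<in> Hom C a ?b"
    using categoryD(2) [OF C ab(1) ob \<eta>a Gk] .
  define h where "h = Comp C \<theta> (Comp C (Gm k) (\<eta> a))"
  have h: "h \<in> Hom C a b"
    unfolding h_def using categoryD(2) [OF C ab(1) ob(2) ab(2) Gk\<eta> \<theta>(1)] .
  have "Comp C (Gm (Fm h)) (\<eta> a) = Comp C (\<eta> b) h"
    using \<eta>_nat [OF ab h] .
  also have "\<dots> = Comp C (Gm k) (\<eta> a)"
    unfolding h_def using categoryD(5) [OF C ab(1) ob(2) ab(2) ob(2) Gk\<eta> \<theta>(1) \<eta>b]
      categoryD(3) [OF C ab(1) ob(2) Gk\<eta>] \<theta>(2) by simp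
  finally have "Gm (Fm h) = Gm k"
    using iso_cancel_right [OF C ab(1) ob \<eta> [OF ab(1)]] Gm [OF Fo [OF ab(1)] Fo [OF ab(2)] Fm
        [OF ab h]] Gk
    by blast
  then have "Comp D (Fm h) (\<epsilon> (Fo a)) = Comp D k (\<epsilon> (Fo a))"
    using \<epsilon>_nat [OF Fo [OF ab(1)] Fo [OF ab(2)]] Fm [OF ab h] k by simp
  then have "Fm h = k"
    using iso_cancel_right [OF D _ _ _ \<epsilon> [OF Fo [OF ab(1)]]] Fo ob ab Fm [OF ab h] k by blast
  then show ?thesis
    using h by blast
qed

lemma equivalence_essentially_surjective:
  assumes "equivalence_of_categories C D Fo Fm" "b \<in> Obj D"
  shows "\<exists>a \<in> Obj C. \<exists>k. is_iso D (Fo a) b k"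
proof -
  obtain Go Gm where G: "is_functor D C Go Gm"
    and n2: "naturally_isomorphic D D (\<lambda>b. Fo (Go b)) (\<lambda>k. Fm (Gm k)) (\<lambda>b. b) (\<lambda>k. k)"
    using assms(1) unfolding equivalence_of_categories_def by blast
  have "Go b \<in> Obj C"
    using G assms(2) by (simp add: is_functor_def)
  moreover have "\<exists>k. is_iso D (Fo (Go b)) b k"
    using n2 assms(2) unfolding naturally_isomorphic_def by blast
  ultimately show ?thesis
    by blast
qed

section \<open>Homotopies relative to the ends\<close>

lemma continuous_map_apply_pair:
  assumes "continuous_map (prod_topology G unit_interval) X H" "continuous_map Z G a"
    "continuous_map Z unit_interval \<tau>"
  shows "continuous_map Z X (\<lambda>z. H (a z, \<tau> z))"
proof -
  have "continuous_map Z (prod_topology G unit_interval) (\<lambda>z. (a z, \<tau> z))"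
    using assms by (intro continuous_map_pairedI)
  from continuous_map_compose [OF this assms(1)] show ?thesis
    by (simp add: o_def)
qed

lemma continuous_map_fst_snd: "continuous_map (prod_topology A (prod_topology B C)) B (\<lambda>z. fst
    (snd z))"
  using continuous_map_compose [OF continuous_map_snd continuous_map_fst] by (simp add: o_def)

lemma continuous_map_snd_snd: "continuous_map (prod_topology A (prod_topology B C)) C (\<lambda>z. snd
    (snd z))"
  using continuous_map_compose [OF continuous_map_snd continuous_map_snd] by (simp add: o_def)

lemma continuous_map_interval:
  assumes "continuous_map Z unit_interval \<tau>" "continuous_on {0..1} \<phi>" "\<And>t. t \<in> {0..1} \<Longrightarrow> \<phi> t
      \<in> {0..1}"
  shows "continuous_map Z unit_interval (\<lambda>z. \<phi> (\<tau> z))"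
proof -
  have "continuous_map unit_interval unit_interval \<phi>"
    using assms by simp
  from continuous_map_compose [OF assms(1) this] show ?thesis
    by (simp add: o_def)
qed

lemma continuous_map_interval2:
  assumes "continuous_map Z unit_interval \<rho>" "continuous_map Z unit_interval \<tau>"
    and "continuous_on ({0..1} \<times> {0..1}) (\<lambda>p. \<phi> (fst p) (snd p))"
    and "\<And>s t. s \<in> {0..1} \<Longrightarrow> t \<in> {0..1} \<Longrightarrow> \<phi> s t \<in> {0..1}"
  shows "continuous_map Z unit_interval (\<lambda>z. \<phi> (\<rho> z) (\<tau> z))"
proof -
  have "continuous_map (prod_topology unit_interval unit_interval) unit_interval (\<lambda>p. \<phi> (fst p)
      (snd p))"
    using assms(3,4) by auto
  moreover have "continuous_map Z (prod_topology unit_interval unit_interval) (\<lambda>z. (\<rho> z, \<tau> z))"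
    using assms(1,2) by (intro continuous_map_pairedI)
  ultimately have "continuous_map Z unit_interval ((\<lambda>p. \<phi> (fst p) (snd p)) \<circ> (\<lambda>z. (\<rho> z, \<tau> z)))"
    using continuous_map_compose by blast
  then show ?thesis
    by (simp add: o_def)
qed

lemma continuous_map_if_le:
  assumes "continuous_map Z unit_interval \<tau>" "continuous_map Z X f" "continuous_map Z X g"
    and "\<And>z. z \<in> topspace Z \<Longrightarrow> \<tau> z = c \<Longrightarrow> f z = g z"
  shows "continuous_map Z X (\<lambda>z. if \<tau> z \<le> c then f z else g z)"
proof (rule continuous_map_cases_le [where p = \<tau> and q = "\<lambda>_. c" and f = f and g = g])
  show "continuous_map Z euclideanreal \<tau>"
    using assms(1) by (simp add: continuous_map_in_subtopology)
  show "continuous_map (subtopology Z {z \<in> topspace Z. \<tau> z \<le> c}) X f"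
    by (rule continuous_map_from_subtopology [OF assms(2)])
  show "continuous_map (subtopology Z {z \<in> topspace Z. c \<le> \<tau> z}) X g"
    by (rule continuous_map_from_subtopology [OF assms(3)])
  show "continuous_map Z euclideanreal (\<lambda>_. c)"
    by simp
qed (rule assms(4))

lemma homotopy_rel_iff:
  "(H, K) \<in> homotopy_rel G X \<longleftrightarrow>
     H \<in> maps (prod_topology G unit_interval) X \<and> K \<in> maps (prod_topology G unit_interval) X \<and>
     (\<exists>h. continuous_map (prod_topology unit_interval (prod_topology G unit_interval)) X h \<and>
        (\<forall>x\<in>topspace G. \<forall>t\<in>{0..1}. h (0, x, t) = H (x, t) \<and> h (1, x, t) = K (x, t)) \<and>
        (\<forall>x\<in>topspace G. \<forall>s\<in>{0..1}. h (s, x, 0) = H (x, 0) \<and> h (s, x, 1) = H (x, 1)))"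
  unfolding homotopy_rel_def
  by (simp, subst homotopic_with) (auto 0 3)

definition homotopy_class ::
  "'g topology \<Rightarrow> 'a topology \<Rightarrow> ('g \<times> real \<Rightarrow> 'a) \<Rightarrow> ('g \<times> real \<Rightarrow> 'a) set" where
  "homotopy_class G X H = homotopy_rel G X `` {H}"

lemma homotopy_rel_refl: "H \<in> maps (prod_topology G unit_interval) X \<Longrightarrow> (H, H) \<in> homotopy_rel G X"
  by (simp add: homotopy_rel_def maps_def)

lemma homotopy_rel_ends:
  assumes "(H, K) \<in> homotopy_rel G X" "x \<in> topspace G"
  shows "K (x, 0) = H (x, 0)" "K (x, 1) = H (x, 1)"
proof -
  have "\<forall>x\<in>topspace G. K (x, 0) = H (x, 0) \<and> K (x, 1) = H (x, 1)"
  proof -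
    have "homotopic_with (\<lambda>L. \<forall>x \<in> topspace G. L (x, 0) = H (x, 0) \<and> L (x, 1) = H (x, 1))
      (prod_topology G unit_interval) X H K"
      using assms(1) by (simp add: homotopy_rel_def)
    from homotopic_with_imp_property [OF this] show ?thesis
      by (rule conjunct2)
  qed
  then show "K (x, 0) = H (x, 0)" "K (x, 1) = H (x, 1)"
    using assms(2) by simp_all
qed

text \<open>The end condition is anchored at the first homotopy; as both have the same ends it can
  be moved to the second.\<close>

lemma homotopy_rel_sym:
  assumes "(H, K) \<in> homotopy_rel G X" shows "(K, H) \<in> homotopy_rel G X"
proof -
  note ends = homotopy_rel_ends [OF assms]
  have "homotopic_with (\<lambda>L. \<forall>x \<in> topspace G. L (x, 0) = H (x, 0) \<and> L (x, 1) = H (x, 1))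
      (prod_topology G unit_interval) X H K"
    using assms by (simp add: homotopy_rel_def)
  then have "homotopic_with (\<lambda>L. \<forall>x \<in> topspace G. L (x, 0) = K (x, 0) \<and> L (x, 1) = K (x, 1))
      (prod_topology G unit_interval) X K H"
    using ends by (subst homotopic_with_sym) (erule homotopic_with_mono, simp)
  then show ?thesis
    using assms by (simp add: homotopy_rel_def)
qed

lemma homotopy_rel_trans:
  assumes HK: "(H, K) \<in> homotopy_rel G X" and KL: "(K, L) \<in> homotopy_rel G X"
  shows "(H, L) \<in> homotopy_rel G X"
proof -
  note ends = homotopy_rel_ends [OF HK]
  have "homotopic_with (\<lambda>L. \<forall>x \<in> topspace G. L (x, 0) = K (x, 0) \<and> L (x, 1) = K (x, 1))
      (prod_topology G unit_interval) X K L"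
    using KL by (simp add: homotopy_rel_def)
  then have KL': "homotopic_with (\<lambda>L. \<forall>x \<in> topspace G. L (x, 0) = H (x, 0) \<and> L (x, 1) = H (x, 1))
      (prod_topology G unit_interval) X K L"
    by (rule homotopic_with_mono) (simp add: ends)
  have "homotopic_with (\<lambda>L. \<forall>x \<in> topspace G. L (x, 0) = H (x, 0) \<and> L (x, 1) = H (x, 1))
      (prod_topology G unit_interval) X H K"
    using HK by (simp add: homotopy_rel_def)
  from homotopic_with_trans [OF this KL'] show ?thesis
    using HK KL by (simp add: homotopy_rel_def)
qed

lemma homotopy_class_eq:
  assumes "(H, K) \<in> homotopy_rel G X" shows "homotopy_class G X H = homotopy_class G X K"
  unfolding homotopy_class_def
  using homotopy_rel_trans [OF assms] homotopy_rel_trans [OF homotopy_rel_sym [OF assms]] by blast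

section \<open>Changes of time parameter\<close>

text \<open>The unit, associativity and inverse laws each compare two reparametrizations of one and
  the same homotopy, so a single deformation lemma proves them all.\<close>

definition reparametrize ::
  "'g topology \<Rightarrow> ('g \<times> real \<Rightarrow> 'a) \<Rightarrow> (real \<Rightarrow> real) \<Rightarrow> 'g \<times> real \<Rightarrow> 'a" where
  "reparametrize G H \<phi> = (\<lambda>(x, t) \<in> topspace G \<times> {0..1}. H (x, \<phi> t))"

lemma reparametrize_maps:
  assumes "H \<in> maps (prod_topology G unit_interval) X" "continuous_on {0..1} \<phi>" "\<And>t. t \<in> {0..1}
      \<Longrightarrow> \<phi> t \<in> {0..1}"
  shows "reparametrize G H \<phi> \<in> maps (prod_topology G unit_interval) X"
proof -
  have "continuous_map (prod_topology G unit_interval) X (\<lambda>z. H (fst z, \<phi> (snd z)))"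
    using assms
    by (intro continuous_map_apply_pair [of G X H] continuous_map_interval [of _ snd \<phi>]
        continuous_map_fst continuous_map_snd) (simp_all add: maps_def)
  then have "continuous_map (prod_topology G unit_interval) X (reparametrize G H \<phi>)"
    by (rule continuous_map_eq) (auto simp: reparametrize_def)
  then show ?thesis
    by (simp add: maps_def reparametrize_def)
qed

text \<open>Two reparametrizations with the same ends are homotopic, since the interval is convex.\<close>

lemma reparametrize_rel:
  assumes H: "H \<in> maps (prod_topology G unit_interval) X"
    and \<phi>: "continuous_on {0..1} \<phi>" "\<And>t. t \<in> {0..1} \<Longrightarrow> \<phi> t \<in> {0..1}"
    and \<psi>: "continuous_on {0..1} \<psi>" "\<And>t. t \<in> {0..1} \<Longrightarrow> \<psi> t \<in> {0..1}"
    and ends: "\<phi> 0 = \<psi> 0" "\<phi> 1 = \<psi> 1"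
  shows "(reparametrize G H \<phi>, reparametrize G H \<psi>) \<in> homotopy_rel G X"
proof -
  let ?Z = "prod_topology unit_interval (prod_topology G unit_interval)"
  have conv: "(1 - s) * \<phi> t + s * \<psi> t \<in> {0..1}" if "s \<in> {0..1}" "t \<in> {0..1}" for s t
    using \<phi>(2) [OF that(2)] \<psi>(2) [OF that(2)] that(1) convexD_alt [of "{0..1::real}" "\<phi> t" "\<psi> t" s]
        by simp
  have "continuous_map ?Z unit_interval (\<lambda>z. (1 - fst z) * \<phi> (snd (snd z)) + fst z * \<psi> (snd
      (snd z)))"
  proof (rule continuous_map_interval2 [where \<rho> = fst and \<tau> = "\<lambda>z. snd (snd z)" and \<phi> = "\<lambda>s t.
      (1 - s) * \<phi> t + s * \<psi> t"])
    have "continuous_on ({0..1} \<times> {0..1}) (\<lambda>p. \<phi> (snd p))" "continuous_on ({0..1} \<times> {0..1}) (\<lambda>p. \<psi>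
        (snd p))"
      by (rule continuous_on_compose2 [OF \<phi>(1) continuous_on_snd [OF continuous_on_id]], force)
        (rule continuous_on_compose2 [OF \<psi>(1) continuous_on_snd [OF continuous_on_id]], force)
    then show "continuous_on ({0..1} \<times> {0..1}) (\<lambda>p. (1 - fst p) * \<phi> (snd p) + fst p * \<psi> (snd p))"
      by (intro continuous_on_add continuous_on_mult continuous_on_diff continuous_on_const
          continuous_on_fst continuous_on_id)
  qed (rule continuous_map_fst continuous_map_snd_snd conv; assumption)+
  then have "continuous_map ?Z X (\<lambda>z. H (fst (snd z), (1 - fst z) * \<phi> (snd (snd z)) + fst z * \<psi> (snd
      (snd z))))"
    using H by (intro continuous_map_apply_pair [of G X H] continuous_map_fst_snd)
        (simp_all add: maps_def)
  moreover have "\<phi> t + s * (\<psi> t - \<phi> t) = \<phi> t" if "t = 0 \<or> t = 1" for s t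
    using that ends by auto
  ultimately show ?thesis
    unfolding homotopy_rel_iff
    by (intro conjI reparametrize_maps H \<phi> \<psi> exI [of _ "\<lambda>z. H (fst (snd z), (1 - fst z) * \<phi> (snd
        (snd z)) + fst z * \<psi> (snd (snd z)))"])
      (simp_all add: reparametrize_def algebra_simps ends)
qed

lemma homotopies_maps: "H \<in> homotopies G X u v \<Longrightarrow> H \<in> maps (prod_topology G unit_interval) X"
  by (simp add: homotopies_def)

lemma reparametrize_id:
  assumes "H \<in> maps (prod_topology G unit_interval) X" shows "reparametrize G H (\<lambda>t. t) = H"
proof
  fix p show "reparametrize G H (\<lambda>t. t) p = H p"
    using assms by (cases p) (auto simp: reparametrize_def maps_def extensional_def)
qed

lemma concat_homotopies:
  assumes H: "H \<in> homotopies G X u v" and K: "K \<in> homotopies G X v w"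
  shows "concat_homotopy G H K \<in> homotopies G X u w"
proof -
  let ?Z = "prod_topology G unit_interval"
  \<comment> \<open>\<open>min 1\<close> and \<open>max 0\<close> change nothing on the half where a
    branch is used, but keep its argument in \<open>[0,1]\<close> on the other half. So both
    branches are continuous everywhere, as \<open>continuous_map_if_le\<close> demands.\<close>
  have "continuous_map ?Z X (\<lambda>z. if snd z \<le> 1/2 then H (fst z, min 1 (2 * snd z)) else K
      (fst z, max 0 (2 * snd z - 1)))"
  proof (rule continuous_map_if_le)
    show "continuous_map ?Z X (\<lambda>z. H (fst z, min 1 (2 * snd z)))"
      by (intro continuous_map_apply_pair [of G X H] continuous_map_interval [of _ snd "\<lambda>t. min 1
          (2 * t)"]
          continuous_map_fst continuous_map_snd continuous_intros)
              (use H in \<open>auto simp: homotopies_def maps_def\<close>)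
    show "continuous_map ?Z X (\<lambda>z. K (fst z, max 0 (2 * snd z - 1)))"
      by (intro continuous_map_apply_pair [of G X K] continuous_map_interval [of _ snd "\<lambda>t. max 0
          (2 * t - 1)"]
          continuous_map_fst continuous_map_snd continuous_intros)
              (use K in \<open>auto simp: homotopies_def maps_def\<close>)
    show "continuous_map ?Z unit_interval snd"
      by (rule continuous_map_snd)
  qed (use H K in \<open>auto simp: homotopies_def\<close>)
  then have "continuous_map ?Z X (concat_homotopy G H K)"
    by (rule continuous_map_eq) (auto simp: concat_homotopy_def)
  then show ?thesis
    using H K by (simp add: homotopies_def maps_def concat_homotopy_def)
qed

text \<open>Both deformations are run at once, one on each half; they match in the middle because
  each keeps the ends fixed.\<close>

lemma concat_homotopy_cong:
  assumes H: "(H, H') \<in> homotopy_rel G X" and K: "(K, K') \<in> homotopy_rel G X"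
    and Hu: "H \<in> homotopies G X u v" and Kv: "K \<in> homotopies G X v w"
  shows "(concat_homotopy G H K, concat_homotopy G H' K') \<in> homotopy_rel G X"
proof -
  let ?Z = "prod_topology unit_interval (prod_topology G unit_interval)"
  obtain h where h: "continuous_map ?Z X h"
    "\<And>x t. x\<in>topspace G \<Longrightarrow> t\<in>{0..1} \<Longrightarrow> h (0, x, t) = H (x, t)"
    "\<And>x t. x\<in>topspace G \<Longrightarrow> t\<in>{0..1} \<Longrightarrow> h (1, x, t) = H' (x, t)"
    "\<And>x s. x\<in>topspace G \<Longrightarrow> s\<in>{0..1} \<Longrightarrow> h (s, x, 0) = H (x, 0)"
    "\<And>x s. x\<in>topspace G \<Longrightarrow> s\<in>{0..1} \<Longrightarrow> h (s, x, 1) = H (x, 1)"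
    using H unfolding homotopy_rel_iff by blast
  obtain k where k: "continuous_map ?Z X k"
    "\<And>x t. x\<in>topspace G \<Longrightarrow> t\<in>{0..1} \<Longrightarrow> k (0, x, t) = K (x, t)"
    "\<And>x t. x\<in>topspace G \<Longrightarrow> t\<in>{0..1} \<Longrightarrow> k (1, x, t) = K' (x, t)"
    "\<And>x s. x\<in>topspace G \<Longrightarrow> s\<in>{0..1} \<Longrightarrow> k (s, x, 0) = K (x, 0)"
    "\<And>x s. x\<in>topspace G \<Longrightarrow> s\<in>{0..1} \<Longrightarrow> k (s, x, 1) = K (x, 1)"
    using K unfolding homotopy_rel_iff by blast
  have t: "continuous_map ?Z unit_interval (\<lambda>z. snd (snd z))"
    by (rule continuous_map_snd_snd)
  have reparam: "continuous_map ?Z X (\<lambda>z. j (fst z, fst (snd z), \<phi> (snd (snd z))))"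
    if "continuous_map ?Z X j" "continuous_on {0..1} \<phi>" "\<And>t. t \<in> {0..1} \<Longrightarrow> \<phi> t \<in> {0..1}" for j \<phi>
  proof -
    have "continuous_map ?Z ?Z (\<lambda>z. (fst z, fst (snd z), \<phi> (snd (snd z))))"
      by (intro continuous_map_pairedI continuous_map_fst continuous_map_fst_snd
          continuous_map_interval [OF t that(2,3)])
    from continuous_map_compose [OF this that(1)] show ?thesis
      by (simp add: o_def)
  qed
  define j where "j z = (if snd (snd z) \<le> 1/2 then h (fst z, fst (snd z), min 1 (2 * snd (snd z)))
    else k (fst z, fst (snd z), max 0 (2 * snd (snd z) - 1)))" for z
  have HK: "H (x, 1) = K (x, 0)" if "x \<in> topspace G" for x
    using Hu Kv that by (simp add: homotopies_def)
  have cont_h: "continuous_map ?Z X (\<lambda>z. h (fst z, fst (snd z), min 1 (2 * snd (snd z))))"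
    by (rule reparam [OF h(1), of "\<lambda>t. min 1 (2 * t)"]) (auto intro!: continuous_intros)
  have cont_k: "continuous_map ?Z X (\<lambda>z. k (fst z, fst (snd z), max 0 (2 * snd (snd z) - 1)))"
    by (rule reparam [OF k(1), of "\<lambda>t. max 0 (2 * t - 1)"]) (auto intro!: continuous_intros)
  have cont_j: "continuous_map ?Z X j"
    unfolding j_def by (rule continuous_map_if_le [OF t cont_h cont_k]) (auto simp: h k HK)
  have H'K': "H' \<in> homotopies G X u v" "K' \<in> homotopies G X v w"
    using H K Hu Kv homotopy_rel_ends [OF H] homotopy_rel_ends [OF K]
    by (auto simp: homotopies_def homotopy_rel_def)
  show ?thesis
    unfolding homotopy_rel_iff
  proof (intro conjI exI [of _ j] cont_j ballI)
    show "concat_homotopy G H K \<in> maps (prod_topology G unit_interval) X"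
      using concat_homotopies [OF Hu Kv] by (rule homotopies_maps)
    show "concat_homotopy G H' K' \<in> maps (prod_topology G unit_interval) X"
      using concat_homotopies [OF H'K'] by (rule homotopies_maps)
  qed (simp_all add: j_def concat_homotopy_def h k)
qed


section \<open>The groupoid of maps between two spaces\<close>

lemma concat_homotopy_apply:
  "x \<in> topspace G \<Longrightarrow> t \<in> {0..1} \<Longrightarrow>
    concat_homotopy G H K (x, t) = (if t \<le> 1/2 then H (x, 2 * t) else K (x, 2 * t - 1))"
  by (simp add: concat_homotopy_def)

lemma reparametrize_apply:
  "x \<in> topspace G \<Longrightarrow> t \<in> {0..1} \<Longrightarrow> reparametrize G H \<phi> (x, t) = H (x, \<phi> t)"
  by (simp add: reparametrize_def)

lemma concat_eq_reparametrize:
  assumes "\<And>x t. x \<in> topspace G \<Longrightarrow> t \<in> {0..1} \<Longrightarrow>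
      (if t \<le> 1/2 then H (x, 2 * t) else K (x, 2 * t - 1)) = W (x, \<phi> t)"
  shows "concat_homotopy G H K = reparametrize G W \<phi>"
proof
  fix p :: "'a \<times> real"
  obtain x t where p: "p = (x, t)"
    by fastforce
  show "concat_homotopy G H K p = reparametrize G W \<phi> p"
  proof (cases "x \<in> topspace G \<and> t \<in> {0..1}")
    case True
    then show ?thesis
      using assms [of x t] by (simp add: p concat_homotopy_def reparametrize_def)
  next
    case False
    then show ?thesis
      by (auto simp: p concat_homotopy_def reparametrize_def)
  qed
qed

lemma const_homotopies:
  assumes "u \<in> maps G X" shows "const_homotopy G u \<in> homotopies G X u u"
proof -
  have "continuous_map (prod_topology G unit_interval) X (u \<circ> fst)"
    using assms by (intro continuous_map_compose [OF continuous_map_fst]) (simp add: maps_def)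
  then have "continuous_map (prod_topology G unit_interval) X (const_homotopy G u)"
    by (rule continuous_map_eq) (auto simp: const_homotopy_def)
  then show ?thesis
    by (simp add: homotopies_def maps_def const_homotopy_def)
qed

lemma concat_reparametrize_rel:
  assumes W: "W \<in> maps (prod_topology G unit_interval) X"
    and "\<And>x t. x \<in> topspace G \<Longrightarrow> t \<in> {0..1} \<Longrightarrow>
      (if t \<le> 1/2 then H (x, 2 * t) else K (x, 2 * t - 1)) = W (x, \<phi> t)"
    and "continuous_on {0..1} \<phi>" "\<And>t. t \<in> {0..1} \<Longrightarrow> \<phi> t \<in> {0..1}"
    and "\<phi> 0 = 0" "\<phi> 1 = 1"
  shows "(concat_homotopy G H K, W) \<in> homotopy_rel G X"
proof -
  have "(reparametrize G W \<phi>, reparametrize G W (\<lambda>t. t)) \<in> homotopy_rel G X"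
    using assms by (intro reparametrize_rel continuous_on_id) auto
  then show ?thesis
    using concat_eq_reparametrize [OF assms(2)] reparametrize_id [OF W] by simp
qed

lemma concat_const_left:
  assumes H: "H \<in> homotopies G X u v"
  shows "(concat_homotopy G (const_homotopy G u) H, H) \<in> homotopy_rel G X"
proof (rule concat_reparametrize_rel [OF homotopies_maps [OF H], where \<phi> = "\<lambda>t. max 0 (2 * t - 1)"])
  show "(if t \<le> 1/2 then const_homotopy G u (x, 2 * t) else H (x, 2 * t - 1)) = H (x, max 0
      (2 * t - 1))"
    if "x \<in> topspace G" "t \<in> {0..1}" for x t
  proof -
    have "max 0 (2 * t - 1) = (if t \<le> 1/2 then 0 else 2 * t - 1)"
      by auto
    then show ?thesis
      using that H by (simp add: const_homotopy_def homotopies_def)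
  qed
qed (auto intro!: continuous_intros)

lemma concat_const_right:
  assumes H: "H \<in> homotopies G X u v"
  shows "(concat_homotopy G H (const_homotopy G v), H) \<in> homotopy_rel G X"
proof (rule concat_reparametrize_rel [OF homotopies_maps [OF H], where \<phi> = "\<lambda>t. min 1 (2 * t)"])
  show "(if t \<le> 1/2 then H (x, 2 * t) else const_homotopy G v (x, 2 * t - 1)) = H (x, min 1
      (2 * t))"
    if "x \<in> topspace G" "t \<in> {0..1}" for x t
  proof -
    have "min 1 (2 * t) = (if t \<le> 1/2 then 2 * t else 1)"
      by auto
    then show ?thesis
      using that H by (simp add: const_homotopy_def homotopies_def)
  qed
qed (auto intro!: continuous_intros)

lemma concat_assoc:
  assumes H: "H \<in> homotopies G X u v" and K: "K \<in> homotopies G X v w" and L: "L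
      \<in> homotopies G X w r"
  shows "(concat_homotopy G (concat_homotopy G H K) L, concat_homotopy G H (concat_homotopy G K L))
    \<in> homotopy_rel G X"
proof (rule concat_reparametrize_rel [OF homotopies_maps [OF concat_homotopies
    [OF H concat_homotopies [OF K L]]],
      where \<phi> = "\<lambda>t. min (2 * t) (min (t + 1/4) ((t + 1) / 2))"])
  \<comment> \<open>The time change maps \<open>[0,1/4]\<close>, \<open>[1/4,1/2]\<close>,
    \<open>[1/2,1]\<close> linearly onto \<open>[0,1/2]\<close>, \<open>[1/2,3/4]\<close>,
    \<open>[3/4,1]\<close>. The slopes 2, 1, 1/2 decrease, so it is the minimum of three affine
    functions.\<close>
  let ?\<phi> = "\<lambda>t::real. min (2 * t) (min (t + 1/4) ((t + 1) / 2))"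
  fix x t assume x: "x \<in> topspace G" and t: "t \<in> {0..1::real}"
  consider "t \<le> 1/4" | "1/4 < t" "t \<le> 1/2" | "1/2 < t"
    by linarith
  then show "(if t \<le> 1/2 then concat_homotopy G H K (x, 2 * t) else L (x, 2 * t - 1)) =
      concat_homotopy G H (concat_homotopy G K L) (x, ?\<phi> t)"
  proof cases
    case 1
    then have "?\<phi> t = 2 * t"
      by (simp add: min_def)
    then show ?thesis
      using 1 x t by (simp add: concat_homotopy_apply)
  next
    case 2
    then have "?\<phi> t = t + 1/4"
      by (simp add: min_def)
    then show ?thesis
      using 2 x t by (simp add: concat_homotopy_apply)
  next
    case 3
    then have "?\<phi> t = (t + 1) / 2"
      by (simp add: min_def)
    moreover have "2 * ((t + 1) / 2) - 1 = t"
      by (simp add: field_simps)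
    ultimately show ?thesis
      using 3 x t concat_homotopy_apply [of x G "(t + 1) / 2" H "concat_homotopy G K L"]
        concat_homotopy_apply [of x G t K L] by simp
  qed
qed (auto intro!: continuous_intros simp: min_le_iff_disj)

text \<open>Going there and back is a tent-shaped reparametrization of \<open>H\<close> with equal
  values at 0 and 1, hence deformable to a constant one.\<close>

lemma concat_reverse:
  assumes H: "H \<in> homotopies G X u v"
  shows "reparametrize G H (\<lambda>t. 1 - t) \<in> homotopies G X v u"
    and "(concat_homotopy G H (reparametrize G H (\<lambda>t. 1 - t)), const_homotopy G u)
        \<in> homotopy_rel G X"
    and "(concat_homotopy G (reparametrize G H (\<lambda>t. 1 - t)) H, const_homotopy G v)
        \<in> homotopy_rel G X"
proof -
  note Hm = homotopies_maps [OF H]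
  have "reparametrize G H (\<lambda>t. 1 - t) \<in> maps (prod_topology G unit_interval) X"
    by (rule reparametrize_maps [OF Hm]) (auto intro!: continuous_intros)
  then show "reparametrize G H (\<lambda>t. 1 - t) \<in> homotopies G X v u"
    using H by (simp add: homotopies_def reparametrize_apply)
  have const: "const_homotopy G u = reparametrize G H (\<lambda>t. 0)" "const_homotopy G v
      = reparametrize G H (\<lambda>t. 1)"
    using H by (auto simp: fun_eq_iff const_homotopy_def reparametrize_def homotopies_def
        restrict_def)
  have "concat_homotopy G H (reparametrize G H (\<lambda>t. 1 - t)) = reparametrize G H (\<lambda>t. min (2 * t)
      (2 - 2 * t))"
    by (rule concat_eq_reparametrize) (auto simp: reparametrize_apply min_def)
  moreover have "(reparametrize G H (\<lambda>t. min (2 * t) (2 - 2 * t)), reparametrize G H (\<lambda>t. 0))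
      \<in> homotopy_rel G X"
    by (rule reparametrize_rel [OF Hm]) (auto intro!: continuous_intros)
  ultimately show "(concat_homotopy G H (reparametrize G H (\<lambda>t. 1 - t)), const_homotopy G u)
      \<in> homotopy_rel G X"
    by (simp add: const)
  have "concat_homotopy G (reparametrize G H (\<lambda>t. 1 - t)) H = reparametrize G H (\<lambda>t. max (1 - 2 * t)
      (2 * t - 1))"
  proof (rule concat_eq_reparametrize)
    show "(if t \<le> 1/2 then reparametrize G H (\<lambda>t. 1 - t) (x, 2 * t) else H (x, 2 * t - 1)) =
        H (x, max (1 - 2 * t) (2 * t - 1))" if "x \<in> topspace G" "t \<in> {0..1}" for x t
    proof -
      have "max (1 - 2 * t) (2 * t - 1) = (if t \<le> 1/2 then 1 - 2 * t else 2 * t - 1)"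
        by auto
      then show ?thesis
        using that by (simp add: reparametrize_apply)
    qed
  qed
  moreover have "(reparametrize G H (\<lambda>t. max (1 - 2 * t) (2 * t - 1)), reparametrize G H (\<lambda>t. 1))
      \<in> homotopy_rel G X"
    by (rule reparametrize_rel [OF Hm]) (auto intro!: continuous_intros)
  ultimately show "(concat_homotopy G (reparametrize G H (\<lambda>t. 1 - t)) H, const_homotopy G v)
      \<in> homotopy_rel G X"
    by (simp add: const)
qed

lemma Obj_Hot [simp]: "Obj (Hot G X) = maps G X"
  by (simp add: Hot_def)

lemma Id_Hot: "Id (Hot G X) u = homotopy_class G X (const_homotopy G u)"
  by (simp add: Hot_def homotopy_class_def)

lemma Hom_Hot_iff: "A \<in> Hom (Hot G X) u v \<longleftrightarrow> (\<exists>H \<in> homotopies G X u v. A = homotopy_class G X H)"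
  by (auto simp: Hot_def quotient_def homotopy_class_def)

lemma homotopy_class_mem:
  assumes "H \<in> homotopies G X u v" "K \<in> homotopy_class G X H"
  shows "(H, K) \<in> homotopy_rel G X" "K \<in> homotopies G X u v"
proof -
  show HK: "(H, K) \<in> homotopy_rel G X"
    using assms(2) by (simp add: homotopy_class_def)
  then have "K \<in> maps (prod_topology G unit_interval) X"
    by (simp add: homotopy_rel_def)
  then show "K \<in> homotopies G X u v"
    using assms(1) homotopy_rel_ends [OF HK] by (simp add: homotopies_def)
qed

lemma homotopy_class_self: "H \<in> homotopies G X u v \<Longrightarrow> H \<in> homotopy_class G X H"
  by (simp add: homotopy_class_def homotopy_rel_refl homotopies_maps)

text \<open>By \<open>concat_homotopy_cong\<close> all members of the defining union coincide, and
  the union is not empty since each class contains its representative.\<close>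

lemma Comp_Hot:
  assumes H: "H \<in> homotopies G X u v" and K: "K \<in> homotopies G X v w"
  shows "Comp (Hot G X) (homotopy_class G X K) (homotopy_class G X H) =
    homotopy_class G X (concat_homotopy G H K)"
proof -
  have same: "homotopy_class G X (concat_homotopy G H' K') = homotopy_class G X
      (concat_homotopy G H K)"
    if "H' \<in> homotopy_class G X H" "K' \<in> homotopy_class G X K" for H' K'
    using concat_homotopy_cong [OF homotopy_class_mem(1) [OF H that(1)] homotopy_class_mem(1)
        [OF K that(2)] H K]
    by (rule homotopy_class_eq [symmetric])
  have "(\<Union>H' \<in> homotopy_class G X H. \<Union>K' \<in> homotopy_class G X K.
      homotopy_class G X (concat_homotopy G H' K')) =
    (\<Union>H' \<in> homotopy_class G X H. \<Union>K' \<in> homotopy_class G X K. homotopy_class G X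
        (concat_homotopy G H K))"
    by (intro SUP_cong refl same)
  also have "\<dots> = homotopy_class G X (concat_homotopy G H K)"
    using homotopy_class_self [OF H] homotopy_class_self [OF K] by (metis UN_constant empty_iff)
  finally have "(\<Union>H' \<in> homotopy_class G X H. \<Union>K' \<in> homotopy_class G X K.
      homotopy_class G X (concat_homotopy G H' K')) = homotopy_class G X (concat_homotopy G H K)" .
  then show ?thesis
    by (simp add: Hot_def homotopy_class_def)
qed

lemma is_category_Hot: "is_category (Hot G X)"
  unfolding is_category_def
proof (intro conjI ballI)
  fix u assume "u \<in> Obj (Hot G X)"
  then show "Id (Hot G X) u \<in> Hom (Hot G X) u u"
    using const_homotopies [of u G X] by (auto simp: Hom_Hot_iff Id_Hot)
next
  fix u v w A B
  assume "A \<in> Hom (Hot G X) u v" "B \<in> Hom (Hot G X) v w"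
  then obtain H K where H: "H \<in> homotopies G X u v" "A = homotopy_class G X H"
    and K: "K \<in> homotopies G X v w" "B = homotopy_class G X K"
    by (auto simp: Hom_Hot_iff)
  show "Comp (Hot G X) B A \<in> Hom (Hot G X) u w"
    unfolding H(2) K(2) Comp_Hot [OF H(1) K(1)] Hom_Hot_iff
    using concat_homotopies [OF H(1) K(1)] by blast
next
  fix u v A
  assume uv: "u \<in> Obj (Hot G X)" "v \<in> Obj (Hot G X)" and "A \<in> Hom (Hot G X) u v"
  then obtain H where H: "H \<in> homotopies G X u v" and A: "A = homotopy_class G X H"
    by (auto simp: Hom_Hot_iff)
  have c: "const_homotopy G u \<in> homotopies G X u u" "const_homotopy G v \<in> homotopies G X v v"
    using uv const_homotopies by auto
  show "Comp (Hot G X) (Id (Hot G X) v) A = A"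
    unfolding A Id_Hot Comp_Hot [OF H c(2)] by (rule homotopy_class_eq [OF concat_const_right
        [OF H]])
  show "Comp (Hot G X) A (Id (Hot G X) u) = A"
    unfolding A Id_Hot Comp_Hot [OF c(1) H] by (rule homotopy_class_eq [OF concat_const_left
        [OF H]])
next
  fix u v w r A B C
  assume "A \<in> Hom (Hot G X) u v" "B \<in> Hom (Hot G X) v w" "C \<in> Hom (Hot G X) w r"
  then obtain H K L where H: "H \<in> homotopies G X u v" "A = homotopy_class G X H"
    and K: "K \<in> homotopies G X v w" "B = homotopy_class G X K"
    and L: "L \<in> homotopies G X w r" "C = homotopy_class G X L"
    by (auto simp: Hom_Hot_iff)
  show "Comp (Hot G X) C (Comp (Hot G X) B A) = Comp (Hot G X) (Comp (Hot G X) C B) A"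
    unfolding H(2) K(2) L(2) Comp_Hot [OF H(1) K(1)] Comp_Hot [OF K(1) L(1)]
      Comp_Hot [OF concat_homotopies [OF H(1) K(1)] L(1)] Comp_Hot [OF H(1) concat_homotopies
          [OF K(1) L(1)]]
    by (rule homotopy_class_eq [OF concat_assoc [OF H(1) K(1) L(1)]])
qed

lemma is_iso_Hot:
  assumes H: "H \<in> homotopies G X u v"
  shows "is_iso (Hot G X) u v (homotopy_class G X H)"
proof -
  note rev = concat_reverse [OF H]
  have "Comp (Hot G X) (homotopy_class G X (reparametrize G H (\<lambda>t. 1 - t))) (homotopy_class G X H)
      = Id (Hot G X) u"
    unfolding Comp_Hot [OF H rev(1)] Id_Hot by (rule homotopy_class_eq [OF rev(2)])
  moreover have "Comp (Hot G X) (homotopy_class G X H) (homotopy_class G X (reparametrize G H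
      (\<lambda>t. 1 - t))) = Id (Hot G X) v"
    unfolding Comp_Hot [OF rev(1) H] Id_Hot by (rule homotopy_class_eq [OF rev(3)])
  moreover have "homotopy_class G X H \<in> Hom (Hot G X) u v"
    using H by (auto simp: Hom_Hot_iff)
  moreover have "homotopy_class G X (reparametrize G H (\<lambda>t. 1 - t)) \<in> Hom (Hot G X) v u"
    using rev(1) unfolding Hom_Hot_iff by (rule bexI [rotated]) (rule refl)
  ultimately show ?thesis
    unfolding is_iso_def by (intro conjI bexI)
qed

section \<open>What an equivalence means for maps and homotopies\<close>

lemma Hot_postcomp_essentially_surjective:
  assumes eq: "equivalence_of_categories (Hot G X) (Hot G Y) (postcomp_obj G f)
      (postcomp_arr G Y f)"
    and b: "b \<in> maps G Y"
  shows "\<exists>u \<in> maps G X. \<exists>H. H \<in> homotopies G Y b (\<lambda>z. f (u z))"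
proof -
  obtain u k where u: "u \<in> maps G X" and "is_iso (Hot G Y) (postcomp_obj G f u) b k"
    using equivalence_essentially_surjective [OF eq, of b] b unfolding Obj_Hot by blast
  \<comment> \<open>The inverse is taken because the paths of a lift start at
    \<open>b\<close>.\<close>
  then obtain k' where "k' \<in> Hom (Hot G Y) b (postcomp_obj G f u)"
    unfolding is_iso_def by blast
  then obtain H where "H \<in> homotopies G Y b (postcomp_obj G f u)"
    unfolding Hom_Hot_iff by blast
  then have "H \<in> homotopies G Y b (\<lambda>z. f (u z))"
    by (simp add: homotopies_def postcomp_obj_def compose_def)
  then show ?thesis
    using u by blast
qed

lemma Hot_postcomp_full:
  assumes eq: "equivalence_of_categories (Hot G X) (Hot G Y) (postcomp_obj G f)
      (postcomp_arr G Y f)"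
    and uv: "u \<in> maps G X" "v \<in> maps G X"
    and R: "R \<in> homotopies G Y (\<lambda>z. f (u z)) (\<lambda>z. f (v z))"
  shows "\<exists>U \<in> homotopies G X u v. (compose (topspace G \<times> {0..1}) f U, R) \<in> homotopy_rel G Y"
proof -
  have "R \<in> homotopies G Y (postcomp_obj G f u) (postcomp_obj G f v)"
    using R by (simp add: homotopies_def postcomp_obj_def compose_def)
  then have "homotopy_class G Y R \<in> Hom (Hot G Y) (postcomp_obj G f u) (postcomp_obj G f v)"
    by (auto simp: Hom_Hot_iff)
  then obtain A where "A \<in> Hom (Hot G X) u v" and AR: "postcomp_arr G Y f A = homotopy_class G Y R"
    using equivalence_full [OF is_category_Hot is_category_Hot eq, of u v] uv unfolding Obj_Hot
        by blast
  then obtain U where U: "U \<in> homotopies G X u v" and A: "A = homotopy_class G X U"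
    by (auto simp: Hom_Hot_iff)
  have "R \<in> postcomp_arr G Y f A"
    unfolding AR using R by (rule homotopy_class_self)
  then obtain U' where "U' \<in> A" "(compose (topspace G \<times> {0..1}) f U', R) \<in> homotopy_rel G Y"
    by (auto simp: postcomp_arr_def)
  then show ?thesis
    using homotopy_class_mem(2) [OF U] A by blast
qed


section \<open>The first two cases of the extension property\<close>

lemma HELP_empty:
  assumes eq: "equivalence_of_categories (Hot G X) (Hot G Y) (postcomp_obj G f)
      (postcomp_arr G Y f)"
  shows "HELP X Y f G {}"
  unfolding HELP_def
proof (intro allI impI)
  fix b \<sigma> assume b: "continuous_map G Y b"
  have "continuous_map G Y (restrict b (topspace G))"
    by (rule continuous_map_eq [OF b]) simp
  then have "restrict b (topspace G) \<in> maps G Y"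
    by (simp add: maps_def)
  then obtain u H where u: "u \<in> maps G X" and H: "H \<in> homotopies G Y (restrict b (topspace G))
      (\<lambda>z. f (u z))"
    using Hot_postcomp_essentially_surjective [OF eq] by blast
  have "path_lift X Y f G b (\<lambda>z. (u z, \<lambda>t. H (z, t)))"
    using u H by (simp add: path_lift_def maps_def homotopies_def)
  then show "\<exists>\<tau>. path_lift X Y f G b \<tau> \<and> (\<forall>x\<in>topspace G \<inter> {}. \<tau> x = \<sigma> x)"
    by blast
qed

text \<open>Paths are total functions on the reals, but continuity sees only times in
  \<open>[0,1]\<close>; this variant of \<open>path_lift_cong\<close> permits other values to
  differ.\<close>

lemma path_lift_cong_interval:
  assumes \<sigma>: "path_lift X Y f K b \<sigma>"
    and "\<And>x. x \<in> topspace K \<Longrightarrow> fst (\<sigma> x) = fst (\<sigma>' x)"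
    and "\<And>x t. x \<in> topspace K \<Longrightarrow> t \<in> {0..1} \<Longrightarrow> snd (\<sigma> x) t = snd (\<sigma>' x) t"
  shows "path_lift X Y f K b \<sigma>'"
proof -
  have "continuous_map K X (\<lambda>x. fst (\<sigma>' x))"
    by (rule continuous_map_eq [where f = "\<lambda>x. fst (\<sigma> x)"])
        (use assms in \<open>auto simp: path_lift_def\<close>)
  moreover have "continuous_map (prod_topology K unit_interval) Y (\<lambda>p. snd (\<sigma>' (fst p)) (snd p))"
    by (rule continuous_map_eq [where f = "\<lambda>p. snd (\<sigma> (fst p)) (snd p)"])
      (use assms in \<open>auto simp: path_lift_def\<close>)
  moreover have "snd (\<sigma>' x) 0 = b x \<and> snd (\<sigma>' x) 1 = f (fst (\<sigma>' x))" if "x \<in> topspace K" for x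
    using \<sigma> assms(2) [OF that] assms(3) [OF that, of 0] assms(3) [OF that, of 1] that
    by (simp add: path_lift_def)
  ultimately show ?thesis
    unfolding path_lift_def by blast
qed

section \<open>Filling the square for the interval case\<close>

lemma concat_three:
  assumes H0: "continuous_map (prod_topology G unit_interval) Y H0"
    and b: "continuous_map (prod_topology G unit_interval) Y b"
    and H1: "continuous_map (prod_topology G unit_interval) Y H1"
    and ends: "\<And>z. z \<in> topspace G \<Longrightarrow> H0 (z, 0) = b (z, 0)" "\<And>z. z \<in> topspace G \<Longrightarrow> H1 (z, 0) = b
        (z, 1)"
  obtains R where "continuous_map (prod_topology G unit_interval) Y R" "R \<in> extensional
      (topspace G \<times> {0..1})"
    and "\<And>z t. z \<in> topspace G \<Longrightarrow> t \<in> {0..1} \<Longrightarrow> R (z, (1 - t) / 3) = H0 (z, t)"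
    and "\<And>z t. z \<in> topspace G \<Longrightarrow> t \<in> {0..1} \<Longrightarrow> R (z, (1 + t) / 3) = b (z, t)"
    and "\<And>z t. z \<in> topspace G \<Longrightarrow> t \<in> {0..1} \<Longrightarrow> R (z, (2 + t) / 3) = H1 (z, t)"
proof -
  let ?Z = "prod_topology G unit_interval"
  define R' where "R' p = (if snd p \<le> 1/3 then H0 (fst p, max 0 (1 - 3 * snd p))
     else if snd p \<le> 2/3 then b (fst p, max 0 (min 1 (3 * snd p - 1))) else H1 (fst p, max 0
         (3 * snd p - 2)))" for p
  have reparam: "continuous_map ?Z Y (\<lambda>p. j (fst p, \<phi> (snd p)))"
    if "continuous_map ?Z Y j" "continuous_on {0..1} \<phi>" "\<And>t. t \<in> {0..1} \<Longrightarrow> \<phi> t \<in> {0..1}" for j \<phi>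
    by (rule continuous_map_apply_pair [OF that(1) continuous_map_fst continuous_map_interval
        [OF continuous_map_snd that(2,3)]])
  have c0: "continuous_map ?Z Y (\<lambda>p. H0 (fst p, max 0 (1 - 3 * snd p)))"
    by (rule reparam [OF H0, where \<phi> = "\<lambda>t. max 0 (1 - 3 * t)"]) (auto intro!: continuous_intros)
  have cb: "continuous_map ?Z Y (\<lambda>p. b (fst p, max 0 (min 1 (3 * snd p - 1))))"
    by (rule reparam [OF b, where \<phi> = "\<lambda>t. max 0 (min 1 (3 * t - 1))"])
        (auto intro!: continuous_intros)
  have c1: "continuous_map ?Z Y (\<lambda>p. H1 (fst p, max 0 (3 * snd p - 2)))"
    by (rule reparam [OF H1, where \<phi> = "\<lambda>t. max 0 (3 * t - 2)"]) (auto intro!: continuous_intros)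
  have "continuous_map ?Z Y R'"
    unfolding R'_def
    by (rule continuous_map_if_le [OF continuous_map_snd c0 continuous_map_if_le
        [OF continuous_map_snd cb c1]])
      (auto simp: ends)
  then have cR: "continuous_map ?Z Y (restrict R' (topspace ?Z))"
    by (rule continuous_map_eq) simp
  have R': "R' (z, (1 - t) / 3) = H0 (z, t)" "R' (z, (1 + t) / 3) = b (z, t)" "R' (z, (2 + t) / 3)
      = H1 (z, t)"
    if z: "z \<in> topspace G" and t: "t \<in> {0..1}" for z t
  proof -
    have eqs: "max 0 (1 - 3 * ((1 - t) / 3)) = t" "max 0 (min 1 (3 * ((1 + t) / 3) - 1)) = t"
      "max 0 (3 * ((2 + t) / 3) - 2) = t"
      using t by (simp_all add: field_simps)
    show "R' (z, (1 - t) / 3) = H0 (z, t)"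
      unfolding R'_def fst_conv snd_conv eqs using t by simp
    show "R' (z, (1 + t) / 3) = b (z, t)"
      using t ends(1) [OF z] unfolding R'_def fst_conv snd_conv eqs by (cases "t = 0") simp_all
    show "R' (z, (2 + t) / 3) = H1 (z, t)"
      using t ends(2) [OF z] unfolding R'_def fst_conv snd_conv eqs by (cases "t = 0") simp_all
  qed
  show thesis
    by (rule that [of "restrict R' (topspace ?Z)"]) (use cR R' in auto)
qed

text \<open>
  Given a homotopy \<open>b\<close> and homotopies \<open>H\<^sub>0\<close>, \<open>H\<^sub>1\<close> starting at its ends, fullness deforms the
  concatenation \<open>R\<^sub>0\<close> of \<open>H\<^sub>0\<close> reversed, \<open>b\<close> and \<open>H\<^sub>1\<close> into some \<open>f \<circ> U\<close>. The lift of \<open>b\<close> must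
  restrict to \<open>H\<^sub>0\<close> and \<open>H\<^sub>1\<close> over the ends: at position \<open>s\<close> and time \<open>t\<close> it first (parameter
  \<open>stage_early\<close>) stretches the middle third of \<open>R\<^sub>0\<close> to all of \<open>R\<^sub>0\<close> and then (parameter
  \<open>stage_late\<close>) runs the deformation. The time change \<open>stage\<close> never reaches the second phase
  for \<open>s = 0\<close> and \<open>s = 1\<close>.
\<close>

definition clamp01 :: "real \<Rightarrow> real" where
  "clamp01 t = max 0 (min 1 t)"

text \<open>The factor of \<open>t\<close> is 1/2 for \<open>s = 0\<close> and \<open>s = 1\<close>,
  so there the first phase takes the whole unit of time. With slope 3/2 it reaches 1 at 1/3 and 2/3,
  so both phases are completed over the middle third.\<close>

definition stage :: "real \<Rightarrow> real \<Rightarrow> real" where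
  "stage s t = t * (1/2 + min (1/2) (3/2 * min s (1 - s)))"

definition stage_early :: "real \<Rightarrow> real \<Rightarrow> real" where
  "stage_early s t = clamp01 (2 * stage s t)"

definition stage_late :: "real \<Rightarrow> real \<Rightarrow> real" where
  "stage_late s t = clamp01 (2 * stage s t - 1)"

text \<open>With \<open>a = (1 - stage_early s t) / 3\<close>, the window \<open>[a, 1 - a]\<close>
  opens from the middle third to the whole interval, and the clamped term is the relative position
  in it. That position is \<open>s\<close> at \<open>t = 0\<close> and
  \<open>clamp01 (3 * s - 1)\<close> at \<open>t = 1\<close>; it stays 0 for \<open>s = 0\<close>
  and 1 for \<open>s = 1\<close>.\<close>

definition square_pos :: "real \<Rightarrow> real \<Rightarrow> real" where
  "square_pos s t = (1 - stage_early s t) / 3 + clamp01 ((1 + 2 * t) * s - t) * (1 - 2 *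
      (1 - stage_early s t) / 3)"

lemma clamp01_range: "0 \<le> clamp01 t" "clamp01 t \<le> 1"
  by (simp_all add: clamp01_def)

lemma square_pos_range: "0 \<le> square_pos s t" "square_pos s t \<le> 1"
proof -
  define a where "a = (1 - stage_early s t) / 3"
  define c where "c = clamp01 ((1 + 2 * t) * s - t)"
  have a: "0 \<le> a" "a \<le> 1/3" and c: "0 \<le> c" "c \<le> 1"
    using clamp01_range by (simp_all add: a_def c_def stage_early_def)
  have eq: "square_pos s t = a + c * (1 - 2 * a)"
    by (simp add: square_pos_def a_def c_def)
  have "c * (1 - 2 * a) \<le> 1 - 2 * a" "0 \<le> c * (1 - 2 * a)"
    using mult_right_mono [of c 1 "1 - 2 * a"] a c by simp_all
  then show "0 \<le> square_pos s t" "square_pos s t \<le> 1"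
    using a unfolding eq by linarith+
qed

text \<open>The edges of the square carry the data: in \<open>HELP_interval\<close> the bottom reads
  \<open>b\<close>, the left and right edges read the homotopies prescribed over the two ends, and
  the top must lie in the image of \<open>f\<close>.\<close>

lemma square_bottom:
  assumes "s \<in> {0..1}" shows "stage_late s 0 = 0" "square_pos s 0 = (1 + s) / 3"
  using assms by (auto simp: stage_late_def square_pos_def stage_early_def stage_def clamp01_def
      field_simps)

lemma square_left:
  assumes "t \<in> {0..1}" shows "stage_late 0 t = 0" "square_pos 0 t = (1 - t) / 3"
  using assms by (auto simp: stage_late_def square_pos_def stage_early_def stage_def clamp01_def)

lemma square_right:
  assumes "t \<in> {0..1}" shows "stage_late 1 t = 0" "square_pos 1 t = (2 + t) / 3"
  using assms by (auto simp: stage_late_def square_pos_def stage_early_def stage_def clamp01_def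
      field_simps)

text \<open>Over the middle third the deformation is complete. Over the outer thirds it may be
  unfinished, but the position is an end, where a deformation relative to the ends does not
  move.\<close>

lemma square_top:
  assumes "s \<in> {0..1}"
  shows "square_pos s 1 = clamp01 (3 * s - 1)"
    and "stage_late s 1 = 1 \<or> clamp01 (3 * s - 1) = 0 \<or> clamp01 (3 * s - 1) = 1"
proof -
  have "stage_early s 1 = 1"
    using assms by (auto simp: stage_early_def stage_def clamp01_def min_def)
  then show "square_pos s 1 = clamp01 (3 * s - 1)"
    by (simp add: square_pos_def)
  show "stage_late s 1 = 1 \<or> clamp01 (3 * s - 1) = 0 \<or> clamp01 (3 * s - 1) = 1"
    using assms by (auto simp: stage_late_def stage_def clamp01_def min_def max_def)
qed

lemma continuous_on_square:
  "continuous_on S (\<lambda>p. square_pos (fst p) (snd p))" "continuous_on S (\<lambda>p. 1 - stage_late (fst p)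
      (snd p))"
  unfolding square_pos_def stage_late_def stage_early_def stage_def clamp01_def
  by (auto intro!: continuous_intros)

lemma HELP_interval:
  assumes eq: "equivalence_of_categories (Hot G X) (Hot G Y) (postcomp_obj G f)
      (postcomp_arr G Y f)"
  shows "HELP X Y f (prod_topology G unit_interval) (UNIV \<times> {0, 1})"
  unfolding HELP_def
proof (intro allI impI)
  let ?GI = "prod_topology G unit_interval" and ?L = "UNIV \<times> {0, 1::real}"
  fix b \<sigma>
  assume b: "continuous_map ?GI Y b" and \<sigma>: "path_lift X Y f (subtopology ?GI ?L) b \<sigma>"
  have side: "path_lift X Y f G (\<lambda>z. b (z, e)) (\<lambda>z. \<sigma> (z, e))" if "e \<in> {0, 1}" for e
  proof (rule path_lift_compose [OF \<sigma>])
    show "continuous_map G (subtopology ?GI ?L) (\<lambda>z. (z, e))"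
      using that by (auto simp: continuous_map_in_subtopology intro!: continuous_map_pairedI)
  qed
  define u where "u e = restrict (\<lambda>z. fst (\<sigma> (z, e))) (topspace G)" for e
  define H where "H e = (\<lambda>p. snd (\<sigma> (fst p, e)) (snd p))" for e
  have u: "u e \<in> maps G X" if "e \<in> {0, 1}" for e
  proof -
    have "continuous_map G X (u e)"
      by (rule continuous_map_eq [where f = "\<lambda>z. fst (\<sigma> (z, e))"])
        (use side [OF that] in \<open>auto simp: path_lift_def u_def\<close>)
    then show ?thesis
      by (simp add: maps_def u_def)
  qed
  have H: "continuous_map ?GI Y (H e)" "\<And>z. z \<in> topspace G \<Longrightarrow> H e (z, 0) = b (z, e)"
    "\<And>z. z \<in> topspace G \<Longrightarrow> H e (z, 1) = f (u e z)" if "e \<in> {0, 1}" for e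
    using side [OF that] by (simp_all add: path_lift_def H_def u_def)
  obtain R0 where R0: "continuous_map ?GI Y R0" "R0 \<in> extensional (topspace G \<times> {0..1})"
    and R0_left: "\<And>z t. z \<in> topspace G \<Longrightarrow> t \<in> {0..1} \<Longrightarrow> R0 (z, (1 - t) / 3) = H 0 (z, t)"
    and R0_mid: "\<And>z t. z \<in> topspace G \<Longrightarrow> t \<in> {0..1} \<Longrightarrow> R0 (z, (1 + t) / 3) = b (z, t)"
    and R0_right: "\<And>z t. z \<in> topspace G \<Longrightarrow> t \<in> {0..1} \<Longrightarrow> R0 (z, (2 + t) / 3) = H 1 (z, t)"
    by (rule concat_three [of G Y "H 0" b "H 1"]) (use H b in auto)
  have R0_ends: "R0 (z, 0) = f (u 0 z)" "R0 (z, 1) = f (u 1 z)" if "z \<in> topspace G" for z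
    using R0_left [OF that, of 1] R0_right [OF that, of 1] H(3) that by simp_all
  then have "R0 \<in> homotopies G Y (\<lambda>z. f (u 0 z)) (\<lambda>z. f (u 1 z))"
    using R0 by (simp add: homotopies_def maps_def)
  then obtain U where U: "U \<in> homotopies G X (u 0) (u 1)"
    and rel: "(compose (topspace G \<times> {0..1}) f U, R0) \<in> homotopy_rel G Y"
    using Hot_postcomp_full [OF eq u u] by blast
  obtain R where R: "continuous_map (prod_topology unit_interval ?GI) Y R"
    and R_0: "\<And>z t. z \<in> topspace G \<Longrightarrow> t \<in> {0..1} \<Longrightarrow> R (0, z, t) = f (U (z, t))"
    and R_1: "\<And>z t. z \<in> topspace G \<Longrightarrow> t \<in> {0..1} \<Longrightarrow> R (1, z, t) = R0 (z, t)"
    and R_ends: "\<And>z r. z \<in> topspace G \<Longrightarrow> r \<in> {0..1} \<Longrightarrow> R (r, z, 0) = f (U (z, 0)) \<and> R (r, z, 1) = f (U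
        (z, 1))"
    using rel unfolding homotopy_rel_iff by (auto simp: compose_def)
  \<comment> \<open>\<open>R\<close> leads from \<open>f\<close> composed with \<open>U\<close> to
    \<open>R0\<close>, hence the reversed parameter \<open>1 - stage_late\<close>: the path starts
    on \<open>R0\<close> and is driven into the image of \<open>U\<close>.\<close>
  define \<tau>' where "\<tau>' p = (U (fst p, clamp01 (3 * snd p - 1)),
      \<lambda>t. R (1 - stage_late (snd p) t, fst p, square_pos (snd p) t))" for p
  \<comment> \<open>At the ends \<open>\<tau>'\<close> agrees with \<open>\<sigma>\<close> only for
    path times in \<open>[0,1]\<close>, whereas \<open>HELP\<close> asks for equal functions;
    inserting \<open>\<sigma>\<close> itself repairs this without affecting continuity.\<close>
  define \<tau> where "\<tau> p = (if snd p \<in> {0, 1} then \<sigma> p else \<tau>' p)" for p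
  have "path_lift X Y f ?GI b \<tau>'"
    unfolding path_lift_def
  proof (intro conjI ballI)
    have "continuous_map ?GI X (\<lambda>p. U (fst p, clamp01 (3 * snd p - 1)))"
    proof (rule continuous_map_apply_pair [of G X U, OF _ continuous_map_fst])
      show "continuous_map ?GI X U"
        using U by (simp add: homotopies_def maps_def)
      show "continuous_map ?GI unit_interval (\<lambda>p. clamp01 (3 * snd p - 1))"
        by (rule continuous_map_interval [OF continuous_map_snd, where \<phi> = "\<lambda>s. clamp01
            (3 * s - 1)"])
          (auto simp: clamp01_def intro!: continuous_intros)
    qed
    then show "continuous_map ?GI X (\<lambda>p. fst (\<tau>' p))"
      by (simp add: \<tau>'_def)
    let ?Z = "prod_topology ?GI unit_interval"
    have z: "continuous_map ?Z G (\<lambda>q. fst (fst q))" and s: "continuous_map ?Z unit_interval (\<lambda>q. snd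
        (fst q))"
      using continuous_map_compose [OF continuous_map_fst continuous_map_fst]
        continuous_map_compose [OF continuous_map_fst continuous_map_snd] by (simp_all add: o_def)
    have pos: "continuous_map ?Z unit_interval (\<lambda>q. square_pos (snd (fst q)) (snd q))"
      by (rule continuous_map_interval2 [OF s continuous_map_snd, where \<phi> = square_pos])
        (auto simp: square_pos_range continuous_on_square)
    have late: "continuous_map ?Z unit_interval (\<lambda>q. 1 - stage_late (snd (fst q)) (snd q))"
      by (rule continuous_map_interval2 [OF s continuous_map_snd, where \<phi> =
          "\<lambda>s t. 1 - stage_late s t"])
        (auto simp: stage_late_def clamp01_range continuous_on_square [unfolded stage_late_def])
    have "continuous_map ?Z (prod_topology unit_interval ?GI)
        (\<lambda>q. (1 - stage_late (snd (fst q)) (snd q), fst (fst q), square_pos (snd (fst q)) (snd q)))"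
      by (intro continuous_map_pairedI late z pos)
    from continuous_map_compose [OF this R]
    show "continuous_map ?Z Y (\<lambda>q. snd (\<tau>' (fst q)) (snd q))"
      by (simp add: \<tau>'_def o_def)
  next
    fix p assume "p \<in> topspace ?GI"
    then obtain z s where p: "p = (z, s)" and z: "z \<in> topspace G" and s: "s \<in> {0..1}"
      by auto
    have "(1 + s) / 3 \<in> {0..1}"
      using s by simp
    then show "snd (\<tau>' p) 0 = b p"
      unfolding \<tau>'_def p fst_conv snd_conv square_bottom [OF s] diff_zero
      using R_1 [OF z] R0_mid [OF z s] by simp
    have "1 - stage_late s 1 \<in> {0..1}" "clamp01 (3 * s - 1) \<in> {0..1}"
      using clamp01_range by (simp_all add: stage_late_def)
    then have "R (1 - stage_late s 1, z, clamp01 (3 * s - 1)) = f (U (z, clamp01 (3 * s - 1)))"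
      using square_top(2) [OF s] R_0 [OF z] R_ends [OF z] by auto
    then show "snd (\<tau>' p) 1 = f (fst (\<tau>' p))"
      using square_top(1) [OF s] by (simp add: \<tau>'_def p)
  qed
  then have "path_lift X Y f ?GI b \<tau>"
  proof (rule path_lift_cong_interval)
    fix p assume "p \<in> topspace ?GI"
    then obtain z s where p: "p = (z, s)" and z: "z \<in> topspace G" and s: "s \<in> {0..1}"
      by auto
    have "clamp01 (3 * 0 - 1) = 0" "clamp01 (3 * 1 - 1) = 1"
      by (simp_all add: clamp01_def)
    then show "fst (\<tau>' p) = fst (\<tau> p)"
      using U z by (auto simp: \<tau>_def \<tau>'_def p homotopies_def u_def)
    fix t :: real assume t: "t \<in> {0..1}"
    have "(1 - t) / 3 \<in> {0..1}" "(2 + t) / 3 \<in> {0..1}"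
      using t by simp_all
    then have "R (1, z, (1 - t) / 3) = snd (\<sigma> (z, 0)) t" "R (1, z, (2 + t) / 3) = snd (\<sigma> (z, 1)) t"
      using R_1 [OF z] R0_left [OF z t] R0_right [OF z t] by (simp_all add: H_def)
    then have "snd (\<tau>' (z, 0)) t = snd (\<sigma> (z, 0)) t" "snd (\<tau>' (z, 1)) t = snd (\<sigma> (z, 1)) t"
      unfolding \<tau>'_def fst_conv snd_conv square_left [OF t] square_right [OF t] diff_zero .
    then show "snd (\<tau>' p) t = snd (\<tau> p) t"
      unfolding \<tau>_def p by auto
  qed
  then show "\<exists>\<tau>. path_lift X Y f ?GI b \<tau> \<and> (\<forall>x\<in>topspace ?GI \<inter> ?L. \<tau> x = \<sigma> x)"
    by (intro exI [of _ \<tau>]) (auto simp: \<tau>_def)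
qed

section \<open>Transfer to tori times cubes of dimension 0 and 1\<close>

lemma HELP_torus_cube_0:
  assumes "HELP X Y f (torus n) {}"
  shows "HELP X Y f (top_of_set (torus_set n \<times> cube 0)) (UNIV \<times> cube_boundary 0)"
proof (rule HELP_compact_quotient_set [OF assms [unfolded torus_eq], where q = "\<lambda>z. (z, \<lambda>_. 0)"])
  show "continuous_on (torus_set n) (\<lambda>z. (z, \<lambda>_. 0))"
    by (intro continuous_on_Pair continuous_on_id continuous_on_const)
  have "cube 0 = {\<lambda>_. 0}"
    by (auto simp: cube_def)
  then show "(\<lambda>z. (z, \<lambda>_. 0)) ` torus_set n = torus_set n \<times> cube 0"
    by auto
qed (auto simp: compact_torus_set cube_boundary_def)

lemma HELP_torus_cube_1:
  assumes "HELP X Y f (prod_topology (torus n) unit_interval) (UNIV \<times> {0, 1})"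
  shows "HELP X Y f (top_of_set (torus_set n \<times> cube 1)) (UNIV \<times> cube_boundary 1)"
proof (rule HELP_compact_quotient_set [OF assms [unfolded torus_eq prod_topology_subtopology_eu],
      where q = "\<lambda>p. (fst p, (\<lambda>_. 0)(0 := 2 * snd p - 1))"])
  let ?q = "\<lambda>p. (fst p :: nat \<Rightarrow> complex, (\<lambda>_. 0)(0 := 2 * snd p - 1) :: nat \<Rightarrow> real)"
  have "continuous_on (torus_set n \<times> {0..1}) (\<lambda>p. ((\<lambda>_. 0)(0 := 2 * snd p - 1 :: real)) i)"
      for i :: nat
    by (cases "i = 0") (auto intro!: continuous_intros)
  then show "continuous_on (torus_set n \<times> {0..1}) ?q"
    by (intro continuous_on_Pair continuous_on_fst continuous_on_id
        continuous_on_coordinatewise_then_product)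
  show "compact (torus_set n \<times> {0..1::real})"
    by (intro compact_Times compact_torus_set compact_Icc)
  show "?q ` (torus_set n \<times> {0..1}) = torus_set n \<times> cube 1"
  proof (intro equalityI subsetI)
    fix p assume "p \<in> torus_set n \<times> cube 1"
    then obtain z x where p: "p = (z, x)" "z \<in> torus_set n" "x \<in> cube 1"
      by auto
    then have "\<bar>x 0\<bar> \<le> 1" "x = (\<lambda>_. 0)(0 := x 0)"
      by (auto simp: cube_def fun_eq_iff)
    moreover have "2 * ((x 0 + 1) / 2) - 1 = x 0"
      by (simp add: field_simps)
    ultimately have "p = ?q (z, (x 0 + 1) / 2)" "(z, (x 0 + 1) / 2) \<in> torus_set n \<times> {0..1}"
      using p unfolding fst_conv snd_conv by (metis, auto simp: abs_le_iff)
    then show "p \<in> ?q ` (torus_set n \<times> {0..1})"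
      by (rule image_eqI)
  qed (auto simp: cube_def abs_le_iff)
  show "p \<in> UNIV \<times> {0, 1} \<longleftrightarrow> ?q p \<in> UNIV \<times> cube_boundary 1" if "p \<in> torus_set n \<times> {0..1}" for p
    using that by (auto simp: cube_boundary_def)
  show "p = p'" if "?q p = ?q p'" for p p' :: "(nat \<Rightarrow> complex) \<times> real"
  proof -
    have "snd (?q p) 0 = snd (?q p') 0"
      using that by metis
    then have "snd p = snd p'"
      by simp
    then show ?thesis
      using that by (simp add: prod_eq_iff)
  qed
qed


section \<open>The torus as a CW complex\<close>

text \<open>The sign puts the point 1, the 0-cell of the circle, at both ends of
  \<open>[-1,1]\<close>; the open interval then parametrizes the 1-cell, with the parameter of
  \<open>w\<close> read off from \<open>Arg (- w)\<close>.\<close>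

definition circle_point :: "real \<Rightarrow> complex" where
  "circle_point t = - cis (pi * t)"

lemma circle_point_eq_1_iff:
  assumes "\<bar>t\<bar> \<le> 1" shows "circle_point t = 1 \<longleftrightarrow> \<bar>t\<bar> = 1"
proof
  assume "circle_point t = 1"
  then have "cos (pi * t) = - 1"
    by (metis Re_complex_of_real circle_point_def cis.simps(1) minus_equation_iff
        one_complex.simps(1) uminus_complex.simps(1))
  then have "cos (pi * \<bar>t\<bar>) = cos pi"
    by (cases "t \<ge> 0") simp_all
  moreover have "0 \<le> pi * \<bar>t\<bar>" "pi * \<bar>t\<bar> \<le> pi"
    using assms by (simp_all add: mult_left_le)
  ultimately have "pi * \<bar>t\<bar> = pi"
    using cos_inj_pi [of "pi * \<bar>t\<bar>" pi] pi_ge_zero by blast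
  then show "\<bar>t\<bar> = 1"
    by simp
next
  assume "\<bar>t\<bar> = 1"
  then have "t = 1 \<or> t = - 1"
    by linarith
  then show "circle_point t = 1"
    by (auto simp: circle_point_def complex_eq_iff)
qed

lemma circle_point_inj:
  assumes "\<bar>s\<bar> < 1" "\<bar>t\<bar> < 1" "circle_point s = circle_point t" shows "s = t"
proof -
  have "cis (pi * s) = cis (pi * t)"
    using assms(3) by (simp add: circle_point_def)
  moreover have "Arg (cis (pi * r)) = pi * r" if "\<bar>r\<bar> < 1" for r
    using that mult_strict_left_mono [of "- 1" r pi] by (intro Arg_cis) (auto simp: abs_less_iff)
  ultimately show ?thesis
    using assms by (metis mult_left_cancel pi_neq_zero)
qed

lemma circle_point_surj:
  assumes "norm w = 1" "w \<noteq> 1"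
  shows "\<exists>t. \<bar>t\<bar> < 1 \<and> circle_point t = w"
proof -
  define t where "t = Arg (- w) / pi"
  have "- w \<noteq> 0"
    using assms by auto
  then have "cis (Arg (- w)) = - w"
    using cis_Arg [of "- w"] assms(1) by (simp add: sgn_eq)
  then have w: "circle_point t = w"
    by (simp add: circle_point_def t_def)
  have "- pi < Arg (- w)" "Arg (- w) \<le> pi"
    using Arg_bounded by auto
  then have "\<bar>t\<bar> \<le> 1"
    by (simp add: t_def abs_le_iff field_simps)
  moreover have "\<bar>t\<bar> \<noteq> 1"
    using circle_point_eq_1_iff [OF \<open>\<bar>t\<bar> \<le> 1\<close>] w assms(2) by auto
  ultimately show ?thesis
    using w by (intro exI [of _ t]) auto
qed

lemma norm_circle_point: "norm (circle_point t) = 1"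
  by (simp add: circle_point_def)

text \<open>These are the product cells: \<open>S\<close> lists the factors contributing their
  1-cell, the others contribute the point 1. The dimension is \<open>card S\<close>.\<close>

definition torus_cell :: "nat \<Rightarrow> nat set \<Rightarrow> (nat \<Rightarrow> complex) set" where
  "torus_cell n S = {z \<in> torus_set n. \<forall>i\<in>{1..n}. z i \<noteq> 1 \<longleftrightarrow> i \<in> S}"

definition torus_char :: "nat \<Rightarrow> nat set \<Rightarrow> (nat \<Rightarrow> real) \<Rightarrow> (nat \<Rightarrow> complex)" where
  "torus_char n S y = (\<lambda>i\<in>{1..n}. if i \<in> S
     then circle_point (disc_to_cube (card S) y ((SOME h. bij_betw h S {..<card S}) i)) else 1)"

lemma index_bij:
  assumes "finite S" shows "bij_betw (SOME h. bij_betw h S {..<card S}) S {..<card S}"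
  using ex_bij_betw_finite_nat [OF assms] unfolding atLeast0LessThan by (rule someI_ex)

lemma torus_char_mem: "torus_char n S y \<in> torus_set n"
  by (auto simp: torus_char_def torus_set_def norm_circle_point)

lemma continuous_on_torus_char: "continuous_on (disc_set (card S)) (torus_char n S)"
proof (rule continuous_on_coordinatewise_then_product)
  fix i
  have c: "continuous_on (disc_set (card S)) (\<lambda>y. disc_to_cube (card S) y j)" for j
    using continuous_on_product_then_coordinatewise [OF continuous_on_disc_to_cube] by blast
  show "continuous_on (disc_set (card S)) (\<lambda>y. torus_char n S y i)"
    unfolding torus_char_def circle_point_def
    by (cases "i \<in> {1..n}"; cases "i \<in> S") (auto intro!: continuous_intros c)
qed

lemma torus_char_eq_1_iff:
  assumes S: "S \<subseteq> {1..n}" and y: "y \<in> disc_set (card S)" and i: "i \<in> S"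
  shows "torus_char n S y i = 1 \<longleftrightarrow>
    \<bar>disc_to_cube (card S) y ((SOME h. bij_betw h S {..<card S}) i)\<bar> = 1"
proof -
  have "\<bar>disc_to_cube (card S) y j\<bar> \<le> 1" for j
    using disc_to_cube_mem [OF y] by (cases "j < card S") (auto simp: cube_def)
  then show ?thesis
    using S i by (auto simp: torus_char_def circle_point_eq_1_iff)
qed

lemma disc_to_cube_interior:
  assumes "y \<in> disc_set k"
  shows "y \<in> disc_interior k \<longleftrightarrow> (\<forall>j<k. \<bar>disc_to_cube k y j\<bar> < 1)"
proof -
  have le: "eucl_norm k y \<le> 1"
    using assms by (simp add: mem_disc_set_iff)
  have "max_coord k (disc_to_cube k y) < 1 \<longleftrightarrow> eucl_norm k y < 1"
    unfolding norms_disc_to_cube [OF le] using disc_to_cube_denominator [OF le] by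
        (simp add: field_simps)
  then show ?thesis
    using assms by (simp add: disc_interior_iff max_coord_less_iff)
qed

lemma torus_char_mem_cell_iff:
  assumes S: "S \<subseteq> {1..n}" and y: "y \<in> disc_set (card S)"
  shows "torus_char n S y \<in> torus_cell n S \<longleftrightarrow> y \<in> disc_interior (card S)"
proof -
  let ?h = "SOME h. bij_betw h S {..<card S}"
  have h: "bij_betw ?h S {..<card S}"
    using S finite_subset by (intro index_bij) blast
  have le: "\<bar>disc_to_cube (card S) y j\<bar> \<le> 1" for j
    using disc_to_cube_mem [OF y] by (cases "j < card S") (auto simp: cube_def)
  have "torus_char n S y i = 1" if "i \<in> {1..n}" "i \<notin> S" for i
    using that by (simp add: torus_char_def)
  then have "torus_char n S y \<in> torus_cell n S \<longleftrightarrow> (\<forall>i\<in>S. torus_char n S y i \<noteq> 1)"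
    using S torus_char_mem [of n S y] unfolding torus_cell_def mem_Collect_eq by blast
  also have "\<dots> \<longleftrightarrow> (\<forall>i\<in>S. \<bar>disc_to_cube (card S) y (?h i)\<bar> \<noteq> 1)"
    using torus_char_eq_1_iff [OF S y] by simp
  also have "\<dots> \<longleftrightarrow> (\<forall>i\<in>S. \<bar>disc_to_cube (card S) y (?h i)\<bar> < 1)"
    using le by (simp add: less_le)
  also have "\<dots> \<longleftrightarrow> (\<forall>j\<in>{..<card S}. \<bar>disc_to_cube (card S) y j\<bar> < 1)"
    by (rule bij_betw_ball [OF h, symmetric])
  finally show ?thesis
    unfolding disc_to_cube_interior [OF y] Ball_def lessThan_iff .
qed

lemma torus_char_inj:
  assumes S: "S \<subseteq> {1..n}" shows "inj_on (torus_char n S) (disc_interior (card S))"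
proof (rule inj_onI)
  fix y y' assume y: "y \<in> disc_interior (card S)" "y' \<in> disc_interior (card S)"
    and eq: "torus_char n S y = torus_char n S y'"
  let ?h = "SOME h. bij_betw h S {..<card S}"
  have h: "bij_betw ?h S {..<card S}"
    using S finite_subset by (intro index_bij) blast
  have yd: "y \<in> disc_set (card S)" "y' \<in> disc_set (card S)"
    using y by (simp_all add: disc_interior_iff)
  have "disc_to_cube (card S) y j = disc_to_cube (card S) y' j" for j
  proof (cases "j < card S")
    case True
    then obtain i where i: "i \<in> S" "j = ?h i"
      using bij_betw_imp_surj_on [OF h] by (metis imageE lessThan_iff)
    have "i \<in> {1..n}"
      using S i(1) by (rule subsetD)
    then have "circle_point (disc_to_cube (card S) y j) = circle_point (disc_to_cube (card S) y' j)"
      using fun_cong [OF eq, of i] i by (simp add: torus_char_def)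
    then show ?thesis
      using disc_to_cube_interior [OF yd(1)] disc_to_cube_interior
          [OF yd(2)] y True circle_point_inj by blast
  next
    case False
    then show ?thesis
      using disc_to_cube_mem [OF yd(1)] disc_to_cube_mem [OF yd(2)] by (simp add: cube_def)
  qed
  then show "y = y'"
    using cube_to_disc_inverse [OF yd(1)] cube_to_disc_inverse [OF yd(2)] by (metis ext)
qed

lemma torus_char_surj:
  assumes S: "S \<subseteq> {1..n}" and z: "z \<in> torus_cell n S"
  shows "\<exists>y \<in> disc_interior (card S). torus_char n S y = z"
proof -
  let ?h = "SOME h. bij_betw h S {..<card S}"
  have h: "bij_betw ?h S {..<card S}"
    using S finite_subset by (intro index_bij) blast
  have "\<exists>t. \<bar>t\<bar> < 1 \<and> circle_point t = z i" if "i \<in> S" for i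
    using that z S by (intro circle_point_surj) (auto simp: torus_cell_def torus_set_def PiE_iff)
  then obtain t where t: "\<And>i. i \<in> S \<Longrightarrow> \<bar>t i\<bar> < 1 \<and> circle_point (t i) = z i"
    by metis
  define x where "x j = (if j < card S then t (the_inv_into S ?h j) else 0)" for j
  have xh: "x (?h i) = t i" if "i \<in> S" for i
    using bij_betw_apply [OF h that] the_inv_into_f_f [OF bij_betw_imp_inj_on [OF h] that]
    by (simp add: x_def)
  have lt: "\<bar>x j\<bar> < 1" if "j < card S" for j
  proof -
    have "j \<in> ?h ` S"
      using bij_betw_imp_surj_on [OF h] that by simp
    then obtain i where "i \<in> S" "j = ?h i"
      by (rule imageE)
    then show ?thesis
      using xh [of i] t [of i] by simp
  qed
  then have x: "x \<in> cube (card S)"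
    by (auto simp: cube_def x_def less_imp_le)
  define y where "y = cube_to_disc (card S) x"
  have y: "y \<in> disc_set (card S)" "disc_to_cube (card S) y = x"
    using cube_to_disc_mem [OF x] disc_to_cube_inverse by (simp_all add: y_def)
  have "y \<in> disc_interior (card S)"
    unfolding disc_to_cube_interior [OF y(1)] y(2) using lt by blast
  moreover have "torus_char n S y i = z i" for i
  proof (cases "i \<in> {1..n}")
    case True
    then show ?thesis
      using z xh t y(2) by (cases "i \<in> S") (auto simp: torus_char_def torus_cell_def)
  next
    case False
    then show ?thesis
      using z by (auto simp: torus_char_def torus_cell_def torus_set_def PiE_iff extensional_def)
  qed
  ultimately show ?thesis
    by blast
qed

text \<open>Continuity of the inverse needs no formula: a map from a compact to a Hausdorff space is
  closed, and it stays closed when restricted to the full preimage of the open cell, which is the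
  interior of the disc.\<close>

lemma torus_char_homeomorphic:
  assumes S: "S \<subseteq> {1..n}"
  shows "continuous_map (disc (card S)) (torus n) (torus_char n S)"
    and "homeomorphic_map (subtopology (disc (card S)) (disc_interior (card S)))
      (subtopology (torus n) (torus_cell n S)) (torus_char n S)"
proof -
  show cont: "continuous_map (disc (card S)) (torus n) (torus_char n S)"
    using continuous_on_torus_char torus_char_mem unfolding disc_eq torus_eq by auto
  have "closed_map (disc (card S)) (torus n) (torus_char n S)"
  proof (rule continuous_imp_closed_map [OF cont])
    show "compact_space (disc (card S))"
      by (simp add: disc_eq compact_space_subtopology compact_disc_set)
    show "Hausdorff_space (torus n)"
      unfolding torus_eq by (rule Hausdorff_space_subtopology [OF Hausdorff_space_euclidean])
  qed
  moreover have pre: "{y \<in> topspace (disc (card S)). torus_char n S y \<in> torus_cell n S}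
      = disc_interior (card S)"
    using torus_char_mem_cell_iff [OF S] by (auto simp: disc_eq disc_interior_iff)
  ultimately have closed: "closed_map (subtopology (disc (card S)) (disc_interior (card S)))
      (subtopology (torus n) (torus_cell n S)) (torus_char n S)"
    using closed_map_restriction by blast
  have top: "topspace (subtopology (disc (card S)) (disc_interior (card S))) = disc_interior
      (card S)"
    "topspace (subtopology (torus n) (torus_cell n S)) = torus_cell n S"
    by (auto simp: disc_interior_def torus_eq torus_cell_def)
  have int: "torus_char n S y \<in> torus_cell n S" if "y \<in> disc_interior (card S)" for y
    using that pre by blast
  show "homeomorphic_map (subtopology (disc (card S)) (disc_interior (card S)))
      (subtopology (torus n) (torus_cell n S)) (torus_char n S)"
  proof (rule bijective_closed_imp_homeomorphic_map [OF _ closed])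
    show "continuous_map (subtopology (disc (card S)) (disc_interior (card S)))
        (subtopology (torus n) (torus_cell n S)) (torus_char n S)"
      unfolding continuous_map_in_subtopology top
      using continuous_map_from_subtopology [OF cont] int by simp
    show "torus_char n S ` topspace (subtopology (disc (card S)) (disc_interior (card S))) =
        topspace (subtopology (torus n) (torus_cell n S))"
      unfolding top
    proof
      show "torus_char n S ` disc_interior (card S) \<subseteq> torus_cell n S"
        using int by (rule image_subsetI)
      show "torus_cell n S \<subseteq> torus_char n S ` disc_interior (card S)"
        using torus_char_surj [OF S] by (metis imageI subsetI)
    qed
    show "inj_on (torus_char n S) (topspace (subtopology (disc (card S)) (disc_interior (card S))))"
      unfolding top by (rule torus_char_inj [OF S])
  qed
qed

lemma torus_cell_disjoint:
  assumes "S \<subseteq> {1..n}" "T \<subseteq> {1..n}" "z \<in> torus_cell n S" "z \<in> torus_cell n T" shows "S = T"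
  using assms by (auto simp: torus_cell_def)

lemma torus_cell_cover: "z \<in> torus_set n \<Longrightarrow> z \<in> torus_cell n {i \<in> {1..n}. z i \<noteq> 1}"
  by (simp add: torus_cell_def)

text \<open>\<open>CW_structure\<close> attaches the characteristic map to the cell as a set, so
  \<open>S\<close> must be recoverable from it.\<close>

lemma torus_cell_index:
  assumes "S \<subseteq> {1..n}" shows "{i \<in> {1..n}. \<exists>z \<in> torus_cell n S. z i \<noteq> 1} = S"
proof -
  have "(\<lambda>i\<in>{1..n}. if i \<in> S then -1 else 1) \<in> torus_cell n S"
    by (auto simp: torus_cell_def torus_set_def)
  then show ?thesis
    using assms by (fastforce simp: torus_cell_def)
qed

lemma torus_char_boundary:
  assumes S: "S \<subseteq> {1..n}" and y: "y \<in> disc_boundary (card S)"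
  shows "\<exists>T. T \<subset> S \<and> torus_char n S y \<in> torus_cell n T"
proof -
  define T where "T = {i \<in> {1..n}. torus_char n S y i \<noteq> 1}"
  have mem: "torus_char n S y \<in> torus_cell n T"
    unfolding T_def by (intro torus_cell_cover torus_char_mem)
  have "T \<subseteq> S"
    by (auto simp: T_def torus_char_def)
  moreover have "T \<noteq> S"
    using torus_char_mem_cell_iff [OF S, of y] mem y by (auto simp: disc_boundary_iff
        disc_interior_iff)
  ultimately show ?thesis
    using mem by blast
qed

proposition CW_complex_torus: "CW_complex (torus n)"
proof -
  define E where "E k = torus_cell n ` {S. S \<subseteq> {1..n} \<and> card S = k}" for k
  define \<Phi> where "\<Phi> e = torus_char n {i \<in> {1..n}. \<exists>z\<in>e. z i \<noteq> 1}" for e :: "(nat \<Rightarrow> complex) set"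
  have \<Phi>: "\<Phi> (torus_cell n S) = torus_char n S" if "S \<subseteq> {1..n}" for S
    unfolding \<Phi>_def torus_cell_index [OF that] ..
  have E_iff: "e \<in> E k \<longleftrightarrow> (\<exists>S. S \<subseteq> {1..n} \<and> card S = k \<and> e = torus_cell n S)" for e k
    by (auto simp: E_def)
  have E_card: "torus_cell n S \<in> E (card S)" if "S \<subseteq> {1..n}" for S
    using that unfolding E_iff by (intro exI [of _ S]) simp
  have fin: "finite (\<Union>k. E k)"
  proof (rule finite_subset)
    show "(\<Union>k. E k) \<subseteq> torus_cell n ` Pow {1..n}"
      by (auto simp: E_def)
  qed simp
  have union: "(\<Union>k. \<Union>(E k)) = topspace (torus n)"
  proof (intro equalityI subsetI)
    fix z assume "z \<in> topspace (torus n)"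
    then have "z \<in> torus_cell n {i \<in> {1..n}. z i \<noteq> 1}"
      unfolding torus_eq topspace_euclidean_subtopology by (rule torus_cell_cover)
    moreover have "torus_cell n {i \<in> {1..n}. z i \<noteq> 1} \<in> E (card {i \<in> {1..n}. z i \<noteq> 1})"
      by (rule E_card) (rule Collect_restrict)
    ultimately show "z \<in> (\<Union>k. \<Union>(E k))"
      by blast
  next
    fix z assume "z \<in> (\<Union>k. \<Union>(E k))"
    then show "z \<in> topspace (torus n)"
      by (auto simp: E_def torus_cell_def torus_eq)
  qed
  have "CW_structure (torus n) E \<Phi>"
    unfolding CW_structure_def
  proof (intro conjI allI ballI impI)
    show "(\<Union>k. \<Union>(E k)) = topspace (torus n)"
      by (rule union)
  next
    fix m k d e assume "d \<in> E m" "e \<in> E k" and ne: "(m, d) \<noteq> (k, e)"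
    then obtain S T where "S \<subseteq> {1..n}" "card S = m" "d = torus_cell n S"
      "T \<subseteq> {1..n}" "card T = k" "e = torus_cell n T"
      unfolding E_iff by blast
    then show "disjnt d e"
      using ne torus_cell_disjoint [of S n T] unfolding disjnt_iff by blast
  next
    fix k e assume "e \<in> E k"
    then obtain S where S: "S \<subseteq> {1..n}" "card S = k" "e = torus_cell n S"
      unfolding E_iff by blast
    show "continuous_map (disc k) (torus n) (\<Phi> e)"
      using torus_char_homeomorphic(1) [OF S(1)] unfolding S(2,3) \<Phi> [OF S(1)] .
    show "homeomorphic_map (subtopology (disc k) (disc_interior k)) (subtopology (torus n) e) (\<Phi> e)"
      using torus_char_homeomorphic(2) [OF S(1)] unfolding S(2,3) \<Phi> [OF S(1)] .
    show "\<exists>F. finite F \<and> F \<subseteq> (\<Union>m<k. E m) \<and> \<Phi> e ` disc_boundary k \<subseteq> \<Union>F"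
    proof (intro exI conjI)
      have "finite S"
        using S(1) finite_subset by blast
      then show "finite (torus_cell n ` {T. T \<subset> S})"
        by (intro finite_imageI finite_subset [of "{T. T \<subset> S}" "Pow S"]) auto
      show "torus_cell n ` {T. T \<subset> S} \<subseteq> (\<Union>m<k. E m)"
      proof (rule image_subsetI)
        fix T assume "T \<in> {T. T \<subset> S}"
        then have "T \<subset> S"
          by simp
        then have "card T < k" "T \<subseteq> {1..n}"
          using psubset_card_mono [OF \<open>finite S\<close>] S by auto
        then show "torus_cell n T \<in> (\<Union>m<k. E m)"
          using E_card [of T] by blast
      qed
      show "\<Phi> e ` disc_boundary k \<subseteq> \<Union>(torus_cell n ` {T. T \<subset> S})"
      proof (rule image_subsetI)
        fix y assume "y \<in> disc_boundary k"
        then obtain T where "T \<subset> S" "torus_char n S y \<in> torus_cell n T"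
          using torus_char_boundary [OF S(1)] S(2) by blast
        then show "\<Phi> e y \<in> \<Union>(torus_cell n ` {T. T \<subset> S})"
          unfolding S(3) \<Phi> [OF S(1)] by blast
      qed
    qed
  next
    fix A assume A: "A \<subseteq> topspace (torus n)"
    show "closedin (torus n) A \<longleftrightarrow> (\<forall>k. \<forall>e\<in>E k. closedin (torus n) (A \<inter> torus n closure_of e))"
    proof
      assume cl: "\<forall>k. \<forall>e\<in>E k. closedin (torus n) (A \<inter> torus n closure_of e)"
      \<comment> \<open>The weak topology is automatic because there are finitely many cells:
        \<open>A\<close> is a finite union of closed sets.\<close>
      have "A = (\<Union>e \<in> (\<Union>k. E k). A \<inter> torus n closure_of e)"
      proof (intro equalityI subsetI)
        fix z assume z: "z \<in> A"
        then obtain k e where e: "e \<in> E k" "z \<in> e"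
          using A union by blast
        then have "e \<subseteq> topspace (torus n)"
          using union by blast
        then have "z \<in> torus n closure_of e"
          using closure_of_subset e(2) by blast
        then show "z \<in> (\<Union>e \<in> (\<Union>k. E k). A \<inter> torus n closure_of e)"
          using e z by blast
      qed blast
      moreover have "closedin (torus n) (\<Union>e \<in> (\<Union>k. E k). A \<inter> torus n closure_of e)"
        using cl fin by (intro closedin_Union) auto
      ultimately show "closedin (torus n) A"
        by simp
    qed (simp add: closedin_Int)
  qed
  moreover have "Hausdorff_space (torus n)"
    unfolding torus_eq by (rule Hausdorff_space_subtopology [OF Hausdorff_space_euclidean])
  ultimately show ?thesis
    unfolding CW_complex_def by blast
qed


section \<open>Whitehead's theorem\<close>

lemma HELP_of_torus_equivalences:
  assumes "\<And>n. equivalence_of_categories (Hot (torus n) X) (Hot (torus n) Y)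
      (postcomp_obj (torus n) f) (postcomp_arr (torus n) Y f)"
  shows "HELP X Y f (top_of_set (torus_set n \<times> cube k)) (UNIV \<times> cube_boundary k)"
  by (rule HELP_torus_cube [OF HELP_torus_cube_0 [OF HELP_empty [OF assms]]
        HELP_torus_cube_1 [OF HELP_interval [OF assms]]])

lemma CW_HELP_point:
  assumes "CW_complex K"
    and "\<And>k. HELP X Y f (top_of_set (torus_set 0 \<times> cube k)) (UNIV \<times> cube_boundary k)"
  shows "HELP X Y f (prod_topology K (top_of_set {0::real})) (UNIV \<times> {})"
proof -
  obtain E \<Phi> where "CW_structure K E \<Phi>"
    using assms(1) by (auto simp: CW_complex_def)
  then show ?thesis
    using assms(1) by (intro HELP_CW [OF _ _ _ _ _ HELP_disc [OF assms(2)]])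
        (auto simp: CW_complex_def)
qed

lemma CW_HELP_interval:
  assumes "CW_complex K"
    and "\<And>k. HELP X Y f (top_of_set (torus_set 0 \<times> cube k)) (UNIV \<times> cube_boundary k)"
  shows "HELP X Y f (prod_topology K unit_interval) (UNIV \<times> {0, 1})"
proof -
  obtain E \<Phi> where "CW_structure K E \<Phi>"
    using assms(1) by (auto simp: CW_complex_def)
  then show ?thesis
    using assms(1) by (intro HELP_CW [OF _ _ _ _ _ HELP_disc_interval [OF assms(2)]])
        (auto simp: CW_complex_def)
qed

lemma isomorphic_objects_Hot:
  "u \<in> maps G X \<Longrightarrow> v \<in> maps G X \<Longrightarrow> H \<in> homotopies G X u v \<Longrightarrow> isomorphic_objects (Hot G X) u v"
  using is_iso_Hot unfolding isomorphic_objects_def Obj_Hot by blast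

proposition HELP_imp_Hot_equivalence:
  assumes X: "CW_complex X" and Y: "CW_complex Y" and f: "f \<in> maps X Y"
    and HELP: "\<And>k. HELP X Y f (top_of_set (torus_set 0 \<times> cube k)) (UNIV \<times> cube_boundary k)"
  shows "Hot_equivalence X Y f"
proof -
  let ?Y0 = "prod_topology Y (top_of_set {0::real})"
  \<comment> \<open>Over the empty set any function is a lift. Lifting the identity of
    \<open>Y\<close>, here as \<open>fst\<close>, then yields \<open>g\<close> and the homotopy
    \<open>h\<close> from the identity to \<open>f\<close> after \<open>g\<close>.\<close>
  have "path_lift X Y f (subtopology ?Y0 (UNIV \<times> {})) fst undefined"
    by (simp add: path_lift_def)
  then obtain \<tau> where \<tau>: "path_lift X Y f ?Y0 fst \<tau>"
    using HELPD [OF CW_HELP_point [OF Y HELP] continuous_map_fst] by blast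
  have "continuous_map Y ?Y0 (\<lambda>y. (y, 0))"
    by (intro continuous_map_pairedI) auto
  from path_lift_compose [OF \<tau> this]
  have \<sigma>: "path_lift X Y f Y (\<lambda>y. y) (\<lambda>y. \<tau> (y, 0))"
    by simp
  define g where "g = restrict (\<lambda>y. fst (\<tau> (y, 0))) (topspace Y)"
  define h where "h = (\<lambda>p. snd (\<tau> (fst p, 0)) (snd p))"
  have "continuous_map Y X g"
    by (rule continuous_map_eq [where f = "\<lambda>y. fst (\<tau> (y, 0))"])
        (use \<sigma> in \<open>auto simp: path_lift_def g_def\<close>)
  then have g: "g \<in> maps Y X"
    by (simp add: maps_def g_def)
  have h: "continuous_map (prod_topology Y unit_interval) Y h"
    and h0: "\<And>y. y \<in> topspace Y \<Longrightarrow> h (y, 0) = y" and h1: "\<And>y. y \<in> topspace Y \<Longrightarrow> h (y, 1) = f (g y)"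
    using \<sigma> by (simp_all add: path_lift_def g_def h_def)
  have fX: "f x \<in> topspace Y" if "x \<in> topspace X" for x
    using f that by (auto simp: maps_def continuous_map_def)
  have fc: "continuous_map X Y f" and gc: "continuous_map Y X g"
    using f g by (simp_all add: maps_def)
  have idX: "(\<lambda>x \<in> topspace X. x) \<in> maps X X" and idY: "(\<lambda>y \<in> topspace Y. y) \<in> maps Y Y"
    using continuous_map_eq [OF continuous_map_id, of X "\<lambda>x \<in> topspace X. x"]
      continuous_map_eq [OF continuous_map_id, of Y "\<lambda>x \<in> topspace Y. x"] by
          (simp_all add: maps_def)
  have gf: "compose (topspace X) g f \<in> maps X X" and fg: "compose (topspace Y) f g \<in> maps Y Y"
    using continuous_map_eq [OF continuous_map_compose [OF fc gc], of "compose (topspace X) g f"]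
      continuous_map_eq [OF continuous_map_compose [OF gc fc], of "compose (topspace Y) f g"]
    by (simp_all add: maps_def compose_def)

  have "continuous_map (prod_topology Y unit_interval) Y (restrict h (topspace Y \<times> {0..1}))"
    by (rule continuous_map_eq [OF h]) simp
  then have "restrict h (topspace Y \<times> {0..1}) \<in> homotopies Y Y (\<lambda>y \<in> topspace Y. y) (compose
      (topspace Y) f g)"
    by (simp add: homotopies_def maps_def h0 h1 compose_def)
  then have "compose (topspace Y) f g \<in> maps Y Y \<and> isomorphic_objects (Hot Y Y) (compose
      (topspace Y) f g) (\<lambda>y \<in> topspace Y. y)"
    using isomorphic_objects_Hot [OF fg idY concat_reverse(1)] fg by blast
  moreover
  have "isomorphic_objects (Hot X X) (compose (topspace X) g f) (\<lambda>x \<in> topspace X. x)"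
  proof -
    let ?XI = "prod_topology X unit_interval"
    \<comment> \<open>Running \<open>h\<close> on the image of \<open>f\<close> gives a homotopy
      from \<open>f\<close> to \<open>f\<close> after \<open>g\<close> after \<open>f\<close>. Its
      two ends lift to the identity of \<open>X\<close> and to \<open>g\<close> after
      \<open>f\<close>, so lifting \<open>b\<close> relative to the ends connects these two maps in
      \<open>X\<close>.\<close>
    define b where "b p = h (f (fst p), snd p)" for p
    have b: "continuous_map ?XI Y b"
      unfolding b_def
      using continuous_map_compose [OF continuous_map_fst fc]
      by (intro continuous_map_apply_pair [OF h] continuous_map_snd) (simp add: o_def)
    text \<open>On \<open>X \<times> {0,1}\<close> the map \<open>b\<close> is \<open>f \<circ> s\<close> for the map \<open>s\<close> below, with the constant homotopy.\<close>
    define s where "s p = (if snd p = 0 then fst p else g (f (fst p)))" for p :: "'a \<times> real"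
    define \<sigma>' where "\<sigma>' p = (s p, \<lambda>_ :: real. f (s p))" for p
    have "path_lift X Y f (subtopology ?XI (UNIV \<times> {0, 1})) b \<sigma>'"
    proof (rule path_lift_paste [where I = "{0, 1::real}" and T = "\<lambda>e. topspace X \<times> {e}"])
      fix e :: real assume e: "e \<in> {0, 1}"
      have "closedin unit_interval {e}"
        using e by (auto simp: closedin_closed_eq [of "{0..1}"] intro!: closed_subset)
      then have "closedin ?XI (topspace X \<times> {e})"
        by (simp add: closedin_prod_Times_iff)
      then show "closedin (subtopology ?XI (UNIV \<times> {0, 1})) (topspace X \<times> {e})"
        using e by (intro closedin_subset_topspace) auto
      let ?K = "subtopology (subtopology ?XI (UNIV \<times> {0, 1})) (topspace X \<times> {e})"
      have fst: "continuous_map ?K X fst"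
        by (intro continuous_map_from_subtopology continuous_map_fst)
      have top: "snd p = e" "fst p \<in> topspace X" if "p \<in> topspace ?K" for p
        using that by auto
      have s: "continuous_map ?K X s"
      proof (cases "e = 0")
        case True
        show ?thesis
          by (rule continuous_map_eq [OF fst]) (use top True in \<open>simp add: s_def\<close>)
      next
        case False
        show ?thesis
          by (rule continuous_map_eq [OF continuous_map_compose [OF fst continuous_map_compose
              [OF fc gc]]])
            (use top False in \<open>simp add: s_def\<close>)
      qed
      have "continuous_map (prod_topology ?K unit_interval) Y (f \<circ> (s \<circ> fst))"
        by (intro continuous_map_compose [OF _ fc] continuous_map_compose [OF continuous_map_fst s])
      moreover have "f (s p) = b p" if "p \<in> topspace ?K" for p
        using top [OF that] e fX h0 h1 by (auto simp: s_def b_def)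
      ultimately show "path_lift X Y f ?K b \<sigma>'"
        using s by (simp add: path_lift_def \<sigma>'_def o_def)
    qed auto
    then obtain \<upsilon> where \<upsilon>: "path_lift X Y f ?XI b \<upsilon>"
      "\<And>p. p \<in> topspace ?XI \<Longrightarrow> p \<in> UNIV \<times> {0, 1} \<Longrightarrow> \<upsilon> p = \<sigma>' p"
      using HELPD [OF CW_HELP_interval [OF X HELP] b] by blast
    define H where "H = restrict (\<lambda>p. fst (\<upsilon> p)) (topspace X \<times> {0..1})"
    have "continuous_map ?XI X H"
      by (rule continuous_map_eq [where f = "\<lambda>p. fst (\<upsilon> p)"])
          (use \<upsilon>(1) in \<open>auto simp: path_lift_def H_def\<close>)
    then have "H \<in> homotopies X X (\<lambda>x \<in> topspace X. x) (compose (topspace X) g f)"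
      using \<upsilon>(2) by (simp add: homotopies_def maps_def H_def \<sigma>'_def s_def compose_def)
    then show ?thesis
      using isomorphic_objects_Hot [OF gf idX concat_reverse(1)] by blast
  qed
  ultimately show ?thesis
    unfolding Hot_equivalence_def using f g by auto
qed

theorem theorem0p7:
  shows "Hot_strong_generator TYPE('a) TYPE('b) (range torus)"
  unfolding Hot_strong_generator_def
proof (intro conjI ballI allI impI)
  fix G :: "(nat \<Rightarrow> complex) topology"
  assume "G \<in> range torus"
  then show "CW_complex G"
    using CW_complex_torus by auto
next
  fix X :: "'a topology" and Y :: "'b topology" and f :: "'a \<Rightarrow> 'b"
  assume X: "CW_complex X" and Y: "CW_complex Y" and f: "f \<in> Obj (Hot X Y)"
    and eq: "\<forall>G \<in> range torus. equivalence_of_categories (Hot G X) (Hot G Y)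
      (postcomp_obj G f) (postcomp_arr G Y f)"
  have "HELP X Y f (top_of_set (torus_set 0 \<times> cube k)) (UNIV \<times> cube_boundary k)" for k
    by (rule HELP_of_torus_equivalences) (use eq in blast)
  then show "Hot_equivalence X Y f"
    using HELP_imp_Hot_equivalence [OF X Y] f by simp
qed

end
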